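(* Let $d\ge1$, $\Omega=[0,1]^d$, $f\in L^2(\Omega)$, and let $V$ be a twice weakly differentiable function with $V,\nabla V,\Delta V\in L^\infty(\Omega)$ satisfying, for a.e. $x\in\Omega$, $0<C_{\min}< V(x)\le V_{\max}$, $0<C_{\min}<V(x)^2-\Delta V(x)$ and $-\Delta V(x)\le V_{\max}$. Let $u^\ast\in H^1_0(\Omega)\cap H^2(\Omega)$ be the solution of $-\Delta u+Vu=f$ in $\Omega$, $u=0$ on $\partial\Omega$, which is the minimizer over $H_0^1(\Omega)\cap H^2(\Omega)$ of $$\mathcal E^{\mathrm{PINN}}(u):=\int_\Omega|\Delta u-Vu+f|^2\,dx .$$ Then for every $u\in H^1_0(\Omega)\cap H^2(\Omega)$, $$\min\{1,C_{\min}\}\,\|u-u^\ast\|_{H^2(\Omega)}^2\le \mathcal E^{\mathrm{PINN}}(u)-\mathcal E^{\mathrm{PINN}}(u^\ast)\le 2\big(1+V_{\max}+V_{\max}^2\big)\|u-u^\ast\|_{H^2(\Omega)}^2 .$$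
   Context: $\|v\|_{H^2(\Omega)}^2=\sum_{|\alpha|\le 2}\|D^\alpha v\|_{L^2(\Omega)}^2$. $H^1_0(\Omega)$ is the closure of $C^1_c(\Omega)$ in $H^1(\Omega)$. *)

theory Defs
  imports "HOL-Analysis.Analysis"
begin

definition unit_cube :: "(real^'n) set" where
  "unit_cube = cbox 0 (\<chi> i. 1)"

definition cpartial :: "(real^'n \<Rightarrow> real) \<Rightarrow> 'n \<Rightarrow> real^'n \<Rightarrow> real" where
  "cpartial \<phi> i = (\<lambda>x. frechet_derivative \<phi> (at x) (axis i 1))"

text \<open>Classical iterated derivative D^alpha of order k = |alpha| (for smooth
  functions the order of differentiation is irrelevant).\<close>
primrec cDk :: "nat \<Rightarrow> ('n \<Rightarrow> nat) \<Rightarrow> (real^'n \<Rightarrow> real) \<Rightarrow> real^'n \<Rightarrow> real" where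
  "cDk 0 \<alpha> \<phi> = \<phi>"
| "cDk (Suc k) \<alpha> \<phi> =
     (let i = (SOME i. 0 < \<alpha> i) in cpartial (cDk k (\<alpha>(i := \<alpha> i - 1)) \<phi>) i)"

definition mi_order :: "('n::finite \<Rightarrow> nat) \<Rightarrow> nat" where
  "mi_order \<alpha> = (\<Sum>i\<in>UNIV. \<alpha> i)"

definition cD :: "('n::finite \<Rightarrow> nat) \<Rightarrow> (real^'n \<Rightarrow> real) \<Rightarrow> real^'n \<Rightarrow> real" where
  "cD \<alpha> \<phi> = cDk (mi_order \<alpha>) \<alpha> \<phi>"

definition tsupp :: "(real^'n \<Rightarrow> real) \<Rightarrow> (real^'n) set" where
  "tsupp \<phi> = closure {x. \<phi> x \<noteq> 0}"

definition test_fun :: "(real^'n::finite) set \<Rightarrow> (real^'n \<Rightarrow> real) \<Rightarrow> bool" where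
  "test_fun \<Omega> \<phi> \<longleftrightarrow>
     (\<forall>\<alpha>. (\<forall>x. cD \<alpha> \<phi> differentiable (at x)) \<and> continuous_on UNIV (cD \<alpha> \<phi>))
     \<and> compact (tsupp \<phi>) \<and> tsupp \<phi> \<subseteq> interior \<Omega>"

definition C1c :: "(real^'n::finite) set \<Rightarrow> (real^'n \<Rightarrow> real) \<Rightarrow> bool" where
  "C1c \<Omega> \<phi> \<longleftrightarrow>
     (\<forall>x. \<phi> differentiable (at x)) \<and> (\<forall>i. continuous_on UNIV (cpartial \<phi> i))
     \<and> compact (tsupp \<phi>) \<and> tsupp \<phi> \<subseteq> interior \<Omega>"

definition loc_int :: "(real^'n::finite) set \<Rightarrow> (real^'n \<Rightarrow> real) \<Rightarrow> bool" where
  "loc_int \<Omega> u \<longleftrightarrow> u \<in> borel_measurable (lebesgue_on \<Omega>) \<and>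
     (\<forall>K. compact K \<and> K \<subseteq> interior \<Omega> \<longrightarrow> integrable (lebesgue_on K) u)"

definition L2 :: "(real^'n::finite) set \<Rightarrow> (real^'n \<Rightarrow> real) \<Rightarrow> bool" where
  "L2 \<Omega> u \<longleftrightarrow> u \<in> borel_measurable (lebesgue_on \<Omega>) \<and>
     integrable (lebesgue_on \<Omega>) (\<lambda>x. (u x)\<^sup>2)"

definition Linf :: "(real^'n::finite) set \<Rightarrow> (real^'n \<Rightarrow> real) \<Rightarrow> bool" where
  "Linf \<Omega> u \<longleftrightarrow> u \<in> borel_measurable (lebesgue_on \<Omega>) \<and>
     (\<exists>C. AE x in lebesgue_on \<Omega>. \<bar>u x\<bar> \<le> C)"

definition weak_deriv :: "(real^'n::finite) set \<Rightarrow> ('n \<Rightarrow> nat) \<Rightarrow> (real^'n \<Rightarrow> real)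
    \<Rightarrow> (real^'n \<Rightarrow> real) \<Rightarrow> bool" where
  "weak_deriv \<Omega> \<alpha> u v \<longleftrightarrow> loc_int \<Omega> u \<and> loc_int \<Omega> v \<and>
     (\<forall>\<phi>. test_fun \<Omega> \<phi> \<longrightarrow>
        (\<integral>x. u x * cD \<alpha> \<phi> x \<partial>lebesgue_on \<Omega>)
          = (-1) ^ mi_order \<alpha> * (\<integral>x. v x * \<phi> x \<partial>lebesgue_on \<Omega>))"

definition wD :: "(real^'n::finite) set \<Rightarrow> ('n \<Rightarrow> nat) \<Rightarrow> (real^'n \<Rightarrow> real) \<Rightarrow> real^'n \<Rightarrow> real" where
  "wD \<Omega> \<alpha> u = (SOME v. weak_deriv \<Omega> \<alpha> u v)"

definition Hk :: "nat \<Rightarrow> (real^'n::finite) set \<Rightarrow> (real^'n \<Rightarrow> real) \<Rightarrow> bool" where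
  "Hk k \<Omega> u \<longleftrightarrow> L2 \<Omega> u \<and>
     (\<forall>\<alpha>. mi_order \<alpha> \<le> k \<longrightarrow> (\<exists>v. weak_deriv \<Omega> \<alpha> u v \<and> L2 \<Omega> v))"

definition Hk_norm_sq :: "nat \<Rightarrow> (real^'n::finite) set \<Rightarrow> (real^'n \<Rightarrow> real) \<Rightarrow> real" where
  "Hk_norm_sq k \<Omega> u =
     (\<Sum>\<alpha>\<in>{\<alpha>. mi_order \<alpha> \<le> k}. \<integral>x. (wD \<Omega> \<alpha> u x)\<^sup>2 \<partial>lebesgue_on \<Omega>)"

definition H10 :: "(real^'n::finite) set \<Rightarrow> (real^'n \<Rightarrow> real) \<Rightarrow> bool" where
  "H10 \<Omega> u \<longleftrightarrow> Hk 1 \<Omega> u \<and>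
     (\<exists>\<psi> :: nat \<Rightarrow> real^'n \<Rightarrow> real. (\<forall>m. C1c \<Omega> (\<psi> m)) \<and>
        (\<lambda>m. Hk_norm_sq 1 \<Omega> (\<lambda>x. \<psi> m x - u x)) \<longlonglongrightarrow> 0)"

definition wlap :: "(real^'n::finite) set \<Rightarrow> (real^'n \<Rightarrow> real) \<Rightarrow> real^'n \<Rightarrow> real" where
  "wlap \<Omega> u = (\<lambda>x. \<Sum>i\<in>UNIV. wD \<Omega> (\<lambda>k. if k = i then 2 else 0) u x)"

definition E_PINN :: "(real^'n::finite) set \<Rightarrow> (real^'n \<Rightarrow> real) \<Rightarrow> (real^'n \<Rightarrow> real)
    \<Rightarrow> (real^'n \<Rightarrow> real) \<Rightarrow> real" where
  "E_PINN \<Omega> V f u = (\<integral>x. (wlap \<Omega> u x - V x * u x + f x)\<^sup>2 \<partial>lebesgue_on \<Omega>)"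

end

theory Submission
  imports Defs
begin

text \<open>
  Put \<open>w = u - ustar\<close>. Since the residual of \<open>ustar\<close> vanishes, the energy gap is the integral of
  \<open>(lap w - V w)^2\<close>, and formally two integrations by parts turn it into
  \<open>sum_ij |D_ij w|^2 + 2 V |grad w|^2 + (V^2 - lap V) w^2\<close>, from which both bounds are read off
  (each mixed derivative is counted once in the norm and twice in the double sum).

  To justify this on the cube, \<open>w\<close> is approximated by the partial sums of its sine series. Sine
  polynomials satisfy the identity exactly. Because \<open>w\<close> has zero trace, the sine coefficients of
  \<open>D_ii w\<close> are \<open>-(k_i pi)^2\<close> times those of \<open>w\<close>, so the pure second derivatives of the partial sums
  converge in \<open>L2\<close>. The mixed ones are Cauchy since \<open>|D_ij s|^2\<close> and \<open>D_ii s * D_jj s\<close> have the same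
  integral for a sine polynomial \<open>s\<close>, and their limit is identified by uniqueness of weak
  derivatives. For the potential only \<open>lap (s^2)\<close> is tested against \<open>V\<close>: \<open>s^2\<close> vanishes to second order
  on the boundary, so smooth cutoffs can be removed by dominated convergence and the gradient of \<open>V\<close>
  never enters.
\<close>

section \<open>Smooth functions of one variable\<close>

text \<open>Two obstacles block the formal computation. \<open>w\<close> has only two weak
  derivatives, so a double integration by parts, which passes through third derivatives, has no
  direct meaning; and an approximation of \<open>w\<close> must respect the boundary condition on a
  domain with edges. Sines settle both: on a face orthogonal to direction i all even derivatives in
  that direction vanish, so every boundary term has a zero factor, and \<open>D_ii\<close>
  multiplies each sine product by a constant. Zero trace enters only in \<open>H10_by_parts\<close>,
  where \<open>D_i u\<close> is tested with smooth functions that need not vanish on the boundary.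

  For \<open>V\<close>, the sum of the \<open>D_ii V\<close> is bounded, but each of them is only
  locally integrable; the sum is therefore kept together in the limits.

  With \<open>B\<close>, \<open>A\<close>, \<open>S\<close> the squared L2 norms of order 0, 1 and
  2, the gap is bounded below with coefficients \<open>Cmin\<close>, \<open>2 * Cmin\<close>,
  \<open>1\<close> and above with \<open>Vmax^2 + Vmax\<close>, \<open>2 * Vmax\<close>,
  \<open>2\<close>; the constants of the theorem are a common lower and a common upper bound of
  these.\<close>

primrec ntimes_diff :: "nat \<Rightarrow> (real \<Rightarrow> real) \<Rightarrow> bool" where
  "ntimes_diff 0 f \<longleftrightarrow> True"
| "ntimes_diff (Suc n) f \<longleftrightarrow>
     (\<exists>f'. (\<forall>x. (f has_real_derivative f' x) (at x)) \<and> ntimes_diff n f')"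

definition smooth_real :: "(real \<Rightarrow> real) \<Rightarrow> bool" where
  "smooth_real f \<longleftrightarrow> (\<forall>n. ntimes_diff n f)"

lemma ntimes_diff_SucD: "ntimes_diff (Suc n) f \<Longrightarrow> ntimes_diff n f"
proof (induction n arbitrary: f)
  case (Suc n)
  then obtain f' where "\<forall>x. (f has_real_derivative f' x) (at x)" "ntimes_diff (Suc n) f'"
    by (subst (asm) (2) ntimes_diff.simps(2)) blast
  then show ?case
    using Suc.IH unfolding ntimes_diff.simps(2)[of n f] by blast
qed simp

lemma ntimes_diff_const: "ntimes_diff n (\<lambda>x. c)"
proof (induction n arbitrary: c)
  case (Suc n)
  show ?case
    using Suc.IH[of 0] by (auto intro!: exI[of _ "\<lambda>x. 0"])
qed simp

lemma ntimes_diff_ident: "ntimes_diff n (\<lambda>x. x)"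
  by (cases n) (auto intro!: exI[of _ "\<lambda>x. 1"] ntimes_diff_const)

lemma ntimes_diff_add:
  "ntimes_diff n f \<Longrightarrow> ntimes_diff n g \<Longrightarrow> ntimes_diff n (\<lambda>x. f x + g x)"
proof (induction n arbitrary: f g)
  case (Suc n)
  then obtain f' g' where "\<forall>x. (f has_real_derivative f' x) (at x)" "ntimes_diff n f'"
    "\<forall>x. (g has_real_derivative g' x) (at x)" "ntimes_diff n g'"
    by auto
  then show ?case
    using Suc.IH by (auto intro!: exI[of _ "\<lambda>x. f' x + g' x"] derivative_eq_intros)
qed simp

lemma ntimes_diff_mult:
  "ntimes_diff n f \<Longrightarrow> ntimes_diff n g \<Longrightarrow> ntimes_diff n (\<lambda>x. f x * g x)"
proof (induction n arbitrary: f g)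
  case (Suc n)
  then obtain f' g' where *: "\<forall>x. (f has_real_derivative f' x) (at x)" "ntimes_diff n f'"
    "\<forall>x. (g has_real_derivative g' x) (at x)" "ntimes_diff n g'"
    by auto
  have "ntimes_diff n f" "ntimes_diff n g"
    using Suc.prems by (auto intro: ntimes_diff_SucD simp del: ntimes_diff.simps)
  then have "ntimes_diff n (\<lambda>x. f' x * g x + f x * g' x)"
    using Suc.IH * by (intro ntimes_diff_add) auto
  then show ?case
    using * by (auto intro!: exI[of _ "\<lambda>x. f' x * g x + f x * g' x"] derivative_eq_intros)
qed simp

lemma ntimes_diff_compose:
  "ntimes_diff n f \<Longrightarrow> ntimes_diff n g \<Longrightarrow> ntimes_diff n (\<lambda>x. f (g x))"
proof (induction n arbitrary: f g)
  case (Suc n)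
  then obtain f' g' where *: "\<forall>x. (f has_real_derivative f' x) (at x)" "ntimes_diff n f'"
    "\<forall>x. (g has_real_derivative g' x) (at x)" "ntimes_diff n g'"
    by auto
  have "ntimes_diff n g"
    using Suc.prems by (auto intro: ntimes_diff_SucD simp del: ntimes_diff.simps)
  then have "ntimes_diff n (\<lambda>x. f' (g x) * g' x)"
    using Suc.IH * by (intro ntimes_diff_mult) auto
  moreover have "((\<lambda>x. f (g x)) has_real_derivative f' (g x) * g' x) (at x)" for x
    using * by (intro DERIV_chain2[of f]) auto
  ultimately show ?case
    unfolding ntimes_diff.simps(2) by (intro exI[of _ "\<lambda>x. f' (g x) * g' x"]) blast
qed simp

text \<open>The derivative of \<open>inverse f\<close> again contains \<open>inverse f\<close>, but
  only to order \<open>n\<close>, which the induction hypothesis supplies for the same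
  \<open>f\<close>.\<close>

lemma ntimes_diff_inverse:
  "ntimes_diff n f \<Longrightarrow> (\<And>x. f x \<noteq> 0) \<Longrightarrow> ntimes_diff n (\<lambda>x. inverse (f x))"
proof (induction n arbitrary: f)
  case (Suc n)
  then obtain f' where *: "\<forall>x. (f has_real_derivative f' x) (at x)" "ntimes_diff n f'"
    by auto
  have "ntimes_diff n f"
    using Suc.prems by (auto intro: ntimes_diff_SucD simp del: ntimes_diff.simps)
  then have i: "ntimes_diff n (\<lambda>x. inverse (f x))"
    using Suc.IH Suc.prems by blast
  have "ntimes_diff n (\<lambda>x. (- 1) * (inverse (f x) * f' x * inverse (f x)))"
    by (intro ntimes_diff_mult ntimes_diff_const i *)
  moreover have "((\<lambda>x. inverse (f x)) has_real_derivative
      (- 1) * (inverse (f x) * f' x * inverse (f x))) (at x)" for x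
    using * Suc.prems by (auto intro!: derivative_eq_intros)
  ultimately show ?case by (auto intro!: exI)
qed simp

lemma smooth_real_intros:
  "smooth_real (\<lambda>x. c)" "smooth_real (\<lambda>x. x)"
  "smooth_real f \<Longrightarrow> smooth_real g \<Longrightarrow> smooth_real (\<lambda>x. f x + g x)"
  "smooth_real f \<Longrightarrow> smooth_real g \<Longrightarrow> smooth_real (\<lambda>x. f x * g x)"
  "smooth_real f \<Longrightarrow> smooth_real g \<Longrightarrow> smooth_real (\<lambda>x. f (g x))"
  "smooth_real f \<Longrightarrow> (\<And>x. f x \<noteq> 0) \<Longrightarrow> smooth_real (\<lambda>x. inverse (f x))"
  by (simp_all add: smooth_real_def ntimes_diff_const ntimes_diff_ident ntimes_diff_add
      ntimes_diff_mult ntimes_diff_compose ntimes_diff_inverse)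

lemma smooth_real_diff:
  assumes "smooth_real f" "smooth_real g" shows "smooth_real (\<lambda>x. f x - g x)"
proof -
  have "smooth_real (\<lambda>x. f x + (-1) * g x)"
    using assms by (intro smooth_real_intros(1,3,4))
  then show ?thesis by simp
qed

lemma smooth_real_deriv:
  assumes "smooth_real f"
  shows "(f has_real_derivative deriv f x) (at x)" and "smooth_real (deriv f)"
proof -
  obtain f' where f': "\<forall>x. (f has_real_derivative f' x) (at x)"
    using assms unfolding smooth_real_def by (metis ntimes_diff.simps(2))
  then have eq: "deriv f = f'"
    by (auto intro: DERIV_imp_deriv)
  then show "(f has_real_derivative deriv f x) (at x)" using f' by simp
  show "smooth_real (deriv f)"
    unfolding smooth_real_def
  proof
    fix n
    have "ntimes_diff (Suc n) f"
      using assms unfolding smooth_real_def by blast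
    then obtain g where "\<forall>x. (f has_real_derivative g x) (at x)" "ntimes_diff n g"
      by auto
    moreover from this have "deriv f = g"
      by (auto intro: DERIV_imp_deriv)
    ultimately show "ntimes_diff n (deriv f)" by simp
  qed
qed

lemma smooth_real_cong_deriv:
  assumes "smooth_real f" "\<And>x. (f has_real_derivative f' x) (at x)"
  shows "smooth_real f'"
proof -
  have "deriv f = f'" using assms(2) by (auto intro: DERIV_imp_deriv)
  then show ?thesis using smooth_real_deriv(2)[OF assms(1)] by simp
qed

lemma smooth_real_continuous: "smooth_real f \<Longrightarrow> continuous_on A f"
  using smooth_real_deriv(1) by (meson DERIV_isCont continuous_at_imp_continuous_on)

text \<open>Differentiation shifts the phase by pi / 2 and scales the amplitude by \<open>a\<close>,
  so the family is closed under it; this is why phase and amplitude vary in the induction.\<close>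

lemma smooth_real_sin: "smooth_real (\<lambda>x. c * sin (a * x + b))"
proof -
  have "ntimes_diff n (\<lambda>x. c * sin (a * x + b))" for n
  proof (induction n arbitrary: b c)
    case (Suc n)
    have "((\<lambda>x. c * sin (a * x + b)) has_real_derivative (c * a) * sin (a * x + (b + pi / 2))) (at x)" for x
    proof -
      have "sin (a * x + (b + pi / 2)) = cos (a * x + b)"
        by (simp add: sin_add cos_add algebra_simps)
      then show ?thesis by (auto intro!: derivative_eq_intros)
    qed
    then show ?case using Suc.IH[of "c * a" "b + pi/2"] by (auto intro!: exI)
  qed simp
  then show ?thesis by (simp add: smooth_real_def)
qed

section \<open>The flat exponential and a smooth step\<close>

definition flat_exp :: "nat \<Rightarrow> real \<Rightarrow> real" where
  "flat_exp k x = (if 0 < x then exp (- inverse x) * inverse x ^ k else 0)"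

text \<open>From the right, \<open>y = 1 / x\<close> tends to infinity and the exponential beats
  every power of \<open>y\<close>.\<close>

lemma flat_exp_tendsto_0: "((\<lambda>x. flat_exp k x) \<longlongrightarrow> 0) (at 0)"
proof (rule filterlim_split_at)
  show "(flat_exp k \<longlongrightarrow> 0) (at_left 0)"
    by (rule tendsto_eventually) (auto simp: flat_exp_def eventually_at_filter)
  have "((\<lambda>y::real. y ^ k / exp y) \<longlongrightarrow> 0) at_top"
    by (rule tendsto_power_div_exp_0)
  then have "((\<lambda>x::real. inverse x ^ k / exp (inverse x)) \<longlongrightarrow> 0) (at_right 0)"
    by (rule filterlim_compose) (rule filterlim_inverse_at_top_right)
  then show "(flat_exp k \<longlongrightarrow> 0) (at_right 0)"
    by (rule Lim_transform_eventually)
      (auto simp: eventually_at_filter flat_exp_def exp_minus field_simps)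
qed

text \<open>The powers of \<open>inverse x\<close> are built into \<open>flat_exp\<close> so that
  the derivative is a combination of two members of the same family; smoothness then follows by
  induction.\<close>

lemma flat_exp_has_derivative:
  "(flat_exp k has_real_derivative flat_exp (k + 2) x - of_nat k * flat_exp (k + 1) x) (at x)"
proof (cases x "0::real" rule: linorder_cases)
  case less
  have "((\<lambda>_. 0) has_real_derivative 0) (at x)" by simp
  then have "(flat_exp k has_real_derivative 0) (at x)"
    by (rule has_field_derivative_transform_within_open[of _ _ _ "{..<0}"])
      (use less in \<open>auto simp: flat_exp_def\<close>)
  with less show ?thesis by (simp add: flat_exp_def)
next
  case equal
  \<comment> \<open>The difference quotient of \<open>flat_exp k\<close> at 0 is
    \<open>flat_exp (Suc k)\<close>, since dividing by \<open>h\<close> raises the power of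
    \<open>inverse h\<close> by one.\<close>
  have "((\<lambda>h. (flat_exp k (0 + h) - flat_exp k 0) / h) \<longlongrightarrow> 0) (at 0)"
    by (rule Lim_transform_eventually[OF flat_exp_tendsto_0[of "Suc k"]])
      (auto simp: eventually_at_filter flat_exp_def field_simps)
  then show ?thesis using equal by (simp add: DERIV_def flat_exp_def)
next
  case greater
  have "((\<lambda>x. exp (- inverse x) * inverse x ^ k) has_real_derivative
      exp (- inverse x) * inverse x ^ (k+2) - of_nat k * (exp (- inverse x) * inverse x ^ (k+1))) (at x)"
  proof -
    have "((\<lambda>x. inverse x ^ k) has_real_derivative - (of_nat k * inverse x ^ (k+1))) (at x)"
    proof -
      have "((\<lambda>x. inverse x ^ k) has_real_derivative
          of_nat k * (- (inverse x ^ 2) * inverse x ^ (k - Suc 0))) (at x)"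
        using greater DERIV_power[OF DERIV_inverse[of x UNIV], of k]
        by (simp add: power2_eq_square)
      moreover have "of_nat k * (- (inverse x ^ 2) * inverse x ^ (k - Suc 0)) = - (of_nat k * inverse x ^ (k+1))"
        by (cases k) (simp_all add: power2_eq_square)
      ultimately show ?thesis by (simp only:)
    qed
    note 1 = this
    have 2: "((\<lambda>x. exp (- inverse x)) has_real_derivative exp (- inverse x) * inverse x ^ 2) (at x)"
      using greater by (auto intro!: derivative_eq_intros simp: power2_eq_square)
    show ?thesis
      by (rule DERIV_cong[OF DERIV_mult[OF 2 1]]) (simp add: power_add power2_eq_square algebra_simps)
  qed
  then have "(flat_exp k has_real_derivative
     exp (- inverse x) * inverse x ^ (k+2) - of_nat k * (exp (- inverse x) * inverse x ^ (k+1))) (at x)"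
    by (rule has_field_derivative_transform_within_open[of _ _ _ "{0<..}"])
      (use greater in \<open>auto simp: flat_exp_def\<close>)
  with greater show ?thesis by (simp add: flat_exp_def)
qed

lemma smooth_real_flat_exp: "smooth_real (flat_exp k)"
proof -
  have "ntimes_diff n (flat_exp k)" for n
  proof (induction n arbitrary: k)
    case (Suc n)
    have "ntimes_diff n (\<lambda>x. flat_exp (k + 2) x + (- of_nat k) * flat_exp (k + 1) x)"
      by (intro ntimes_diff_add ntimes_diff_mult ntimes_diff_const Suc.IH)
    then show ?case
      using flat_exp_has_derivative[of k] by (auto intro!: exI)
  qed simp
  then show ?thesis by (simp add: smooth_real_def)
qed

text \<open>A smooth transition from 0 for \<open>y <= 1\<close> to 1 for \<open>y >= 2\<close>. One
  of \<open>y - 1\<close> and \<open>2 - y\<close> is always positive, so the denominator never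
  vanishes.\<close>

definition smooth_step :: "real \<Rightarrow> real" where
  "smooth_step y = flat_exp 0 (y - 1) * inverse (flat_exp 0 (y - 1) + flat_exp 0 (2 - y))"

lemma smooth_step_denominator_pos: "flat_exp 0 (y - 1) + flat_exp 0 (2 - y) > 0"
  by (auto simp: flat_exp_def add_pos_nonneg add_nonneg_pos)

lemma smooth_step_smooth: "smooth_real smooth_step"
proof -
  have "smooth_real (\<lambda>y. flat_exp 0 (y - 1))" "smooth_real (\<lambda>y. flat_exp 0 (2 - y))"
    by (rule smooth_real_intros(5)[of "flat_exp 0", OF smooth_real_flat_exp smooth_real_diff];
        rule smooth_real_intros(1,2))+
  then have "smooth_real (\<lambda>y. flat_exp 0 (y - 1) * inverse (flat_exp 0 (y - 1) + flat_exp 0 (2 - y)))"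
    using smooth_step_denominator_pos[THEN less_imp_neq, symmetric] by (intro smooth_real_intros(3,4,6))
  then show ?thesis by (simp add: smooth_step_def[abs_def])
qed

lemma smooth_step_le_1: "y \<le> 1 \<Longrightarrow> smooth_step y = 0"
  by (simp add: smooth_step_def flat_exp_def)

lemma smooth_step_ge_2: "2 \<le> y \<Longrightarrow> smooth_step y = 1"
  by (simp add: smooth_step_def flat_exp_def)

lemma smooth_step_bounds: "0 \<le> smooth_step y" "smooth_step y \<le> 1"
  using smooth_step_denominator_pos[of y]
  by (auto simp: smooth_step_def flat_exp_def field_simps)

lemma eventually_constant_deriv:
  assumes "open S" "y \<in> S" "\<And>z. z \<in> S \<Longrightarrow> f z = c"
  shows "deriv f y = (0::real)"
proof (rule DERIV_imp_deriv)
  have "((\<lambda>_. c) has_real_derivative 0) (at y)" by simp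
  then show "(f has_real_derivative 0) (at y)"
    by (rule has_field_derivative_transform_within_open[of _ _ _ S]) (use assms in auto)
qed

lemma smooth_step_derivs_eq_0:
  assumes "y < 1 \<or> 2 < y"
  shows "deriv smooth_step y = 0" "deriv (deriv smooth_step) y = 0"
proof -
  have 1: "deriv smooth_step z = 0" if "z \<in> {..<1}" for z
    using that by (intro eventually_constant_deriv[of "{..<1}" _ _ 0]) (auto simp: smooth_step_le_1)
  have 2: "deriv smooth_step z = 0" if "z \<in> {2<..}" for z
    using that by (intro eventually_constant_deriv[of "{2<..}" _ _ 1]) (auto simp: smooth_step_ge_2)
  show "deriv smooth_step y = 0" using 1 2 assms by auto
  have "deriv (deriv smooth_step) y = 0" if "y \<in> {..<1}"
    by (rule eventually_constant_deriv[of "{..<1}", OF _ that 1]) auto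
  moreover have "deriv (deriv smooth_step) y = 0" if "y \<in> {2<..}"
    by (rule eventually_constant_deriv[of "{2<..}", OF _ that 2]) auto
  ultimately show "deriv (deriv smooth_step) y = 0" using assms by auto
qed

text \<open>The weights match the rescaling \<open>y = m * q\<close>: the j-th derivative of the
  rescaled step carries a factor \<open>m ^ j\<close>, which together with \<open>q ^ j\<close>
  becomes \<open>y ^ j\<close>. The bounds thus become uniform in \<open>m\<close>. The constant
  exists because both derivatives vanish outside [1, 2].\<close>

lemma smooth_step_deriv_bounds:
  obtains C where "C \<ge> 0" "\<And>y. \<bar>y\<bar> * \<bar>deriv smooth_step y\<bar> \<le> C"
    "\<And>y. \<bar>y\<bar>^2 * \<bar>deriv (deriv smooth_step) y\<bar> \<le> C"
proof -
  let ?d = "deriv smooth_step" and ?dd = "deriv (deriv smooth_step)"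
  have s: "smooth_real ?d" "smooth_real ?dd"
    using smooth_real_deriv(2) smooth_step_smooth by blast+
  have "compact (?d ` {1..2})" "compact (?dd ` {1..2})"
    by (intro compact_continuous_image smooth_real_continuous s compact_Icc)+
  then have "bounded (?d ` {1..2})" "bounded (?dd ` {1..2})"
    by (auto intro: compact_imp_bounded)
  then obtain a b where ab: "\<And>y. y \<in> {1..2} \<Longrightarrow> \<bar>?d y\<bar> \<le> a" "\<And>y. y \<in> {1..2} \<Longrightarrow> \<bar>?dd y\<bar> \<le> b"
    unfolding bounded_iff by (metis imageI real_norm_def)
  have ab0: "0 \<le> a" "0 \<le> b" using ab(1)[of 1] ab(2)[of 1] by auto
  \<comment> \<open>On [1, 2] the weights are at most 2 and 4; adding the two bounds gives one
    constant for both estimates.\<close>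
  have "\<bar>y\<bar> * \<bar>?d y\<bar> \<le> 2 * a + 4 * b \<and> \<bar>y\<bar>^2 * \<bar>?dd y\<bar> \<le> 2 * a + 4 * b" for y
  proof (cases "y \<in> {1..2}")
    case True
    have "\<bar>y\<bar> * \<bar>?d y\<bar> \<le> 2 * a"
      using True ab ab0 by (intro mult_mono) auto
    moreover have "\<bar>y\<bar>^2 * \<bar>?dd y\<bar> \<le> 2^2 * b"
      using True ab ab0 by (intro mult_mono power_mono) auto
    ultimately show ?thesis using ab0 by auto
  next
    case False
    then show ?thesis using smooth_step_derivs_eq_0[of y] ab0 by auto
  qed
  then show ?thesis using that[of "2 * a + 4 * b"] ab0 by auto
qed

section \<open>Smooth functions of several variables\<close>

lemma cpartial_eqI:
  fixes f :: "real^'n::finite \<Rightarrow> real"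
  shows "(f has_derivative f') (at x) \<Longrightarrow> cpartial f i x = f' (axis i 1)"
  by (metis cpartial_def frechet_derivative_at)

lemma cpartial_add:
  fixes f g :: "real^'n::finite \<Rightarrow> real"
  assumes "\<And>x. f differentiable (at x)" "\<And>x. g differentiable (at x)"
  shows "cpartial (\<lambda>x. f x + g x) i = (\<lambda>x. cpartial f i x + cpartial g i x)"
proof
  fix x
  have "((\<lambda>x. f x + g x) has_derivative
      (\<lambda>y. frechet_derivative f (at x) y + frechet_derivative g (at x) y)) (at x)"
    using assms by (intro has_derivative_add) (simp_all add: frechet_derivative_works[symmetric])
  from cpartial_eqI[OF this] show "cpartial (\<lambda>x. f x + g x) i x = cpartial f i x + cpartial g i x"
    by (simp add: cpartial_def)
qed

lemma cpartial_mult: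
  fixes f g :: "real^'n::finite \<Rightarrow> real"
  assumes "\<And>x. f differentiable (at x)" "\<And>x. g differentiable (at x)"
  shows "cpartial (\<lambda>x. f x * g x) i = (\<lambda>x. cpartial f i x * g x + f x * cpartial g i x)"
proof
  fix x
  have "((\<lambda>x. f x * g x) has_derivative
      (\<lambda>y. f x * frechet_derivative g (at x) y + frechet_derivative f (at x) y * g x)) (at x)"
    using assms by (intro has_derivative_mult) (simp_all add: frechet_derivative_works[symmetric])
  from cpartial_eqI[OF this] show "cpartial (\<lambda>x. f x * g x) i x = cpartial f i x * g x + f x * cpartial g i x"
    by (simp add: cpartial_def)
qed

primrec pdiff :: "nat \<Rightarrow> (real^'n::finite \<Rightarrow> real) \<Rightarrow> bool" where
  "pdiff 0 f \<longleftrightarrow> True"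
| "pdiff (Suc n) f \<longleftrightarrow> (\<forall>x. f differentiable (at x)) \<and> (\<forall>i. pdiff n (cpartial f i))"

definition smooth :: "(real^'n::finite \<Rightarrow> real) \<Rightarrow> bool" where
  "smooth f \<longleftrightarrow> (\<forall>n. pdiff n f)"

lemma pdiff_SucD: "pdiff (Suc n) f \<Longrightarrow> pdiff n f"
proof (induction n arbitrary: f)
  case (Suc n)
  then have "\<forall>x. f differentiable (at x)" "\<forall>i. pdiff (Suc n) (cpartial f i)"
    by (auto simp del: pdiff.simps simp: pdiff.simps(2)[of "Suc n"])
  then show ?case
    using Suc.IH unfolding pdiff.simps(2)[of n f] by blast
qed simp

lemma pdiff_add: "pdiff n f \<Longrightarrow> pdiff n g \<Longrightarrow> pdiff n (\<lambda>x. f x + g x)"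
  by (induction n arbitrary: f g) (auto simp: cpartial_add)

lemma pdiff_mult: "pdiff n f \<Longrightarrow> pdiff n g \<Longrightarrow> pdiff n (\<lambda>x. f x * g x)"
proof (induction n arbitrary: f g)
  case (Suc n)
  have "pdiff n f" "pdiff n g"
    using Suc.prems by (auto intro: pdiff_SucD simp del: pdiff.simps)
  then show ?case
    using Suc.prems by (auto simp: cpartial_mult intro!: pdiff_add Suc.IH)
qed simp

lemma pdiff_const: "pdiff n (\<lambda>x::real^'n::finite. c)"
proof (induction n arbitrary: c)
  case (Suc n)
  have "cpartial (\<lambda>x::real^'n. c) i = (\<lambda>x. 0)" for i
    by (rule ext) (rule cpartial_eqI, rule has_derivative_const)
  with Suc.IH[of 0] show ?case by simp
qed simp

lemma pdiff_bounded_linear: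
  assumes "bounded_linear f" shows "pdiff n f"
proof (cases n)
  case (Suc m)
  have "cpartial f i = (\<lambda>x. f (axis i 1))" for i
    using assms by (intro ext cpartial_eqI bounded_linear_imp_has_derivative)
  with Suc assms show ?thesis
    using bounded_linear_imp_differentiable[OF assms] pdiff_const by auto
qed simp

lemma has_derivative_coordinate:
  assumes "(h has_real_derivative h') (at (x $ i))"
  shows "((\<lambda>x. h (x $ i)) has_derivative (\<lambda>y. h' * y $ i)) (at x)"
proof -
  have "((\<lambda>x. x $ i) has_derivative (\<lambda>y. y $ i)) (at x)"
    by (intro bounded_linear_imp_has_derivative bounded_linear_vec_nth)
  from has_derivative_compose[OF this, of h "(*) h'"] assms
  show ?thesis by (simp add: has_field_derivative_def)
qed

lemma pdiff_coordinate: "ntimes_diff n h \<Longrightarrow> pdiff n (\<lambda>x. h (x $ i))"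
proof (induction n arbitrary: h)
  case (Suc n)
  then obtain h' where h': "\<And>x. (h has_real_derivative h' x) (at x)" "ntimes_diff n h'"
    by auto
  have "cpartial (\<lambda>x. h (x $ i)) j = (\<lambda>x. h' (x $ i) * axis j 1 $ i)" for j
    using has_derivative_coordinate[OF h'(1)] by (intro ext cpartial_eqI)
  moreover have "pdiff n (\<lambda>x. h' (x $ i) * axis j 1 $ i)" for j
    by (intro pdiff_mult pdiff_const Suc.IH h')
  moreover have "(\<lambda>x. h (x $ i)) differentiable (at x)" for x
    using has_derivative_coordinate[OF h'(1)] by (auto simp: differentiable_def)
  ultimately show ?case by simp
qed simp

lemma smooth_const: "smooth (\<lambda>x. c)"
  by (simp add: smooth_def pdiff_const)

lemma smooth_add: "smooth f \<Longrightarrow> smooth g \<Longrightarrow> smooth (\<lambda>x. f x + g x)"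
  by (simp add: smooth_def pdiff_add)

lemma smooth_mult: "smooth f \<Longrightarrow> smooth g \<Longrightarrow> smooth (\<lambda>x. f x * g x)"
  by (simp add: smooth_def pdiff_mult)

lemma smooth_bounded_linear: "bounded_linear f \<Longrightarrow> smooth f"
  by (simp add: smooth_def pdiff_bounded_linear)

lemma smooth_coordinate: "smooth_real h \<Longrightarrow> smooth (\<lambda>x. h (x $ i))"
  by (simp add: smooth_def smooth_real_def pdiff_coordinate)

lemma smooth_prod:
  "finite I \<Longrightarrow> (\<And>i. i \<in> I \<Longrightarrow> smooth (f i)) \<Longrightarrow> smooth (\<lambda>x. \<Prod>i\<in>I. f i x)"
  by (induction I rule: finite_induct) (auto intro: smooth_const smooth_mult)

text \<open>Makes the polynomials of the Stone-Weierstrass theorem available as test functions,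
  after multiplication by a cutoff.\<close>

lemma smooth_polynomial: "real_polynomial_function f \<Longrightarrow> smooth f"
  by (induction rule: real_polynomial_function.induct)
    (auto intro: smooth_const smooth_add smooth_mult smooth_bounded_linear)

lemma smooth_cpartial: "smooth f \<Longrightarrow> smooth (cpartial f i)"
  unfolding smooth_def by (metis pdiff.simps(2))

lemma smooth_differentiable: "smooth f \<Longrightarrow> f differentiable (at x)"
  unfolding smooth_def by (metis pdiff.simps(2))

lemma smooth_continuous: "smooth f \<Longrightarrow> continuous_on A f"
  using smooth_differentiable
  by (metis continuous_at_imp_continuous_on differentiable_imp_continuous_within)

lemma smooth_cDk: "smooth f \<Longrightarrow> smooth (cDk k \<alpha> f)"
  by (induction k arbitrary: \<alpha>) (auto simp: Let_def smooth_cpartial)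

section \<open>Test functions and supports\<close>

lemma test_funI:
  "smooth \<phi> \<Longrightarrow> compact (tsupp \<phi>) \<Longrightarrow> tsupp \<phi> \<subseteq> interior \<Omega> \<Longrightarrow> test_fun \<Omega> \<phi>"
  by (auto simp: test_fun_def cD_def intro!: smooth_differentiable smooth_continuous smooth_cDk)

lemma tsupp_subset: "closed S \<Longrightarrow> (\<And>x. x \<notin> S \<Longrightarrow> \<phi> x = 0) \<Longrightarrow> tsupp \<phi> \<subseteq> S"
  unfolding tsupp_def by (intro closure_minimal) auto

lemma not_in_tsupp: "x \<notin> tsupp \<phi> \<Longrightarrow> \<phi> x = 0"
  unfolding tsupp_def using closure_subset[of "{x. \<phi> x \<noteq> 0}"] by auto

lemma closed_tsupp: "closed (tsupp \<phi>)"
  by (simp add: tsupp_def)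

lemma tsupp_cpartial:
  fixes \<phi> :: "real^'n::finite \<Rightarrow> real"
  shows "tsupp (cpartial \<phi> i) \<subseteq> tsupp \<phi>"
proof (rule tsupp_subset[OF closed_tsupp])
  fix x assume x: "x \<notin> tsupp \<phi>"
  have "((\<lambda>x. 0) has_derivative (\<lambda>x. 0)) (at x)" by simp
  then have "(\<phi> has_derivative (\<lambda>x. 0)) (at x)"
    by (rule has_derivative_transform_within_open[of _ _ _ _ "- tsupp \<phi>"])
      (use x in \<open>auto simp: closed_tsupp open_closed not_in_tsupp\<close>)
  then show "cpartial \<phi> i x = 0" using cpartial_eqI by fastforce
qed

lemma tsupp_cDk:
  fixes \<phi> :: "real^'n::finite \<Rightarrow> real"
  shows "tsupp (cDk k \<alpha> \<phi>) \<subseteq> tsupp \<phi>"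
proof (induction k arbitrary: \<alpha>)
  case (Suc k)
  then show ?case using tsupp_cpartial by (fastforce simp: Let_def)
qed simp

lemma interior_unit_cube: "interior unit_cube = {x. \<forall>i. 0 < x $ i \<and> x $ i < 1}"
  by (auto simp: unit_cube_def mem_box_cart)

lemma mem_unit_cube: "x \<in> unit_cube \<longleftrightarrow> (\<forall>i. 0 \<le> x $ i \<and> x $ i \<le> 1)"
  by (auto simp: unit_cube_def mem_box_cart)

section \<open>Tensor products and cutoffs\<close>

definition tensor :: "('n \<Rightarrow> real \<Rightarrow> real) \<Rightarrow> real^'n::finite \<Rightarrow> real" where
  "tensor h x = (\<Prod>i\<in>UNIV. h i (x $ i))"

lemma smooth_tensor: "(\<And>i. smooth_real (h i)) \<Longrightarrow> smooth (tensor h)"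
  unfolding tensor_def[abs_def] by (intro smooth_prod smooth_coordinate) auto

lemma cpartial_tensor:
  fixes h :: "'n::finite \<Rightarrow> real \<Rightarrow> real"
  assumes h: "\<And>j. smooth_real (h j)" and hi: "\<And>t. (h i has_real_derivative h' t) (at t)"
  shows "cpartial (tensor h) i = tensor (h(i := h'))"
proof
  fix x :: "real^'n"
  have "((\<lambda>x. h j (x $ j)) has_derivative (\<lambda>y. deriv (h j) (x $ j) * y $ j)) (at x)" for j
    by (intro has_derivative_coordinate smooth_real_deriv h)
  then have "(tensor h has_derivative
      (\<lambda>y. \<Sum>j\<in>UNIV. (deriv (h j) (x $ j) * y $ j) * (\<Prod>l\<in>UNIV-{j}. h l (x $ l)))) (at x)"
    unfolding tensor_def[abs_def] by (intro has_derivative_prod)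
  then have "cpartial (tensor h) i x =
      (\<Sum>j\<in>UNIV. (deriv (h j) (x $ j) * axis i 1 $ j) * (\<Prod>l\<in>UNIV-{j}. h l (x $ l)))"
    by (rule cpartial_eqI)
  also have "\<dots> = (\<Sum>j\<in>UNIV. if j = i then deriv (h j) (x $ j) * (\<Prod>l\<in>UNIV-{j}. h l (x $ l)) else 0)"
    by (intro sum.cong) (auto simp: axis_def)
  also have "\<dots> = deriv (h i) (x $ i) * (\<Prod>l\<in>UNIV-{i}. h l (x $ l))"
    by simp
  also have "deriv (h i) = h'"
    using hi by (auto intro: DERIV_imp_deriv)
  also have "h' (x $ i) * (\<Prod>l\<in>UNIV-{i}. h l (x $ l)) = tensor (h(i := h')) x"
    unfolding tensor_def by (subst (2) prod.remove[of _ i]) (auto intro!: prod.cong)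
  finally show "cpartial (tensor h) i x = tensor (h(i := h')) x" .
qed

text \<open>The polynomial \<open>t * (1 - t)\<close> stands in for the distance of \<open>t\<close>
  to the end points: it is positive exactly on the open interval, so the points where
  \<open>m * (t * (1 - t))\<close> is at least 1 in every coordinate form a compact subset of the
  open cube, and it contains the support.\<close>

lemma test_fun_tensor:
  fixes h :: "'n::finite \<Rightarrow> real \<Rightarrow> real"
  assumes h: "\<And>i. smooth_real (h i)" and h0: "\<And>i t. m * (t * (1 - t)) < 1 \<Longrightarrow> h i t = 0"
    and m: "0 < m"
  shows "test_fun unit_cube (tensor h)"
proof -
  define K where "K = {x::real^'n. \<forall>i. 1 \<le> m * (x $ i * (1 - x $ i))}"
  have K: "closed K"
    unfolding K_def by (intro closed_Collect_all closed_Collect_le continuous_intros)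
  have sub: "tsupp (tensor h) \<subseteq> K"
  proof (rule tsupp_subset[OF K])
    fix x assume "x \<notin> K"
    then obtain i where "m * (x $ i * (1 - x $ i)) < 1" by (auto simp: K_def not_le)
    then show "tensor h x = 0" using h0 by (auto simp: tensor_def)
  qed
  have KQ: "K \<subseteq> interior unit_cube"
  proof
    fix x assume "x \<in> K"
    then have "0 < x $ i * (1 - x $ i)" for i
      using m unfolding K_def by (metis (no_types, lifting) less_le_trans mem_Collect_eq zero_less_mult_pos zero_less_one)
    then have "0 < x $ i \<and> x $ i < 1" for i
      by (smt (verit) mult_nonneg_nonpos mult_nonpos_nonneg)
    then show "x \<in> interior unit_cube" by (simp add: interior_unit_cube)
  qed
  have "bounded K"
    by (rule bounded_subset[of unit_cube]) (use KQ interior_subset[of unit_cube] in \<open>simp add: unit_cube_def, blast\<close>)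
  then have "compact (tsupp (tensor h))"
    using sub closed_tsupp by (meson bounded_subset compact_eq_bounded_closed)
  then show ?thesis
    using sub KQ by (intro test_funI smooth_tensor h) auto
qed

section \<open>Cutoffs near the end points of the unit interval\<close>

definition cutoff :: "nat \<Rightarrow> real \<Rightarrow> real" where
  "cutoff m t = smooth_step (real m * (t * (1 - t)))"

definition cutoff' :: "nat \<Rightarrow> real \<Rightarrow> real" where
  "cutoff' m t = deriv smooth_step (real m * (t * (1 - t))) * (real m * (1 - 2 * t))"

definition cutoff'' :: "nat \<Rightarrow> real \<Rightarrow> real" where
  "cutoff'' m t = deriv (deriv smooth_step) (real m * (t * (1 - t))) * (real m * (1 - 2 * t))\<^sup>2
     - 2 * real m * deriv smooth_step (real m * (t * (1 - t)))"

lemma smooth_cutoff: "smooth_real (cutoff m)"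
  unfolding cutoff_def[abs_def]
  by (rule smooth_real_intros(5)[of smooth_step])
    (intro smooth_step_smooth smooth_real_intros(1,2,4) smooth_real_diff)+

lemma cutoff_has_derivative:
  "(cutoff m has_real_derivative cutoff' m t) (at t)"
  "(cutoff' m has_real_derivative cutoff'' m t) (at t)"
proof -
  note d = smooth_real_deriv(1)[OF smooth_step_smooth]
    smooth_real_deriv(1)[OF smooth_real_deriv(2)[OF smooth_step_smooth]]
  have q: "((\<lambda>t. real m * (t * (1 - t))) has_real_derivative real m * (1 - 2 * t)) (at t)"
    by (auto intro!: derivative_eq_intros simp: algebra_simps)
  show "(cutoff m has_real_derivative cutoff' m t) (at t)"
    unfolding cutoff_def[abs_def] cutoff'_def by (rule DERIV_chain2[OF d(1) q])
  show "(cutoff' m has_real_derivative cutoff'' m t) (at t)"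
    unfolding cutoff'_def[abs_def] cutoff''_def
    by (rule derivative_eq_intros DERIV_chain2[OF d(2) q] refl)+ (simp add: power2_eq_square)
qed

lemma cutoff_eq_0: "real m * (t * (1 - t)) < 1 \<Longrightarrow> cutoff m t = 0"
  by (simp add: cutoff_def smooth_step_le_1)

lemma cutoff_bounds: "0 \<le> cutoff m t" "cutoff m t \<le> 1"
  by (simp_all add: cutoff_def smooth_step_bounds)

lemma cutoff_eventually_1:
  assumes "0 < t" "t < 1"
  shows "\<forall>\<^sub>F m in sequentially. cutoff m t = 1 \<and> cutoff' m t = 0 \<and> cutoff'' m t = 0"
proof -
  have "0 < t * (1 - t)" using assms by simp
  then have "filterlim (\<lambda>m. real m * (t * (1 - t))) at_top sequentially"
    by (rule filterlim_at_top_mult_tendsto_pos[OF tendsto_const _ filterlim_real_sequentially])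
  then have "\<forall>\<^sub>F m in sequentially. 2 < real m * (t * (1 - t))"
    by (simp add: filterlim_at_top_dense)
  then show ?thesis
    by eventually_elim (simp add: cutoff_def cutoff'_def cutoff''_def smooth_step_ge_2 smooth_step_derivs_eq_0)
qed

text \<open>Each derivative of the cutoff costs one power of the boundary distance, uniformly in
  \<open>m\<close>: this is \<open>smooth_step_deriv_bounds\<close> read at
  \<open>y = m * (t * (1 - t))\<close>.\<close>

lemma cutoff_deriv_bounds:
  obtains C where "0 \<le> C"
    "\<And>m t. 0 \<le> t \<Longrightarrow> t \<le> 1 \<Longrightarrow> t * (1 - t) * \<bar>cutoff' m t\<bar> \<le> C"
    "\<And>m t. 0 \<le> t \<Longrightarrow> t \<le> 1 \<Longrightarrow> (t * (1 - t))\<^sup>2 * \<bar>cutoff'' m t\<bar> \<le> C"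
proof -
  obtain C where C: "C \<ge> 0" "\<And>y. \<bar>y\<bar> * \<bar>deriv smooth_step y\<bar> \<le> C"
    "\<And>y. \<bar>y\<bar>^2 * \<bar>deriv (deriv smooth_step) y\<bar> \<le> C"
    using smooth_step_deriv_bounds by metis
  have "t * (1 - t) * \<bar>cutoff' m t\<bar> \<le> 3 * C \<and> (t * (1 - t))\<^sup>2 * \<bar>cutoff'' m t\<bar> \<le> 3 * C"
    if t: "0 \<le> t" "t \<le> 1" for m t
  proof -
    let ?q = "t * (1 - t)" and ?y = "real m * (t * (1 - t))"
    let ?a = "\<bar>deriv smooth_step ?y\<bar>" and ?b = "\<bar>deriv (deriv smooth_step) ?y\<bar>"
    have q: "0 \<le> ?q" "?q \<le> 1" using t by (auto intro: mult_le_one)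
    have r: "\<bar>1 - 2 * t\<bar> \<le> 1" using t by auto
    have r2: "(1 - 2 * t)\<^sup>2 \<le> 1" using r by (simp add: abs_square_le_1)
    have "0 \<le> ?y" using q by simp
    then have ya: "?y * ?a \<le> C" using C(2)[of ?y] by (simp only: abs_of_nonneg)
    have yb: "?y\<^sup>2 * ?b \<le> C" using C(3)[of ?y] q by simp
    have "?q * \<bar>cutoff' m t\<bar> = (?y * ?a) * \<bar>1 - 2 * t\<bar>"
      by (simp add: cutoff'_def abs_mult)
    also have "\<dots> \<le> C * 1" using ya r C(1) q by (intro mult_mono) auto
    finally have 1: "?q * \<bar>cutoff' m t\<bar> \<le> 3 * C" using C(1) by simp
    have "?q\<^sup>2 * \<bar>cutoff'' m t\<bar> \<le> ?q\<^sup>2 * (?b * (real m * (1 - 2 * t))\<^sup>2 + 2 * real m * ?a)"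
      by (intro mult_left_mono order_trans[OF abs_triangle_ineq4])
        (auto simp: cutoff''_def abs_mult intro!: order_trans[OF abs_triangle_ineq4])
    \<comment> \<open>Every factor \<open>m\<close> is paired with one \<open>q\<close> to form
      \<open>y\<close>. The second term, which stems from the second derivative of
      \<open>t * (1 - t)\<close>, keeps a spare \<open>q\<close>, and that is at most 1.\<close>
    also have "\<dots> = (?y\<^sup>2 * ?b) * (1 - 2 * t)\<^sup>2 + 2 * ?q * (?y * ?a)"
      by (simp add: algebra_simps power2_eq_square)
    also have "\<dots> \<le> C * 1 + 2 * 1 * C"
      using ya yb r2 q C(1) by (intro add_mono mult_mono) auto
    finally show ?thesis using 1 by simp
  qed
  then show ?thesis using that[of "3 * C"] C(1) by auto
qed

text \<open>\<open>trig a j\<close> is the \<open>j\<close>-th derivative of \<open>sin (a * pi * t)\<close>, so \<open>sine k \<alpha>\<close> below is the derivative of order \<open>\<alpha>\<close> of a product of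
  sines.\<close>

definition trig :: "nat \<Rightarrow> nat \<Rightarrow> real \<Rightarrow> real" where
  "trig a j t = (real a * pi) ^ j * sin (real a * pi * t + real j * (pi / 2))"

lemma trig_has_derivative: "(trig a j has_real_derivative trig a (Suc j) t) (at t)"
proof -
  have "sin (real a * pi * t + real (Suc j) * (pi / 2)) = cos (real a * pi * t + real j * (pi / 2))"
    using sin_add[of "real a * pi * t + real j * (pi / 2)" "pi / 2"]
    by (simp add: algebra_simps add_divide_distrib)
  then show ?thesis
    unfolding trig_def by (auto intro!: derivative_eq_intros)
qed

lemma smooth_trig: "smooth_real (trig a j)"
  unfolding trig_def[abs_def] by (rule smooth_real_sin)

lemma trig_bound: "\<bar>trig a j t\<bar> \<le> (real a * pi) ^ j"
  by (simp add: trig_def abs_mult mult_left_le)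

lemma trig_2: "trig a (Suc (Suc j)) t = - (real a * pi)\<^sup>2 * trig a j t"
proof -
  have "real a * pi * t + real (Suc (Suc j)) * (pi / 2) = (real a * pi * t + real j * (pi / 2)) + pi"
    by (simp add: algebra_simps add_divide_distrib)
  then have "sin (real a * pi * t + real (Suc (Suc j)) * (pi / 2)) = - sin (real a * pi * t + real j * (pi / 2))"
    by (simp only: sin_periodic_pi)
  then show ?thesis by (simp add: trig_def power2_eq_square del: of_nat_Suc)
qed

text \<open>An even derivative of the sine is a multiple of the same sine, hence zero at both ends.
  The boundary terms in \<open>sine_by_parts\<close> disappear through this fact.\<close>

lemma trig_even_0_1:
  assumes "even j" shows "trig a j 0 = 0" "trig a j 1 = 0"
proof -
  obtain l where "j = 2 * l" using assms by blast
  then have "real a * pi + real j * (pi / 2) = real (a + l) * pi" "real j * (pi / 2) = real l * pi"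
    by (simp_all add: algebra_simps)
  then show "trig a j 0 = 0" "trig a j 1 = 0"
    by (simp_all add: trig_def del: of_nat_add)
qed

text \<open>With \<open>c = a * pi\<close>, the sine is bounded by \<open>c * t\<close> and by
  \<open>c * (1 - t)\<close>. The factor 2 arises because the larger of \<open>t\<close> and
  \<open>1 - t\<close> is at least 1/2.\<close>

lemma trig_0_bound:
  assumes "0 \<le> t" "t \<le> 1"
  shows "\<bar>trig a 0 t\<bar> \<le> 2 * (real a * pi) * (t * (1 - t))"
proof -
  let ?c = "real a * pi"
  have c: "0 \<le> ?c" by simp
  have "\<bar>sin (?c * t)\<bar> \<le> ?c * t"
    using abs_sin_x_le_abs_x[of "?c * t"] assms by simp
  moreover have "\<bar>sin (?c * t)\<bar> \<le> ?c * (1 - t)"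
  proof -
    have "?c * t = real a * pi - ?c * (1 - t)" by (simp add: algebra_simps)
    then have "\<bar>sin (?c * t)\<bar> = \<bar>sin (?c * (1 - t))\<bar>"
      by (simp add: sin_diff abs_mult power_abs)
    then show ?thesis
      using abs_sin_x_le_abs_x[of "?c * (1 - t)"] assms by simp
  qed
  moreover have "min (?c * t) (?c * (1 - t)) \<le> 2 * ?c * (t * (1 - t))"
  proof (cases "t \<le> 1/2")
    case True
    then have "?c * t * 1 \<le> ?c * t * (2 * (1 - t))" using assms by (intro mult_left_mono) auto
    then show ?thesis by (intro min.coboundedI1) (simp add: algebra_simps)
  next
    case False
    then have "?c * (1 - t) * 1 \<le> ?c * (1 - t) * (2 * t)" using assms by (intro mult_left_mono) auto
    then show ?thesis by (intro min.coboundedI2) (simp add: algebra_simps)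
  qed
  ultimately show ?thesis by (simp add: trig_def)
qed

section \<open>Sines multiplied by a cutoff\<close>

definition csin :: "nat \<Rightarrow> nat \<Rightarrow> real \<Rightarrow> real" where
  "csin a m t = trig a 0 t * cutoff m t"

definition csin' :: "nat \<Rightarrow> nat \<Rightarrow> real \<Rightarrow> real" where
  "csin' a m t = trig a 1 t * cutoff m t + trig a 0 t * cutoff' m t"

definition csin'' :: "nat \<Rightarrow> nat \<Rightarrow> real \<Rightarrow> real" where
  "csin'' a m t = trig a 2 t * cutoff m t + 2 * trig a 1 t * cutoff' m t + trig a 0 t * cutoff'' m t"

lemma csin_has_derivative:
  "(csin a m has_real_derivative csin' a m t) (at t)"
  "(csin' a m has_real_derivative csin'' a m t) (at t)"
proof -
  note d = trig_has_derivative[of a 0] trig_has_derivative[of a 1] cutoff_has_derivative[of m]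
  show "(csin a m has_real_derivative csin' a m t) (at t)"
    unfolding csin_def[abs_def] csin'_def by (rule derivative_eq_intros d refl)+ simp
  show "(csin' a m has_real_derivative csin'' a m t) (at t)"
    unfolding csin'_def[abs_def] csin''_def
    by (rule derivative_eq_intros d refl)+ (simp add: numeral_2_eq_2)
qed

lemma smooth_csin: "smooth_real (csin a m)" "smooth_real (csin' a m)"
proof -
  show 1: "smooth_real (csin a m)"
    unfolding csin_def[abs_def] by (intro smooth_real_intros(4) smooth_trig smooth_cutoff)
  show "smooth_real (csin' a m)"
    by (rule smooth_real_cong_deriv[OF 1 csin_has_derivative(1)])
qed

lemma csin_eq_0: "real m * (t * (1 - t)) < 1 \<Longrightarrow> csin a m t = 0"
  by (simp add: csin_def cutoff_eq_0)

text \<open>The sine vanishes linearly at both ends, which gains one power of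
  \<open>q = t * (1 - t)\<close> over the cutoff alone: the function is of size \<open>q\<close>,
  its derivative is bounded and its second derivative is at most of size \<open>1 / q\<close>, all
  uniformly in \<open>m\<close>.\<close>

lemma csin_bounds:
  obtains C where "0 \<le> C"
    "\<And>m t. 0 \<le> t \<Longrightarrow> t \<le> 1 \<Longrightarrow> \<bar>csin a m t\<bar> \<le> C * (t * (1 - t))"
    "\<And>m t. 0 \<le> t \<Longrightarrow> t \<le> 1 \<Longrightarrow> \<bar>csin' a m t\<bar> \<le> C"
    "\<And>m t. 0 \<le> t \<Longrightarrow> t \<le> 1 \<Longrightarrow> (t * (1 - t)) * \<bar>csin'' a m t\<bar> \<le> C"
proof -
  obtain D where D: "0 \<le> D"
    "\<And>m t. 0 \<le> t \<Longrightarrow> t \<le> 1 \<Longrightarrow> t * (1 - t) * \<bar>cutoff' m t\<bar> \<le> D"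
    "\<And>m t. 0 \<le> t \<Longrightarrow> t \<le> 1 \<Longrightarrow> (t * (1 - t))\<^sup>2 * \<bar>cutoff'' m t\<bar> \<le> D"
    using cutoff_deriv_bounds by metis
  define c where "c = real a * pi"
  have c: "0 \<le> c" by (simp add: c_def)
  \<comment> \<open>The three groups of summands serve the three estimates in turn.\<close>
  define C where "C = 2 * c + (c + 2 * c * D) + (c\<^sup>2 + 2 * c * D + 2 * c * D)"
  have "\<bar>csin a m t\<bar> \<le> C * (t * (1 - t)) \<and> \<bar>csin' a m t\<bar> \<le> C \<and> (t * (1 - t)) * \<bar>csin'' a m t\<bar> \<le> C"
    if t: "0 \<le> t" "t \<le> 1" for m t
  proof -
    let ?q = "t * (1 - t)"
    have q: "0 \<le> ?q" "?q \<le> 1" using t by (auto intro: mult_le_one)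
    have t0: "\<bar>trig a 0 t\<bar> \<le> 2 * c * ?q" using trig_0_bound[OF t] by (simp add: c_def)
    have t1: "\<bar>trig a 1 t\<bar> \<le> c" using trig_bound[of a 1 t] by (simp add: c_def)
    have t2: "\<bar>trig a 2 t\<bar> \<le> c\<^sup>2" using trig_bound[of a 2 t] by (simp add: c_def)
    note cb = cutoff_bounds[of m t]
    have "\<bar>csin a m t\<bar> \<le> (2 * c * ?q) * 1"
      unfolding csin_def abs_mult using t0 cb c q by (intro mult_mono) auto
    also have "\<dots> \<le> C * ?q"
      using q c D(1) by (auto simp: C_def intro!: mult_right_mono)
    finally have 1: "\<bar>csin a m t\<bar> \<le> C * ?q" .
    have a0: "\<bar>trig a 0 t\<bar> * \<bar>cutoff' m t\<bar> \<le> 2 * c * D"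
    proof -
      have "\<bar>trig a 0 t\<bar> * \<bar>cutoff' m t\<bar> \<le> (2 * c * ?q) * \<bar>cutoff' m t\<bar>"
        using t0 by (intro mult_right_mono) auto
      also have "\<dots> = 2 * c * (?q * \<bar>cutoff' m t\<bar>)" by simp
      also have "\<dots> \<le> 2 * c * D" using D(2)[OF t, of m] c by (intro mult_left_mono) auto
      finally show ?thesis .
    qed
    have a1: "\<bar>trig a 1 t\<bar> * \<bar>cutoff m t\<bar> \<le> c * 1"
      using t1 cb c by (intro mult_mono) auto
    have "\<bar>csin' a m t\<bar> \<le> c * 1 + 2 * c * D"
      unfolding csin'_def using a0 a1
      by (intro order_trans[OF abs_triangle_ineq] add_mono) (simp_all add: abs_mult)
    also have "\<dots> \<le> C" using c D(1) by (simp add: C_def)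
    finally have 2: "\<bar>csin' a m t\<bar> \<le> C" .
    have b0: "?q * (\<bar>trig a 2 t\<bar> * \<bar>cutoff m t\<bar>) \<le> 1 * (c\<^sup>2 * 1)"
      using t2 cb c q by (intro mult_mono) auto
    have b1: "?q * (2 * \<bar>trig a 1 t\<bar> * \<bar>cutoff' m t\<bar>) \<le> 2 * c * D"
    proof -
      have "?q * (2 * \<bar>trig a 1 t\<bar> * \<bar>cutoff' m t\<bar>) = 2 * \<bar>trig a 1 t\<bar> * (?q * \<bar>cutoff' m t\<bar>)" by simp
      also have "\<dots> \<le> 2 * c * D" using t1 D(2)[OF t, of m] c q by (intro mult_mono) auto
      finally show ?thesis .
    qed
    have b2: "?q * (\<bar>trig a 0 t\<bar> * \<bar>cutoff'' m t\<bar>) \<le> 2 * c * D"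
    proof -
      have "?q * (\<bar>trig a 0 t\<bar> * \<bar>cutoff'' m t\<bar>) \<le> ?q * ((2 * c * ?q) * \<bar>cutoff'' m t\<bar>)"
        using t0 q by (intro mult_right_mono mult_left_mono) auto
      also have "\<dots> = 2 * c * (?q\<^sup>2 * \<bar>cutoff'' m t\<bar>)" by (simp add: power2_eq_square)
      also have "\<dots> \<le> 2 * c * D" using D(3)[OF t, of m] c by (intro mult_left_mono) auto
      finally show ?thesis .
    qed
    have "\<bar>csin'' a m t\<bar> \<le> \<bar>trig a 2 t\<bar> * \<bar>cutoff m t\<bar> + 2 * \<bar>trig a 1 t\<bar> * \<bar>cutoff' m t\<bar> + \<bar>trig a 0 t\<bar> * \<bar>cutoff'' m t\<bar>"
      unfolding csin''_def
      by (intro order_trans[OF abs_triangle_ineq] add_mono) (simp_all add: abs_mult)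
    then have "?q * \<bar>csin'' a m t\<bar> \<le> ?q * (\<bar>trig a 2 t\<bar> * \<bar>cutoff m t\<bar> + 2 * \<bar>trig a 1 t\<bar> * \<bar>cutoff' m t\<bar> + \<bar>trig a 0 t\<bar> * \<bar>cutoff'' m t\<bar>)"
      using q by (intro mult_left_mono)
    also have "\<dots> \<le> 1 * (c\<^sup>2 * 1) + 2 * c * D + 2 * c * D"
      unfolding distrib_left using b0 b1 b2 by (intro add_mono)
    also have "\<dots> \<le> C" using c D(1) by (simp add: C_def)
    finally show ?thesis using 1 2 by simp
  qed
  moreover have "0 \<le> C" using c D(1) by (simp add: C_def)
  ultimately show ?thesis using that[of C] by blast
qed

lemma csin_tendsto:
  assumes "0 < t" "t < 1"
  shows "(\<lambda>m. csin a m t) \<longlonglongrightarrow> trig a 0 t" "(\<lambda>m. csin' a m t) \<longlonglongrightarrow> trig a 1 t"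
    "(\<lambda>m. csin'' a m t) \<longlonglongrightarrow> trig a 2 t"
proof -
  note ev = cutoff_eventually_1[OF assms]
  have "\<forall>\<^sub>F m in sequentially. csin a m t = trig a 0 t"
    "\<forall>\<^sub>F m in sequentially. csin' a m t = trig a 1 t"
    "\<forall>\<^sub>F m in sequentially. csin'' a m t = trig a 2 t"
    by (rule eventually_mono[OF ev]; simp add: csin_def csin'_def csin''_def)+
  then show "(\<lambda>m. csin a m t) \<longlonglongrightarrow> trig a 0 t" "(\<lambda>m. csin' a m t) \<longlonglongrightarrow> trig a 1 t"
    "(\<lambda>m. csin'' a m t) \<longlonglongrightarrow> trig a 2 t"
    by (auto intro: tendsto_eventually)
qed

definition sine :: "('n \<Rightarrow> nat) \<Rightarrow> ('n \<Rightarrow> nat) \<Rightarrow> real^'n::finite \<Rightarrow> real" where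
  "sine k \<alpha> = tensor (\<lambda>i. trig (k i) (\<alpha> i))"

lemma smooth_sine: "smooth (sine k \<alpha>)"
  unfolding sine_def by (intro smooth_tensor smooth_trig)

lemma cpartial_sine: "cpartial (sine k \<alpha>) i = sine k (\<alpha>(i := Suc (\<alpha> i)))"
proof -
  have "cpartial (sine k \<alpha>) i = tensor ((\<lambda>i. trig (k i) (\<alpha> i))(i := trig (k i) (Suc (\<alpha> i))))"
    unfolding sine_def by (rule cpartial_tensor) (auto intro: smooth_trig trig_has_derivative)
  also have "(\<lambda>i. trig (k i) (\<alpha> i))(i := trig (k i) (Suc (\<alpha> i))) = (\<lambda>j. trig (k j) ((\<alpha>(i := Suc (\<alpha> i))) j))"
    by auto
  finally show ?thesis by (simp add: sine_def)
qed

section \<open>Square integrable functions\<close>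

lemma tendsto_0_sandwich:
  fixes a b :: "nat \<Rightarrow> real"
  shows "(\<And>n. a n \<le> b n) \<Longrightarrow> b \<longlonglongrightarrow> 0 \<Longrightarrow> (\<And>n. 0 \<le> a n) \<Longrightarrow> a \<longlonglongrightarrow> 0"
    and "b \<longlonglongrightarrow> 0 \<Longrightarrow> (\<And>n. a n \<le> b n) \<Longrightarrow> (\<And>n. 0 \<le> a n) \<Longrightarrow> a \<longlonglongrightarrow> 0"
  by (rule tendsto_sandwich[OF _ _ tendsto_const]; auto)+

lemma L2_measurable: "L2 \<Omega> f \<Longrightarrow> f \<in> borel_measurable (lebesgue_on \<Omega>)"
  by (simp add: L2_def)

lemma L2_integrable_sq: "L2 \<Omega> f \<Longrightarrow> integrable (lebesgue_on \<Omega>) (\<lambda>x. (f x)\<^sup>2)"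
  by (simp add: L2_def)

lemma L2_integrable_mult:
  assumes "L2 \<Omega> f" "L2 \<Omega> g"
  shows "integrable (lebesgue_on \<Omega>) (\<lambda>x. f x * g x)"
proof (rule Bochner_Integration.integrable_bound)
  show "integrable (lebesgue_on \<Omega>) (\<lambda>x. (f x)\<^sup>2 + (g x)\<^sup>2)"
    using assms by (intro Bochner_Integration.integrable_add L2_integrable_sq)
  show "(\<lambda>x. f x * g x) \<in> borel_measurable (lebesgue_on \<Omega>)"
    using assms by (intro borel_measurable_times L2_measurable)
  have "\<bar>a * b\<bar> \<le> a\<^sup>2 + b\<^sup>2" for a b :: real
    using sum_squares_bound[of "\<bar>a\<bar>" "\<bar>b\<bar>"] mult_nonneg_nonneg[of "\<bar>a\<bar>" "\<bar>b\<bar>"]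
    unfolding abs_mult power2_abs by linarith
  then show "AE x in lebesgue_on \<Omega>. norm (f x * g x) \<le> norm ((f x)\<^sup>2 + (g x)\<^sup>2)"
    by (intro AE_I2) (metis abs_of_nonneg real_norm_def sum_power2_ge_zero)
qed

lemma L2_add:
  assumes "L2 \<Omega> f" "L2 \<Omega> g"
  shows "L2 \<Omega> (\<lambda>x. f x + g x)"
proof -
  have "integrable (lebesgue_on \<Omega>) (\<lambda>x. (f x)\<^sup>2 + (g x)\<^sup>2 + 2 * (f x * g x))"
    using assms by (intro Bochner_Integration.integrable_add L2_integrable_sq integrable_mult_right L2_integrable_mult)
  then show ?thesis
    using assms by (auto simp: L2_def power2_sum mult.assoc)
qed

lemma L2_cmult: "L2 \<Omega> f \<Longrightarrow> L2 \<Omega> (\<lambda>x. c * f x)"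
  by (auto simp: L2_def power_mult_distrib)

lemma L2_diff:
  assumes "L2 \<Omega> f" "L2 \<Omega> g"
  shows "L2 \<Omega> (\<lambda>x. f x - g x)"
  using L2_add[OF assms(1) L2_cmult[OF assms(2), of "-1"]] by simp

lemma L2_zero: "L2 \<Omega> (\<lambda>x. 0)"
  by (simp add: L2_def)

lemma L2_sum: "(\<And>i. i \<in> I \<Longrightarrow> L2 \<Omega> (f i)) \<Longrightarrow> L2 \<Omega> (\<lambda>x. \<Sum>i\<in>I. f i x)"
  by (induction I rule: infinite_finite_induct) (auto intro: L2_zero L2_add)

lemma L2_cong_AE:
  assumes "L2 \<Omega> f" "g \<in> borel_measurable (lebesgue_on \<Omega>)" "AE x in lebesgue_on \<Omega>. f x = g x"
  shows "L2 \<Omega> g"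
  unfolding L2_def
proof
  have "AE x in lebesgue_on \<Omega>. (f x)\<^sup>2 = (g x)\<^sup>2" using assms(3) by eventually_elim simp
  then show "integrable (lebesgue_on \<Omega>) (\<lambda>x. (g x)\<^sup>2)"
    using assms by (subst integrable_cong_AE[where g = "\<lambda>x. (f x)\<^sup>2"]) (auto simp: L2_def)
qed fact

lemma L2_Linf_mult:
  assumes "Linf \<Omega> a" "L2 \<Omega> f"
  shows "L2 \<Omega> (\<lambda>x. a x * f x)"
proof -
  obtain C where C: "AE x in lebesgue_on \<Omega>. \<bar>a x\<bar> \<le> C" and a: "a \<in> borel_measurable (lebesgue_on \<Omega>)"
    using assms by (auto simp: Linf_def)
  have "integrable (lebesgue_on \<Omega>) (\<lambda>x. (a x * f x)\<^sup>2)"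
  proof (rule Bochner_Integration.integrable_bound)
    show "integrable (lebesgue_on \<Omega>) (\<lambda>x. C\<^sup>2 * (f x)\<^sup>2)"
      using assms by (intro integrable_mult_right L2_integrable_sq)
    show "(\<lambda>x. (a x * f x)\<^sup>2) \<in> borel_measurable (lebesgue_on \<Omega>)"
      using a assms by (auto simp: L2_def)
    show "AE x in lebesgue_on \<Omega>. norm ((a x * f x)\<^sup>2) \<le> norm (C\<^sup>2 * (f x)\<^sup>2)"
      using C
    proof eventually_elim
      case (elim x)
      then have "(a x)\<^sup>2 \<le> C\<^sup>2" by (metis abs_ge_zero power2_abs power_mono)
      then show ?case by (simp add: power_mult_distrib mult_right_mono)
    qed
  qed
  then show ?thesis using a assms by (auto simp: L2_def)
qed

section \<open>Inner products and convergence in L2\<close>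

abbreviation (input) ip :: "(real^'n::finite) set \<Rightarrow> (real^'n \<Rightarrow> real) \<Rightarrow> (real^'n \<Rightarrow> real) \<Rightarrow> real" where
  "ip \<Omega> f g \<equiv> \<integral>x. f x * g x \<partial>lebesgue_on \<Omega>"

text \<open>The discriminant argument: the integral of \<open>(f + t * g)^2\<close> is a quadratic
  in \<open>t\<close> that is nonnegative for every real \<open>t\<close>.\<close>

lemma L2_cauchy_schwarz:
  assumes "L2 \<Omega> f" "L2 \<Omega> g"
  shows "(ip \<Omega> f g)\<^sup>2 \<le> ip \<Omega> f f * ip \<Omega> g g"
proof -
  have nonneg: "0 \<le> ip \<Omega> f f + 2 * t * ip \<Omega> f g + t\<^sup>2 * ip \<Omega> g g" for t
  proof -
    have "0 \<le> (\<integral>x. (f x + t * g x)\<^sup>2 \<partial>lebesgue_on \<Omega>)" by simp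
    also have "\<dots> = (\<integral>x. (f x * f x + (2 * t) * (f x * g x)) + t\<^sup>2 * (g x * g x) \<partial>lebesgue_on \<Omega>)"
      by (intro Bochner_Integration.integral_cong) (auto simp: power2_eq_square algebra_simps)
    also have "\<dots> = ip \<Omega> f f + 2 * t * ip \<Omega> f g + t\<^sup>2 * ip \<Omega> g g"
      using assms by (simp add: L2_integrable_mult)
    finally show ?thesis .
  qed
  define a b c where "a = ip \<Omega> f f" "b = ip \<Omega> f g" "c = ip \<Omega> g g"
  have n: "0 \<le> a + 2 * t * b + t\<^sup>2 * c" for t
    using nonneg by (simp add: a_b_c_def)
  have "b\<^sup>2 \<le> a * c"
  proof (cases "c = 0")
    case True
    have "b = 0"
    proof (rule ccontr)
      assume "b \<noteq> 0"
      \<comment> \<open>This value of \<open>t\<close> turns the expression, now linear in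
        \<open>t\<close>, into -1.\<close>
      then show False using n[of "- (a + 1) / (2 * b)"] True by (simp add: field_simps)
    qed
    then show ?thesis using True by simp
  next
    case False
    have "0 \<le> c" unfolding a_b_c_def by (intro integral_nonneg_AE) auto
    with False have c: "0 < c" by simp
    have "0 \<le> a - b\<^sup>2 / c" using n[of "- b / c"] c by (simp add: field_simps power2_eq_square)
    then show ?thesis using c by (simp add: field_simps)
  qed
  then show ?thesis by (simp add: a_b_c_def)
qed

text \<open>Square integrability is part of the notion because the integral of a non-integrable
  function is 0 by convention, so that the limit alone would carry no information.\<close>

definition l2tendsto :: "(real^'n::finite) set \<Rightarrow> (nat \<Rightarrow> real^'n \<Rightarrow> real) \<Rightarrow> (real^'n \<Rightarrow> real) \<Rightarrow> bool" where
  "l2tendsto \<Omega> F f \<longleftrightarrow> (\<forall>n. L2 \<Omega> (F n)) \<and> L2 \<Omega> f \<and>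
     (\<lambda>n. \<integral>x. (F n x - f x)\<^sup>2 \<partial>lebesgue_on \<Omega>) \<longlonglongrightarrow> 0"

lemma l2tendsto_ip_const:
  assumes "l2tendsto \<Omega> F f" "L2 \<Omega> g"
  shows "(\<lambda>n. ip \<Omega> (F n) g) \<longlonglongrightarrow> ip \<Omega> f g"
proof -
  have F: "L2 \<Omega> (F n)" and f: "L2 \<Omega> f" for n using assms by (auto simp: l2tendsto_def)
  have "(\<lambda>n. (\<integral>x. (F n x - f x)\<^sup>2 \<partial>lebesgue_on \<Omega>) * ip \<Omega> g g) \<longlonglongrightarrow> 0"
    using assms by (intro tendsto_mult_left_zero) (auto simp: l2tendsto_def)
  moreover have "(ip \<Omega> (F n) g - ip \<Omega> f g)\<^sup>2 \<le> (\<integral>x. (F n x - f x)\<^sup>2 \<partial>lebesgue_on \<Omega>) * ip \<Omega> g g" for n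
  proof -
    have "ip \<Omega> (F n) g - ip \<Omega> f g = ip \<Omega> (\<lambda>x. F n x - f x) g"
      using F f assms(2) by (simp add: left_diff_distrib L2_integrable_mult)
    then show ?thesis
      using L2_cauchy_schwarz[OF L2_diff[OF F f] assms(2), of n] by (simp add: power2_eq_square)
  qed
  ultimately have "(\<lambda>n. (ip \<Omega> (F n) g - ip \<Omega> f g)\<^sup>2) \<longlonglongrightarrow> 0"
    by (rule tendsto_0_sandwich) simp
  then have "(\<lambda>n. \<bar>ip \<Omega> (F n) g - ip \<Omega> f g\<bar>\<^sup>2) \<longlonglongrightarrow> 0" by simp
  then have "(\<lambda>n. \<bar>ip \<Omega> (F n) g - ip \<Omega> f g\<bar>) \<longlonglongrightarrow> 0"
    using tendsto_real_sqrt by fastforce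
  then show ?thesis
    by (simp add: tendsto_rabs_zero_iff LIM_zero_iff)
qed

text \<open>The product is expanded around the limit as
  \<open>(F - f) (G - g) + F g + G f - g f\<close>. Cauchy-Schwarz sends the first term to 0, and
  the next two are inner products against fixed functions.\<close>

lemma l2tendsto_ip:
  assumes "l2tendsto \<Omega> F f" "l2tendsto \<Omega> G g"
  shows "(\<lambda>n. ip \<Omega> (F n) (G n)) \<longlonglongrightarrow> ip \<Omega> f g"
proof -
  have F: "L2 \<Omega> (F n)" and f: "L2 \<Omega> f" and G: "L2 \<Omega> (G n)" and g: "L2 \<Omega> g" for n
    using assms by (auto simp: l2tendsto_def)
  have "(\<lambda>n. (\<integral>x. (F n x - f x)\<^sup>2 \<partial>lebesgue_on \<Omega>) * (\<integral>x. (G n x - g x)\<^sup>2 \<partial>lebesgue_on \<Omega>)) \<longlonglongrightarrow> 0"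
    using assms by (intro tendsto_mult_zero) (auto simp: l2tendsto_def)
  moreover have "(ip \<Omega> (\<lambda>x. F n x - f x) (\<lambda>x. G n x - g x))\<^sup>2 \<le>
      (\<integral>x. (F n x - f x)\<^sup>2 \<partial>lebesgue_on \<Omega>) * (\<integral>x. (G n x - g x)\<^sup>2 \<partial>lebesgue_on \<Omega>)" for n
    using L2_cauchy_schwarz[OF L2_diff[OF F f] L2_diff[OF G g], of n n] by (simp add: power2_eq_square)
  ultimately have "(\<lambda>n. (ip \<Omega> (\<lambda>x. F n x - f x) (\<lambda>x. G n x - g x))\<^sup>2) \<longlonglongrightarrow> 0"
    by (rule tendsto_0_sandwich) simp
  then have "(\<lambda>n. \<bar>ip \<Omega> (\<lambda>x. F n x - f x) (\<lambda>x. G n x - g x)\<bar>\<^sup>2) \<longlonglongrightarrow> 0" by simp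
  then have "(\<lambda>n. \<bar>ip \<Omega> (\<lambda>x. F n x - f x) (\<lambda>x. G n x - g x)\<bar>) \<longlonglongrightarrow> 0"
    using tendsto_real_sqrt by fastforce
  then have "(\<lambda>n. ip \<Omega> (\<lambda>x. F n x - f x) (\<lambda>x. G n x - g x)) \<longlonglongrightarrow> 0"
    by (simp add: tendsto_rabs_zero_iff)
  moreover have "(\<lambda>n. ip \<Omega> (F n) g) \<longlonglongrightarrow> ip \<Omega> f g" "(\<lambda>n. ip \<Omega> (G n) f) \<longlonglongrightarrow> ip \<Omega> g f"
    using l2tendsto_ip_const assms f g by blast+
  ultimately have "(\<lambda>n. ip \<Omega> (\<lambda>x. F n x - f x) (\<lambda>x. G n x - g x) + ip \<Omega> (F n) g + ip \<Omega> (G n) f - ip \<Omega> g f)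
      \<longlonglongrightarrow> 0 + ip \<Omega> f g + ip \<Omega> g f - ip \<Omega> g f"
    by (intro tendsto_intros)
  moreover have "ip \<Omega> (\<lambda>x. F n x - f x) (\<lambda>x. G n x - g x) + ip \<Omega> (F n) g + ip \<Omega> (G n) f - ip \<Omega> g f = ip \<Omega> (F n) (G n)" for n
  proof -
    have "ip \<Omega> (\<lambda>x. F n x - f x) (\<lambda>x. G n x - g x) =
      (\<integral>x. F n x * G n x - F n x * g x - G n x * f x + g x * f x \<partial>lebesgue_on \<Omega>)"
      by (intro Bochner_Integration.integral_cong) (auto simp: algebra_simps)
    also have "\<dots> = ip \<Omega> (F n) (G n) - ip \<Omega> (F n) g - ip \<Omega> (G n) f + ip \<Omega> g f"
      using F G f g by (simp add: L2_integrable_mult)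
    finally show ?thesis by simp
  qed
  ultimately show ?thesis by simp
qed

text \<open>The pointwise bound of \<open>(a + b)^2\<close> by \<open>2 a^2 + 2 b^2\<close> serves
  as the triangle inequality for squared norms.\<close>

lemma integral_sq_le:
  assumes "L2 \<Omega> f" "L2 \<Omega> g"
  shows "(\<integral>x. (f x + g x)\<^sup>2 \<partial>lebesgue_on \<Omega>) \<le>
    2 * (\<integral>x. (f x)\<^sup>2 \<partial>lebesgue_on \<Omega>) + 2 * (\<integral>x. (g x)\<^sup>2 \<partial>lebesgue_on \<Omega>)"
proof -
  have "(\<integral>x. (f x + g x)\<^sup>2 \<partial>lebesgue_on \<Omega>) \<le> (\<integral>x. 2 * (f x)\<^sup>2 + 2 * (g x)\<^sup>2 \<partial>lebesgue_on \<Omega>)"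
  proof (rule integral_mono)
    show "integrable (lebesgue_on \<Omega>) (\<lambda>x. (f x + g x)\<^sup>2)"
      using L2_add[OF assms] by (simp add: L2_def)
    show "integrable (lebesgue_on \<Omega>) (\<lambda>x. 2 * (f x)\<^sup>2 + 2 * (g x)\<^sup>2)"
      using assms by (simp add: L2_def)
    show "(f x + g x)\<^sup>2 \<le> 2 * (f x)\<^sup>2 + 2 * (g x)\<^sup>2" for x
      using sum_squares_bound[of "f x" "g x"] by (simp add: power2_sum)
  qed
  also have "\<dots> = 2 * (\<integral>x. (f x)\<^sup>2 \<partial>lebesgue_on \<Omega>) + 2 * (\<integral>x. (g x)\<^sup>2 \<partial>lebesgue_on \<Omega>)"
    using assms by (simp add: L2_def)
  finally show ?thesis .
qed

lemma l2tendsto_add: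
  assumes "l2tendsto \<Omega> F f" "l2tendsto \<Omega> G g"
  shows "l2tendsto \<Omega> (\<lambda>n x. F n x + G n x) (\<lambda>x. f x + g x)"
proof -
  have F: "L2 \<Omega> (F n)" and f: "L2 \<Omega> f" and G: "L2 \<Omega> (G n)" and g: "L2 \<Omega> g" for n
    using assms by (auto simp: l2tendsto_def)
  have "(\<integral>x. (F n x + G n x - (f x + g x))\<^sup>2 \<partial>lebesgue_on \<Omega>) \<le>
    2 * (\<integral>x. (F n x - f x)\<^sup>2 \<partial>lebesgue_on \<Omega>) + 2 * (\<integral>x. (G n x - g x)\<^sup>2 \<partial>lebesgue_on \<Omega>)" for n
    using integral_sq_le[OF L2_diff[OF F f] L2_diff[OF G g], of n n] by (simp add: algebra_simps)
  moreover have "(\<lambda>n. 2 * (\<integral>x. (F n x - f x)\<^sup>2 \<partial>lebesgue_on \<Omega>) + 2 * (\<integral>x. (G n x - g x)\<^sup>2 \<partial>lebesgue_on \<Omega>)) \<longlonglongrightarrow> 0"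
    using assms by (intro tendsto_add_zero tendsto_mult_right_zero) (auto simp: l2tendsto_def)
  ultimately have "(\<lambda>n. \<integral>x. (F n x + G n x - (f x + g x))\<^sup>2 \<partial>lebesgue_on \<Omega>) \<longlonglongrightarrow> 0"
    by (rule tendsto_0_sandwich) simp
  then show ?thesis using F f G g by (auto simp: l2tendsto_def intro!: L2_add)
qed

lemma l2tendsto_const: "L2 \<Omega> f \<Longrightarrow> l2tendsto \<Omega> (\<lambda>n. f) f"
  by (simp add: l2tendsto_def)

lemma l2tendsto_Linf_mult:
  assumes a: "Linf \<Omega> a" and F: "l2tendsto \<Omega> F f"
  shows "l2tendsto \<Omega> (\<lambda>n x. a x * F n x) (\<lambda>x. a x * f x)"
proof -
  have L: "L2 \<Omega> (F n)" "L2 \<Omega> f" for n using F by (auto simp: l2tendsto_def)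
  obtain C where C: "AE x in lebesgue_on \<Omega>. \<bar>a x\<bar> \<le> C"
    using a by (auto simp: Linf_def)
  have "(\<integral>x. (a x * F n x - a x * f x)\<^sup>2 \<partial>lebesgue_on \<Omega>) \<le> C\<^sup>2 * (\<integral>x. (F n x - f x)\<^sup>2 \<partial>lebesgue_on \<Omega>)" for n
  proof -
    have "(\<integral>x. (a x * F n x - a x * f x)\<^sup>2 \<partial>lebesgue_on \<Omega>) \<le> (\<integral>x. C\<^sup>2 * (F n x - f x)\<^sup>2 \<partial>lebesgue_on \<Omega>)"
    proof (rule integral_mono_AE)
      show "integrable (lebesgue_on \<Omega>) (\<lambda>x. (a x * F n x - a x * f x)\<^sup>2)"
        by (intro L2_integrable_sq L2_diff L2_Linf_mult a L)
      show "integrable (lebesgue_on \<Omega>) (\<lambda>x. C\<^sup>2 * (F n x - f x)\<^sup>2)"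
        by (intro integrable_mult_right L2_integrable_sq L2_diff L)
      show "AE x in lebesgue_on \<Omega>. (a x * F n x - a x * f x)\<^sup>2 \<le> C\<^sup>2 * (F n x - f x)\<^sup>2"
        using C
      proof eventually_elim
        case (elim x)
        then have "(a x)\<^sup>2 \<le> C\<^sup>2" by (metis abs_ge_zero power2_abs power_mono)
        then show ?case
          by (simp add: right_diff_distrib[symmetric] power_mult_distrib mult_right_mono)
      qed
    qed
    then show ?thesis by simp
  qed
  moreover have "(\<lambda>n. C\<^sup>2 * (\<integral>x. (F n x - f x)\<^sup>2 \<partial>lebesgue_on \<Omega>)) \<longlonglongrightarrow> 0"
    using F by (intro tendsto_mult_right_zero) (auto simp: l2tendsto_def)
  ultimately have "(\<lambda>n. \<integral>x. (a x * F n x - a x * f x)\<^sup>2 \<partial>lebesgue_on \<Omega>) \<longlonglongrightarrow> 0"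
    by (rule tendsto_0_sandwich) simp
  then show ?thesis using L a by (auto simp: l2tendsto_def intro!: L2_Linf_mult)
qed

section \<open>Integration and bounded convergence on the cube\<close>

abbreviation (input) cube_measure :: "(real^'n::finite) measure" where
  "cube_measure \<equiv> lebesgue_on unit_cube"

abbreviation (input) cip :: "(real^'n::finite \<Rightarrow> real) \<Rightarrow> (real^'n \<Rightarrow> real) \<Rightarrow> real" where
  "cip \<equiv> ip unit_cube"

lemma compact_unit_cube: "compact unit_cube"
  by (simp add: unit_cube_def)

lemma sets_unit_cube [measurable, simp]: "unit_cube \<in> sets lebesgue"
  by (simp add: unit_cube_def)

lemma finite_cube_measure: "finite_measure cube_measure"
  by (intro finite_measure_lebesgue_on) (simp add: unit_cube_def)

lemma AE_interior_unit_cube: "AE x in cube_measure. x \<in> interior unit_cube"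
proof -
  have "negligible (unit_cube - interior unit_cube :: (real^'n) set)"
    using negligible_frontier_interval[of "0::real^'n" "\<chi> i. 1"] by (simp add: unit_cube_def)
  then have "AE x in lebesgue. x \<notin> (unit_cube - interior unit_cube :: (real^'n) set)"
    by (metis AE_not_in negligible_iff_null_sets)
  then show ?thesis
    by (subst AE_restrict_space_iff) (auto elim!: eventually_mono)
qed

lemma continuous_cube_measurable:
  "continuous_on unit_cube f \<Longrightarrow> f \<in> borel_measurable cube_measure"
  by (intro continuous_imp_measurable_on_sets_lebesgue) auto

lemma continuous_cube_bounded:
  assumes "continuous_on unit_cube (f :: real^'n::finite \<Rightarrow> real)"
  obtains C where "0 \<le> C" "\<And>x. x \<in> unit_cube \<Longrightarrow> \<bar>f x\<bar> \<le> C"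
proof -
  have "bounded (f ` unit_cube)"
    using assms compact_unit_cube by (intro compact_imp_bounded compact_continuous_image)
  then obtain C where C: "\<And>x. x \<in> unit_cube \<Longrightarrow> \<bar>f x\<bar> \<le> C"
    unfolding bounded_iff by (metis imageI real_norm_def)
  have "(0::real^'n) \<in> unit_cube" by (simp add: mem_unit_cube)
  then have "0 \<le> C" using C[of 0] by linarith
  then show ?thesis using C that by blast
qed

lemma bounded_cube_integrable:
  fixes f :: "real^'n::finite \<Rightarrow> real"
  assumes "f \<in> borel_measurable cube_measure" "\<And>x. x \<in> unit_cube \<Longrightarrow> \<bar>f x\<bar> \<le> C"
  shows "integrable cube_measure f"
  by (rule finite_measure.integrable_const_bound[OF finite_cube_measure, of _ C])
    (use assms in \<open>auto intro!: AE_I2\<close>)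

lemma bounded_cube_L2:
  fixes f :: "real^'n::finite \<Rightarrow> real"
  assumes "f \<in> borel_measurable cube_measure" "\<And>x. x \<in> unit_cube \<Longrightarrow> \<bar>f x\<bar> \<le> C"
  shows "L2 unit_cube f"
proof -
  have "\<bar>(f x)\<^sup>2\<bar> \<le> C\<^sup>2" if "x \<in> unit_cube" for x
    using assms(2)[OF that] by (metis abs_ge_zero abs_power2 power2_abs power_mono)
  then show ?thesis
    using assms by (auto simp: L2_def intro!: bounded_cube_integrable[of _ "C\<^sup>2"])
qed

lemma continuous_cube_L2: "continuous_on unit_cube f \<Longrightarrow> L2 unit_cube f"
  by (metis continuous_cube_bounded bounded_cube_L2 continuous_cube_measurable)

lemma smooth_cube_L2: "smooth f \<Longrightarrow> L2 unit_cube f"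
  by (intro continuous_cube_L2 smooth_continuous)

lemma L2_cube_integrable:
  fixes f :: "real^'n::finite \<Rightarrow> real"
  assumes "L2 unit_cube f" shows "integrable cube_measure f"
  using L2_integrable_mult[OF assms continuous_cube_L2[of "\<lambda>x. 1"]] by simp

lemma integrable_mult_bounded:
  fixes f g :: "real^'n::finite \<Rightarrow> real"
  assumes "integrable cube_measure g" "f \<in> borel_measurable cube_measure"
    "\<And>x. x \<in> unit_cube \<Longrightarrow> \<bar>f x\<bar> \<le> C"
  shows "integrable cube_measure (\<lambda>x. g x * f x)"
proof (rule Bochner_Integration.integrable_bound)
  show "integrable cube_measure (\<lambda>x. C * g x)" using assms by simp
  show "(\<lambda>x. g x * f x) \<in> borel_measurable cube_measure" using assms by auto
  show "AE x in cube_measure. norm (g x * f x) \<le> norm (C * g x)"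
  proof (rule AE_I2)
    fix x :: "real^'n" assume "x \<in> space cube_measure"
    then have "\<bar>f x\<bar> \<le> \<bar>C\<bar>" using assms(3)[of x] by simp
    then show "norm (g x * f x) \<le> norm (C * g x)"
      by (simp add: abs_mult mult.commute mult_right_mono)
  qed
qed

text \<open>The weight \<open>g\<close> is only integrable while the \<open>F m\<close> are
  uniformly bounded; in this form cutoffs are removed against weak derivatives and against
  \<open>V\<close>.\<close>

lemma bounded_convergence_cube:
  fixes F :: "nat \<Rightarrow> real^'n::finite \<Rightarrow> real" and f g :: "real^'n \<Rightarrow> real"
  assumes g: "integrable cube_measure g" and m: "\<And>m. F m \<in> borel_measurable cube_measure"
    and f: "f \<in> borel_measurable cube_measure"
    and bd: "\<And>m x. x \<in> unit_cube \<Longrightarrow> \<bar>F m x\<bar> \<le> C"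
    and lim: "AE x in cube_measure. (\<lambda>m. F m x) \<longlonglongrightarrow> f x"
  shows "(\<lambda>m. \<integral>x. g x * F m x \<partial>cube_measure) \<longlonglongrightarrow> (\<integral>x. g x * f x \<partial>cube_measure)"
proof (rule integral_dominated_convergence)
  show "(\<lambda>x. g x * f x) \<in> borel_measurable cube_measure"
    "(\<lambda>x. g x * F m x) \<in> borel_measurable cube_measure" for m
    using g m f by auto
  show "integrable cube_measure (\<lambda>x. C * \<bar>g x\<bar>)" using g by simp
  show "AE x in cube_measure. (\<lambda>m. g x * F m x) \<longlonglongrightarrow> g x * f x"
    using lim by eventually_elim (intro tendsto_intros)
  show "AE x in cube_measure. norm (g x * F m x) \<le> C * \<bar>g x\<bar>" for m
    using bd by (intro AE_I2) (simp add: abs_mult, subst mult.commute, auto intro!: mult_right_mono)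
qed

lemma l2tendsto_bounded:
  fixes F :: "nat \<Rightarrow> real^'n::finite \<Rightarrow> real" and f :: "real^'n \<Rightarrow> real"
  assumes m: "\<And>m. F m \<in> borel_measurable cube_measure"
    and f: "f \<in> borel_measurable cube_measure"
    and bd: "\<And>m x. x \<in> unit_cube \<Longrightarrow> \<bar>F m x\<bar> \<le> C" "\<And>x. x \<in> unit_cube \<Longrightarrow> \<bar>f x\<bar> \<le> C"
    and lim: "AE x in cube_measure. (\<lambda>m. F m x) \<longlonglongrightarrow> f x"
  shows "l2tendsto unit_cube F f"
proof -
  have "(\<lambda>m. \<integral>x. 1 * (F m x - f x)\<^sup>2 \<partial>cube_measure) \<longlonglongrightarrow> (\<integral>x. 1 * 0 \<partial>(cube_measure :: (real^'n) measure))"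
  proof (rule bounded_convergence_cube[where C = "(2 * C)\<^sup>2"])
    show "integrable cube_measure (\<lambda>x. 1::real)"
      by (rule bounded_cube_integrable[of _ 1]) auto
    show "\<bar>(F m x - f x)\<^sup>2\<bar> \<le> (2 * C)\<^sup>2" if "x \<in> unit_cube" for m x
    proof -
      have "\<bar>F m x - f x\<bar> \<le> 2 * C" using bd(1)[OF that, of m] bd(2)[OF that] by linarith
      then show ?thesis by (metis abs_ge_zero abs_power2 power2_abs power_mono)
    qed
    show "AE x in cube_measure. (\<lambda>m. (F m x - f x)\<^sup>2) \<longlonglongrightarrow> 0"
      using lim by eventually_elim (auto intro!: tendsto_eq_intros)
  qed (use m f in auto)
  then show ?thesis using bd m f
    by (auto simp: l2tendsto_def intro!: bounded_cube_L2)
qed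

lemma L2_cube_loc_int:
  fixes v :: "real^'n::finite \<Rightarrow> real"
  assumes "L2 unit_cube v" shows "loc_int unit_cube v"
  unfolding loc_int_def
proof (intro conjI allI impI)
  show "v \<in> borel_measurable cube_measure" using assms by (rule L2_measurable)
  fix K :: "(real^'n) set" assume K: "compact K \<and> K \<subseteq> interior unit_cube"
  have int: "integrable lebesgue (\<lambda>x. indicator unit_cube x *\<^sub>R v x)"
    using L2_cube_integrable[OF assms] by (subst (asm) integrable_restrict_space) auto
  have KL: "K \<in> sets lebesgue" using K by (simp add: lmeasurable_compact fmeasurableD)
  have "integrable lebesgue (\<lambda>x. indicator K x *\<^sub>R (indicator unit_cube x *\<^sub>R v x))"
    by (rule integrable_mult_indicator[OF KL int])
  moreover have "indicator K x *\<^sub>R (indicator unit_cube x *\<^sub>R v x) = indicator K x *\<^sub>R v x" for x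
    using K interior_subset[of unit_cube] by (auto simp: indicator_def)
  ultimately have "integrable lebesgue (\<lambda>x. indicator K x *\<^sub>R v x)"
    by (simp only:)
  then show "integrable (lebesgue_on K) v"
    using KL by (subst integrable_restrict_space) auto
qed

text \<open>Local integrability gives no control up to the boundary, so \<open>v\<close> is first
  restricted to the compact support and then extended by zero to the cube.\<close>

lemma integrable_loc_int_compact_support:
  fixes v \<phi> :: "real^'n::finite \<Rightarrow> real"
  assumes v: "loc_int unit_cube v" and \<phi>: "continuous_on unit_cube \<phi>"
    and K: "compact (tsupp \<phi>)" "tsupp \<phi> \<subseteq> interior unit_cube"
  shows "integrable cube_measure (\<lambda>x. v x * \<phi> x)"
proof -
  let ?K = "tsupp \<phi>"
  have KL: "?K \<in> sets lebesgue" using K by (simp add: lmeasurable_compact fmeasurableD)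
  have "integrable (lebesgue_on ?K) v" using v K by (simp add: loc_int_def)
  then have i: "integrable lebesgue (\<lambda>x. indicator ?K x *\<^sub>R v x)"
    using KL by (subst (asm) integrable_restrict_space) auto
  have "integrable lebesgue (\<lambda>x. indicator unit_cube x *\<^sub>R (indicator ?K x *\<^sub>R v x))"
    by (rule integrable_mult_indicator[OF sets_unit_cube i])
  then have "integrable cube_measure (\<lambda>x. indicator ?K x *\<^sub>R v x)"
    by (subst integrable_restrict_space) simp_all
  moreover obtain C where "\<And>x. x \<in> unit_cube \<Longrightarrow> \<bar>\<phi> x\<bar> \<le> C"
    using continuous_cube_bounded[OF \<phi>] by blast
  ultimately have "integrable cube_measure (\<lambda>x. (indicator ?K x *\<^sub>R v x) * \<phi> x)"
    by (rule integrable_mult_bounded[OF _ continuous_cube_measurable[OF \<phi>]])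
  moreover have "(indicator ?K x *\<^sub>R v x) * \<phi> x = v x * \<phi> x" for x
    using not_in_tsupp[of x \<phi>] by (auto simp: indicator_def)
  ultimately show ?thesis by (simp only:)
qed

section \<open>Integration by parts\<close>

lemma has_derivative_along_axis:
  fixes F :: "real^'n::finite \<Rightarrow> real"
  assumes "\<And>x. F differentiable (at x)"
  shows "((\<lambda>s. F (x + s *\<^sub>R axis i 1)) has_real_derivative cpartial F i (x + s *\<^sub>R axis i 1)) (at s)"
proof -
  let ?D = "frechet_derivative F (at (x + s *\<^sub>R axis i 1))"
  have F: "(F has_derivative ?D) (at (x + s *\<^sub>R axis i 1))"
    using assms frechet_derivative_works by blast
  have "((\<lambda>s. x + s *\<^sub>R axis i 1) has_derivative (\<lambda>h. h *\<^sub>R axis i (1::real))) (at s)"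
    by (auto intro!: derivative_eq_intros)
  from has_derivative_compose[OF this F]
  have "((\<lambda>s. F (x + s *\<^sub>R axis i 1)) has_derivative (\<lambda>h. ?D (h *\<^sub>R axis i 1))) (at s)" .
  moreover have "(\<lambda>h. ?D (h *\<^sub>R axis i 1)) = (*) (cpartial F i (x + s *\<^sub>R axis i 1))"
    using has_derivative_bounded_linear[OF F, THEN bounded_linear.linear]
    by (auto simp: cpartial_def linear_cmul)
  ultimately show ?thesis by (simp add: has_field_derivative_def)
qed

lemma differentiable_imp_continuous_on_UNIV:
  fixes F :: "real^'n::finite \<Rightarrow> real"
  shows "(\<And>x. F differentiable (at x)) \<Longrightarrow> continuous_on A F"
  by (metis continuous_at_imp_continuous_on differentiable_imp_continuous_within)

lemma integrable_compact_support:
  fixes F :: "real^'n::finite \<Rightarrow> real"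
  assumes "continuous_on UNIV F" "compact (tsupp F)"
  shows "integrable lborel F"
proof -
  have "integrable lborel (\<lambda>x. indicator (tsupp F) x *\<^sub>R F x)"
    using assms by (intro borel_integrable_compact) (auto intro: continuous_on_subset)
  moreover have "(\<lambda>x. indicator (tsupp F) x *\<^sub>R F x) = F"
    using not_in_tsupp[of _ F] by (auto simp: indicator_def fun_eq_iff)
  ultimately show ?thesis by simp
qed

text \<open>By translation invariance every difference quotient of a compactly supported function has
  integral zero.\<close>

lemma integral_cpartial_eq_0:
  fixes F :: "real^'n::finite \<Rightarrow> real"
  assumes d: "\<And>x. F differentiable (at x)" and c: "continuous_on UNIV (cpartial F i)"
    and K: "compact (tsupp F)" "tsupp F \<subseteq> unit_cube"
  shows "(\<integral>x. cpartial F i x \<partial>cube_measure) = 0"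
proof -
  define G where "G = cpartial F i"
  define e :: "real^'n" where "e = axis i 1"
  have e: "norm e = 1" by (simp add: e_def)
  have line: "((\<lambda>s. F (x + s *\<^sub>R e)) has_real_derivative G (x + s *\<^sub>R e)) (at s)" for x s
    unfolding G_def e_def by (rule has_derivative_along_axis[OF d])
  have contF: "continuous_on UNIV F" by (rule differentiable_imp_continuous_on_UNIV[OF d])
  have G0: "G x = 0" if "x \<notin> tsupp F" for x
    using that tsupp_cpartial[of F i] not_in_tsupp[of x G] by (auto simp: G_def)
  have F0: "F x = 0" if "x \<notin> tsupp F" for x
    using that by (rule not_in_tsupp)
  have "bounded (G ` tsupp F)"
    using c K by (intro compact_imp_bounded compact_continuous_image) (auto simp: G_def intro: continuous_on_subset)
  then obtain B0 where B0: "\<And>x. x \<in> tsupp F \<Longrightarrow> \<bar>G x\<bar> \<le> B0"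
    unfolding bounded_iff by (metis imageI real_norm_def)
  \<comment> \<open>The support may be empty, and then \<open>B0\<close> is arbitrary; the maximum
    keeps the bound nonnegative.\<close>
  define B where "B = max 0 B0"
  have B: "\<bar>G x\<bar> \<le> B" "0 \<le> B" for x
    using B0[of x] G0[of x] by (cases "x \<in> tsupp F"; force simp: B_def)+
  obtain R where R: "\<And>x. x \<in> tsupp F \<Longrightarrow> norm x \<le> R"
    using compact_imp_bounded[OF K(1)] unfolding bounded_iff by blast
  define h where "h n = inverse (real (Suc n))" for n
  have h: "0 < h n" "h n \<le> 1" for n by (auto simp: h_def field_simps)
  define D where "D n x = (F (x + h n *\<^sub>R e) - F x) / h n" for n x
  have contD: "continuous_on UNIV (D n)" for n
    unfolding D_def using h[of n]
    by (intro continuous_intros continuous_on_compose2[OF contF]) auto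
  have intD: "(\<integral>x. D n x \<partial>lborel) = 0" for n
  proof -
    have intF: "integrable lborel F" by (rule integrable_compact_support[OF contF K(1)])
    have "integrable (distr lborel borel ((+) (h n *\<^sub>R e))) F"
      using intF by (simp add: lborel_distr_plus)
    then have i: "integrable lborel (\<lambda>x. F (h n *\<^sub>R e + x))"
      by (subst (asm) integrable_distr_eq) (auto intro: borel_measurable_continuous_onI contF)
    have "(\<integral>x. F x \<partial>lborel) = (\<integral>x. F x \<partial>distr lborel borel ((+) (h n *\<^sub>R e)))"
      by (simp add: lborel_distr_plus)
    also have "\<dots> = (\<integral>x. F (h n *\<^sub>R e + x) \<partial>lborel)"
      by (subst integral_distr) (auto intro: borel_measurable_continuous_onI contF)
    finally show ?thesis
      using i intF by (simp add: D_def add.commute)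
  qed
  have "(\<lambda>n. \<integral>x. D n x \<partial>lborel) \<longlonglongrightarrow> (\<integral>x. G x \<partial>lborel)"
  proof (rule integral_dominated_convergence)
    show "G \<in> borel_measurable lborel" "D n \<in> borel_measurable lborel" for n
      using c contD by (auto simp: G_def intro: borel_measurable_continuous_onI)
    \<comment> \<open>All shifts have length at most 1, so the difference quotients vanish outside
      the ball of radius \<open>R + 1\<close>; inside it the mean value theorem bounds them by
      \<open>B\<close>.\<close>
    show "integrable lborel (\<lambda>x. indicator (cball 0 (R + 1)) x *\<^sub>R B)"
      by (intro borel_integrable_compact) auto
    show "AE x in lborel. (\<lambda>n. D n x) \<longlonglongrightarrow> G x"
    proof (rule AE_I2)
      fix x
      have "((\<lambda>s. (F (x + s *\<^sub>R e) - F x) / s) \<longlongrightarrow> G x) (at 0)"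
        using line[of x 0] by (simp add: DERIV_def)
      moreover have "filterlim h (at 0) sequentially"
        unfolding filterlim_at using h(1) LIMSEQ_inverse_real_of_nat
        by (auto simp: h_def[abs_def] less_imp_neq[symmetric])
      ultimately show "(\<lambda>n. D n x) \<longlonglongrightarrow> G x"
        unfolding D_def by (rule filterlim_compose)
    qed
    show "AE x in lborel. norm (D n x) \<le> indicator (cball 0 (R + 1)) x *\<^sub>R B" for n
    proof (rule AE_I2)
      fix x
      show "norm (D n x) \<le> indicator (cball 0 (R + 1)) x *\<^sub>R B"
      proof (cases "x \<in> cball 0 (R + 1)")
        case True
        obtain z where "0 < z" "z < h n" "F (x + h n *\<^sub>R e) - F (x + 0 *\<^sub>R e) = (h n - 0) * G (x + z *\<^sub>R e)"
          using MVT2[of 0 "h n" "\<lambda>s. F (x + s *\<^sub>R e)" "\<lambda>s. G (x + s *\<^sub>R e)"] h(1)[of n] line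
          by blast
        then have "D n x = G (x + z *\<^sub>R e)"
          using h(1)[of n] by (simp add: D_def)
        then show ?thesis using True B by simp
      next
        case False
        then have x: "R + 1 < norm x" by simp
        have "norm x \<le> norm (x + h n *\<^sub>R e) + norm (h n *\<^sub>R e)"
          by (metis add_diff_cancel norm_triangle_ineq4)
        then have "R < norm (x + h n *\<^sub>R e)" using x h[of n] e by simp
        then have "F (x + h n *\<^sub>R e) = 0" "F x = 0"
          using R[of "x + h n *\<^sub>R e"] R[of x] x F0 by force+
        then show ?thesis using False by (simp add: D_def)
      qed
    qed
  qed
  then have "(\<integral>x. G x \<partial>lborel) = 0"
    using intD by (simp add: LIMSEQ_const_iff)
  moreover have "(\<integral>x. G x \<partial>cube_measure) = (\<integral>x. indicator unit_cube x *\<^sub>R G x \<partial>lebesgue)"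
    by (subst integral_restrict_space) auto
  moreover have "(\<lambda>x. indicator unit_cube x *\<^sub>R G x) = G"
    using G0 K by (force simp: indicator_def fun_eq_iff)
  moreover have "(\<integral>x. G x \<partial>lebesgue) = (\<integral>x. G x \<partial>lborel)"
    using c by (intro integral_completion) (auto simp: G_def intro: borel_measurable_continuous_onI)
  ultimately show ?thesis by (simp add: G_def)
qed

lemma integration_by_parts_cube:
  fixes f g :: "real^'n::finite \<Rightarrow> real"
  assumes f: "\<And>x. f differentiable (at x)" "continuous_on UNIV (cpartial f i)"
    and g: "\<And>x. g differentiable (at x)" "continuous_on UNIV (cpartial g i)"
    and K: "compact (tsupp g)" "tsupp g \<subseteq> interior unit_cube"
  shows "cip f (cpartial g i) = - cip (cpartial f i) g"
proof -
  let ?F = "\<lambda>x. f x * g x"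
  have eq: "cpartial ?F i = (\<lambda>x. cpartial f i x * g x + f x * cpartial g i x)"
    using f g by (intro cpartial_mult)
  have cf: "continuous_on A f" and cg: "continuous_on A g" for A
    using f g by (auto intro: differentiable_imp_continuous_on_UNIV)
  have sub: "tsupp ?F \<subseteq> tsupp g"
    by (rule tsupp_subset[OF closed_tsupp]) (simp add: not_in_tsupp)
  have "(\<integral>x. cpartial ?F i x \<partial>cube_measure) = 0"
  proof (rule integral_cpartial_eq_0)
    show "compact (tsupp ?F)"
      using sub K by (meson closed_tsupp compact_eq_bounded_closed bounded_subset)
    show "tsupp ?F \<subseteq> unit_cube" using sub K interior_subset by blast
    show "continuous_on UNIV (cpartial ?F i)"
      unfolding eq using f g cf cg by (intro continuous_intros)
  qed (use f g in \<open>auto intro: differentiable_mult\<close>)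
  moreover have "integrable cube_measure (\<lambda>x. cpartial f i x * g x)"
    "integrable cube_measure (\<lambda>x. f x * cpartial g i x)"
    using f g cf cg by (intro L2_integrable_mult continuous_cube_L2; auto intro: continuous_on_subset)+
  ultimately show ?thesis unfolding eq by simp
qed

section \<open>Fubini for tensor products\<close>

lemma integral_tensor_lborel:
  fixes g :: "'n::finite \<Rightarrow> real \<Rightarrow> real"
  assumes "\<And>i. integrable lborel (g i)"
  shows "(\<integral>x. tensor g x \<partial>lborel) = (\<Prod>i\<in>UNIV. \<integral>t. g i t \<partial>lborel)"
proof -
  interpret P: product_sigma_finite "\<lambda>_::real^'n. lborel :: real measure" ..
  \<comment> \<open>\<open>lborel\<close> is the image of a product measure indexed by basis
    vectors, so the coordinate index of a basis vector has to be recovered.\<close>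
  define ix where "ix b = (THE i. b = axis i (1::real))" for b :: "real^'n"
  have ix: "ix (axis i 1) = i" for i
    unfolding ix_def by (rule the_equality) (auto simp: axis_eq_axis)
  have bij: "bij_betw (\<lambda>i. axis i 1) UNIV (Basis :: (real^'n) set)"
    by (auto simp: bij_betw_def inj_on_def axis_eq_axis Basis_vec_def)
  have meas: "tensor g \<in> borel_measurable borel"
    unfolding tensor_def[abs_def] using assms
    by (intro borel_measurable_prod measurable_compose[of "\<lambda>x. x $ _" _ borel "g _"])
      (auto intro: borel_measurable_integrable[of lborel, simplified])
  have "(\<integral>x. tensor g x \<partial>lborel) =
      (\<integral>f. tensor g (\<Sum>b\<in>Basis. f b *\<^sub>R b) \<partial>(\<Pi>\<^sub>M b\<in>Basis. lborel))"
    by (subst lborel_eq, subst integral_distr) (auto simp: meas)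
  also have "\<dots> = (\<integral>f. (\<Prod>b\<in>Basis. g (ix b) (f b)) \<partial>(\<Pi>\<^sub>M b\<in>Basis. lborel))"
  proof (rule Bochner_Integration.integral_cong[OF refl])
    fix f :: "real^'n \<Rightarrow> real"
    have "(\<Sum>b\<in>Basis. f b *\<^sub>R b) $ i = f (axis i 1)" for i
    proof -
      have "(\<Sum>b\<in>Basis. f b *\<^sub>R b) $ i = (\<Sum>b\<in>Basis. f b *\<^sub>R b) \<bullet> axis i 1"
        by (simp add: inner_axis)
      also have "\<dots> = f (axis i 1)"
        by (rule inner_sum_left_Basis) (simp add: axis_in_Basis_iff)
      finally show ?thesis .
    qed
    then show "tensor g (\<Sum>b\<in>Basis. f b *\<^sub>R b) = (\<Prod>b\<in>Basis. g (ix b) (f b))"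
      unfolding tensor_def by (subst prod.reindex_bij_betw[OF bij, symmetric]) (simp add: ix)
  qed
  also have "\<dots> = (\<Prod>b\<in>Basis. \<integral>t. g (ix b) t \<partial>lborel)"
    using assms by (intro P.product_integral_prod) auto
  also have "\<dots> = (\<Prod>i\<in>UNIV. \<integral>t. g i t \<partial>lborel)"
    by (subst prod.reindex_bij_betw[OF bij, symmetric]) (simp add: ix)
  finally show ?thesis .
qed

text \<open>By Fubini the integral has the factor \<open>c 1 - c 0\<close>. With a product of two
  functions for \<open>c\<close>, this is integration by parts on the cube for factors without
  compact support.\<close>

lemma integral_tensor_deriv_eq_0:
  fixes h :: "'n::finite \<Rightarrow> real \<Rightarrow> real"
  assumes h: "\<And>j. smooth_real (h j)" and hi: "\<And>t. (c has_real_derivative h i t) (at t)" "c 0 = c 1"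
  shows "(\<integral>x. tensor h x \<partial>cube_measure) = 0"
proof -
  \<comment> \<open>The factors are restricted to [0, 1], so that their tensor product on the whole
    space is \<open>tensor h\<close> times the indicator of the cube.\<close>
  define g where "g j t = h j t * indicator {0..1} t" for j and t :: real
  have gi: "integrable lborel (g j)" for j
    unfolding g_def using smooth_real_continuous[OF h, of UNIV]
    by (intro borel_integrable_atLeastAtMost) (simp add: continuous_on_eq_continuous_at)
  have "(\<integral>t. g i t \<partial>lborel) = c 1 - c 0"
    unfolding g_def using smooth_real_continuous[OF h, of UNIV] hi
    by (intro integral_FTC_Icc_real) (auto simp: continuous_on_eq_continuous_at)
  then have "(\<integral>t. g i t \<partial>lborel) = 0" using hi(2) by simp
  then have "(\<integral>x. tensor g x \<partial>lborel) = 0"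
    by (subst integral_tensor_lborel[OF gi]) (auto intro: prod_zero)
  moreover have "tensor g x = indicator unit_cube x *\<^sub>R tensor h x" for x
  proof (cases "x \<in> unit_cube")
    case True
    then show ?thesis by (simp add: tensor_def g_def mem_unit_cube)
  next
    case False
    then obtain j where "x $ j \<notin> {0..1}" by (auto simp: mem_unit_cube)
    then have "g j (x $ j) = 0" by (simp add: g_def)
    then have "tensor g x = 0" by (auto simp: tensor_def intro: prod_zero)
    then show ?thesis using False by simp
  qed
  ultimately have "(\<integral>x. indicator unit_cube x *\<^sub>R tensor h x \<partial>lborel) = 0" by simp
  moreover have "(\<lambda>x. indicator unit_cube x *\<^sub>R tensor h x) \<in> borel_measurable lborel"
    using smooth_continuous[OF smooth_tensor[of h, OF h], of unit_cube]
      borel_measurable_continuous_on_indicator[of unit_cube "tensor h"]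
    by (simp add: unit_cube_def)
  ultimately have "(\<integral>x. indicator unit_cube x *\<^sub>R tensor h x \<partial>lebesgue) = 0"
    by (subst integral_completion) auto
  then show ?thesis by (subst integral_restrict_space) auto
qed

section \<open>Uniqueness of weak derivatives\<close>

text \<open>Measurability already provides continuous functions converging almost everywhere.
  Clamping them to [-C, C] bounds them uniformly and leaves the limit alone, since \<open>f\<close>
  takes its values there.\<close>

lemma bounded_measurable_continuous_approx:
  fixes f :: "real^'n::finite \<Rightarrow> real"
  assumes f: "f \<in> borel_measurable cube_measure" and C: "\<And>x. x \<in> unit_cube \<Longrightarrow> \<bar>f x\<bar> \<le> C"
  obtains d where "\<And>n. continuous_on UNIV (d n)" "\<And>n x. \<bar>d n x\<bar> \<le> C"
    "AE x in cube_measure. (\<lambda>n. d n x) \<longlonglongrightarrow> f x"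
proof -
  have "(0::real^'n) \<in> unit_cube" by (simp add: mem_unit_cube)
  then have C0: "0 \<le> C" using C[of 0] by linarith
  have "f measurable_on unit_cube"
    using f by (simp add: measurable_on_iff_borel_measurable)
  then obtain N c where N: "negligible N" and c: "\<And>n. continuous_on UNIV (c n)"
    and lim: "\<And>x. x \<notin> N \<Longrightarrow> (\<lambda>n. c n x) \<longlonglongrightarrow> (if x \<in> unit_cube then f x else 0)"
    unfolding measurable_on_def by blast
  define d where "d n x = max (- C) (min C (c n x))" for n x
  have "AE x in lebesgue. x \<notin> N"
    using N by (metis AE_not_in negligible_iff_null_sets)
  then have "AE x in cube_measure. x \<notin> N"
    by (subst AE_restrict_space_iff) (auto elim!: eventually_mono)
  moreover have "(\<lambda>n. d n x) \<longlonglongrightarrow> f x" if "x \<notin> N" "x \<in> unit_cube" for x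
  proof -
    have "(\<lambda>n. d n x) \<longlonglongrightarrow> max (- C) (min C (f x))"
      unfolding d_def using lim[OF that(1)] that(2) by (intro tendsto_intros) simp
    moreover have "max (- C) (min C (f x)) = f x" using C[OF that(2)] by linarith
    ultimately show ?thesis by simp
  qed
  ultimately have "AE x in cube_measure. (\<lambda>n. d n x) \<longlonglongrightarrow> f x"
    by (metis (mono_tags, lifting) AE_mp AE_I2 space_lebesgue_on)
  moreover have "continuous_on UNIV (d n)" for n
    unfolding d_def by (intro continuous_intros c)
  moreover have "\<bar>d n x\<bar> \<le> C" for n x using C0 by (auto simp: d_def)
  ultimately show ?thesis using that by blast
qed

text \<open>Testing with bounded continuous approximations of \<open>sgn g\<close> shows in the
  limit that the integral of the absolute value of \<open>g\<close> is 0.\<close>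

lemma AE_zero_if_orthogonal_continuous:
  fixes g :: "real^'n::finite \<Rightarrow> real"
  assumes g: "integrable cube_measure g"
    and orth: "\<And>f. continuous_on UNIV f \<Longrightarrow> cip g f = 0"
  shows "AE x in cube_measure. g x = 0"
proof -
  have sm: "(\<lambda>x. sgn (g x)) \<in> borel_measurable cube_measure" using g by auto
  obtain d where d: "\<And>n. continuous_on UNIV (d n)" "\<And>n x. \<bar>d n x\<bar> \<le> 1"
    "AE x in cube_measure. (\<lambda>n. d n x) \<longlonglongrightarrow> sgn (g x)"
    by (rule bounded_measurable_continuous_approx[OF sm, of 1]) (auto simp: abs_sgn_eq)
  have "(\<lambda>n. cip g (d n)) \<longlonglongrightarrow> cip g (\<lambda>x. sgn (g x))"
    by (rule bounded_convergence_cube[OF g _ sm d(2) d(3)])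
      (auto intro!: continuous_cube_measurable continuous_on_subset[OF d(1)])
  then have "cip g (\<lambda>x. sgn (g x)) = 0"
    using orth[OF d(1)] by (simp add: LIMSEQ_const_iff)
  then have "(\<integral>x. \<bar>g x\<bar> \<partial>cube_measure) = 0"
    by (simp add: abs_sgn)
  then show ?thesis
    using g by (subst (asm) integral_nonneg_eq_0_iff_AE) auto
qed

section \<open>The fundamental lemma of the calculus of variations\<close>

lemma mi_order_0: "mi_order (\<lambda>i. 0) = 0"
  by (simp add: mi_order_def)

lemma test_fun_cD:
  assumes "test_fun \<Omega> \<phi>"
  shows "cD \<alpha> \<phi> differentiable (at x)" "continuous_on A (cD \<alpha> \<phi>)"
    "compact (tsupp (cD \<alpha> \<phi>))" "tsupp (cD \<alpha> \<phi>) \<subseteq> interior \<Omega>"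
proof -
  show "cD \<alpha> \<phi> differentiable (at x)" "continuous_on A (cD \<alpha> \<phi>)"
    using assms by (auto simp: test_fun_def intro: continuous_on_subset)
  have "tsupp (cD \<alpha> \<phi>) \<subseteq> tsupp \<phi>" by (simp add: cD_def tsupp_cDk)
  then show "compact (tsupp (cD \<alpha> \<phi>))" "tsupp (cD \<alpha> \<phi>) \<subseteq> interior \<Omega>"
    using assms unfolding test_fun_def
    by (meson closed_tsupp compact_eq_bounded_closed bounded_subset, blast)
qed

lemma cD_0: "cD (\<lambda>i. 0) \<phi> = \<phi>"
  by (simp add: cD_def mi_order_0)

lemma test_fun_base:
  assumes "test_fun \<Omega> \<phi>"
  shows "\<phi> differentiable (at x)" "continuous_on A \<phi>" "compact (tsupp \<phi>)" "tsupp \<phi> \<subseteq> interior \<Omega>"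
  using test_fun_cD[OF assms, where \<alpha> = "\<lambda>i. 0"] by (simp_all add: cD_0)

lemma test_fun_mult_smooth:
  assumes "smooth \<eta>" "compact (tsupp \<eta>)" "tsupp \<eta> \<subseteq> interior \<Omega>" "smooth p"
  shows "test_fun \<Omega> (\<lambda>x. \<eta> x * p x)"
proof (rule test_funI)
  have sub: "tsupp (\<lambda>x. \<eta> x * p x) \<subseteq> tsupp \<eta>"
    by (rule tsupp_subset[OF closed_tsupp]) (simp add: not_in_tsupp)
  then show "tsupp (\<lambda>x. \<eta> x * p x) \<subseteq> interior \<Omega>" using assms by blast
  show "compact (tsupp (\<lambda>x. \<eta> x * p x))"
    using sub assms(2) by (meson closed_tsupp compact_eq_bounded_closed bounded_subset)
qed (use assms in \<open>auto intro: smooth_mult\<close>)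

text \<open>The index is shifted because \<open>test_fun_tensor\<close> asks for a positive
  parameter.\<close>

lemma test_fun_cube_cutoff: "test_fun unit_cube (tensor (\<lambda>i. cutoff (Suc m)))"
  by (rule test_fun_tensor[of _ "real (Suc m)"]) (auto intro: smooth_cutoff cutoff_eq_0 simp del: of_nat_Suc)

lemma cube_cutoff_eventually_1:
  assumes "x \<in> interior unit_cube"
  shows "\<forall>\<^sub>F m in sequentially. tensor (\<lambda>i. cutoff m) x = 1"
proof -
  have "\<forall>\<^sub>F m in sequentially. cutoff m (x $ i) = 1" for i
    using assms by (intro eventually_mono[OF cutoff_eventually_1[of "x $ i"]]) (auto simp: interior_unit_cube)
  then have "\<forall>\<^sub>F m in sequentially. \<forall>i. cutoff m (x $ i) = 1"
    by (rule eventually_all_finite)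
  then show ?thesis by eventually_elim (simp add: tensor_def)
qed

text \<open>A cutoff makes \<open>v\<close> integrable. A cutoff times a polynomial is a test
  function, and polynomials are uniformly dense in the continuous functions on the cube, so
  \<open>v\<close> times the cutoff is orthogonal to all continuous functions and vanishes almost
  everywhere. Every interior point lies where some cutoff is 1.\<close>

lemma fundamental_lemma:
  fixes v :: "real^'n::finite \<Rightarrow> real"
  assumes v: "loc_int unit_cube v" and orth: "\<And>\<phi>. test_fun unit_cube \<phi> \<Longrightarrow> cip v \<phi> = 0"
  shows "AE x in cube_measure. v x = 0"
proof -
  have "AE x in cube_measure. v x * tensor (\<lambda>i. cutoff (Suc m)) x = 0" for m
  proof (rule AE_zero_if_orthogonal_continuous)
    let ?\<eta> = "tensor (\<lambda>i::'n. cutoff (Suc m))"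
    have \<eta>: "smooth ?\<eta>" by (intro smooth_tensor smooth_cutoff)
    note t = test_fun_base[OF test_fun_cube_cutoff[where 'a='n, of m]]
    show gi: "integrable cube_measure (\<lambda>x. v x * ?\<eta> x)"
      by (rule integrable_loc_int_compact_support[OF v t(2,3,4)])
    fix f :: "real^'n \<Rightarrow> real" assume f: "continuous_on UNIV f"
    let ?g = "\<lambda>x. v x * ?\<eta> x"
    let ?A = "\<integral>x. \<bar>?g x\<bar> \<partial>cube_measure"
    have bound: "\<bar>cip ?g f\<bar> \<le> e * ?A" if e: "0 < e" for e
    proof -
      obtain p where p: "real_polynomial_function p" "\<And>x. x \<in> unit_cube \<Longrightarrow> \<bar>f x - p x\<bar> < e"
        using Stone_Weierstrass_real_polynomial_function[OF compact_unit_cube continuous_on_subset[OF f] e]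
        by blast
      have sp: "smooth p" by (rule smooth_polynomial[OF p(1)])
      have "cip v (\<lambda>x. ?\<eta> x * p x) = 0"
        by (intro orth test_fun_mult_smooth \<eta> t sp)
      then have gp: "cip ?g p = 0" by (simp add: mult.assoc)
      have cfp: "continuous_on unit_cube (\<lambda>x. f x - p x)" "continuous_on unit_cube f" "continuous_on unit_cube p"
        using f smooth_continuous[OF sp] by (auto intro!: continuous_intros intro: continuous_on_subset)
      have int: "integrable cube_measure (\<lambda>x. ?g x * q x)" if "continuous_on unit_cube q" for q
        by (rule continuous_cube_bounded[OF that])
          (rule integrable_mult_bounded[OF gi continuous_cube_measurable[OF that]])
      have "cip ?g f = cip ?g (\<lambda>x. f x - p x)"
        using gp int[OF cfp(2)] int[OF cfp(3)] by (simp add: right_diff_distrib)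
      also have "\<bar>\<dots>\<bar> \<le> (\<integral>x. \<bar>?g x * (f x - p x)\<bar> \<partial>cube_measure)"
        by (rule integral_abs_bound)
      also have "\<dots> \<le> (\<integral>x. e * \<bar>?g x\<bar> \<partial>cube_measure)"
      proof (rule integral_mono)
        show "integrable cube_measure (\<lambda>x. \<bar>?g x * (f x - p x)\<bar>)"
          using int[OF cfp(1)] by (rule integrable_abs)
        show "integrable cube_measure (\<lambda>x. e * \<bar>?g x\<bar>)"
          using gi by (intro integrable_mult_right integrable_abs)
        fix x :: "real^'n" assume "x \<in> space cube_measure"
        then have "\<bar>f x - p x\<bar> \<le> e" using p(2)[of x] by simp
        then have "\<bar>f x - p x\<bar> * \<bar>?g x\<bar> \<le> e * \<bar>?g x\<bar>" by (rule mult_right_mono) simp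
        then show "\<bar>?g x * (f x - p x)\<bar> \<le> e * \<bar>?g x\<bar>" by (metis abs_mult mult.commute)
      qed
      finally show ?thesis by simp
    qed
    show "cip ?g f = 0"
    proof (rule ccontr)
      define A I where "A = ?A" and "I = \<bar>cip ?g f\<bar>"
      assume "cip ?g f \<noteq> 0"
      then have I: "0 < I" and A: "0 \<le> A" by (auto simp: I_def A_def)
      have "I \<le> e * A" if "0 < e" for e
        using bound[OF that] by (simp only: A_def I_def)
      \<comment> \<open>A value of \<open>e\<close> with \<open>e * A < I\<close>; the summand 1
        covers the case \<open>A = 0\<close>.\<close>
      from this[of "I / (2 * (A + 1))"] have "I * (2 * (A + 1)) \<le> I * A" using I A by (simp add: field_simps)
      then show False using I A by (simp only: mult_le_cancel_left) auto
    qed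
  qed
  then have "AE x in cube_measure. \<forall>m. v x * tensor (\<lambda>i. cutoff (Suc m)) x = 0"
    by (subst AE_all_countable) blast
  then show ?thesis using AE_interior_unit_cube
  proof eventually_elim
    case (elim x)
    have "\<forall>\<^sub>F m in sequentially. tensor (\<lambda>i. cutoff (Suc m)) x = 1"
      using cube_cutoff_eventually_1[OF elim(2)] by (subst eventually_sequentially_Suc)
    then obtain m where "tensor (\<lambda>i. cutoff (Suc m)) x = 1"
      by (auto simp: eventually_sequentially)
    then show ?case using elim(1) by (metis mult.right_neutral)
  qed
qed

lemma loc_int_diff:
  "loc_int \<Omega> u \<Longrightarrow> loc_int \<Omega> v \<Longrightarrow> loc_int \<Omega> (\<lambda>x. u x - v x)"
  by (auto simp: loc_int_def)

lemma weak_deriv_diff: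
  assumes u: "weak_deriv unit_cube \<alpha> u v" and u': "weak_deriv unit_cube \<alpha> u' v'"
  shows "weak_deriv unit_cube \<alpha> (\<lambda>x. u x - u' x) (\<lambda>x. v x - v' x)"
proof -
  have l: "loc_int unit_cube u" "loc_int unit_cube v" "loc_int unit_cube u'" "loc_int unit_cube v'"
    using u u' by (auto simp: weak_deriv_def)
  have "cip (\<lambda>x. u x - u' x) (cD \<alpha> \<phi>) = (-1) ^ mi_order \<alpha> * cip (\<lambda>x. v x - v' x) \<phi>"
    if t: "test_fun unit_cube \<phi>" for \<phi>
  proof -
    have i: "integrable cube_measure (\<lambda>x. w x * \<phi> x)" "integrable cube_measure (\<lambda>x. w x * cD \<alpha> \<phi> x)"
      if "loc_int unit_cube w" for w
      using integrable_loc_int_compact_support[OF that] test_fun_base[OF t] test_fun_cD[OF t] by auto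
    have "cip u (cD \<alpha> \<phi>) = (-1) ^ mi_order \<alpha> * cip v \<phi>"
      "cip u' (cD \<alpha> \<phi>) = (-1) ^ mi_order \<alpha> * cip v' \<phi>"
      using u u' t by (auto simp: weak_deriv_def)
    then show ?thesis
      using i l by (simp add: left_diff_distrib right_diff_distrib)
  qed
  then show ?thesis using l by (auto simp: weak_deriv_def intro: loc_int_diff)
qed

lemma weak_deriv_unique:
  assumes "weak_deriv unit_cube \<alpha> u v" "weak_deriv unit_cube \<alpha> u v'"
  shows "AE x in cube_measure. v x = v' x"
proof -
  have "AE x in cube_measure. v x - v' x = 0"
  proof (rule fundamental_lemma)
    show "loc_int unit_cube (\<lambda>x. v x - v' x)"
      using assms by (auto simp: weak_deriv_def intro: loc_int_diff)
    show "cip (\<lambda>x. v x - v' x) \<phi> = 0" if "test_fun unit_cube \<phi>" for \<phi>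
      using weak_deriv_diff[OF assms] that by (auto simp: weak_deriv_def)
  qed
  then show ?thesis by simp
qed

lemma weak_deriv_wD: "weak_deriv \<Omega> \<alpha> u v \<Longrightarrow> weak_deriv \<Omega> \<alpha> u (wD \<Omega> \<alpha> u)"
  unfolding wD_def by (rule someI[of "weak_deriv \<Omega> \<alpha> u"])

lemma wD_AE_eq: "weak_deriv unit_cube \<alpha> u v \<Longrightarrow> AE x in cube_measure. wD unit_cube \<alpha> u x = v x"
  by (metis weak_deriv_unique weak_deriv_wD)

text \<open>\<open>wD\<close> picks an arbitrary weak derivative, not necessarily the square
  integrable one promised by \<open>Hk\<close>; uniqueness almost everywhere transfers square
  integrability to it.\<close>

lemma Hk_wD:
  assumes "Hk k unit_cube u" "mi_order \<alpha> \<le> k"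
  shows "weak_deriv unit_cube \<alpha> u (wD unit_cube \<alpha> u)" "L2 unit_cube (wD unit_cube \<alpha> u)"
proof -
  obtain v where v: "weak_deriv unit_cube \<alpha> u v" "L2 unit_cube v"
    using assms by (auto simp: Hk_def)
  show w: "weak_deriv unit_cube \<alpha> u (wD unit_cube \<alpha> u)" by (rule weak_deriv_wD[OF v(1)])
  show "L2 unit_cube (wD unit_cube \<alpha> u)"
    by (rule L2_cong_AE[OF v(2) _ weak_deriv_unique[OF v(1) w]])
      (use w in \<open>auto simp: weak_deriv_def loc_int_def\<close>)
qed

section \<open>Sine products against weak derivatives\<close>

abbreviation (input) mi0 :: "'n \<Rightarrow> nat" where
  "mi0 \<equiv> \<lambda>_. 0"

definition mi1 :: "'n \<Rightarrow> 'n \<Rightarrow> nat" where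
  "mi1 i = (\<lambda>k. if k = i then 1 else 0)"

text \<open>A sum of two unit vectors, so that the diagonal case has the entry 2 that occurs in
  \<open>wlap\<close>.\<close>

definition mi2 :: "'n \<Rightarrow> 'n \<Rightarrow> 'n \<Rightarrow> nat" where
  "mi2 i j = (\<lambda>k. (if k = i then 1 else 0) + (if k = j then 1 else 0))"

lemma mi2_same: "mi2 i i = (\<lambda>k. if k = i then 2 else 0)"
  by (auto simp: mi2_def)

lemma mi1_upd: "(\<lambda>_. 0)(i := Suc 0) = mi1 i"
  by (auto simp: mi1_def)

lemma mi2_upd: "(mi1 j)(i := Suc (mi1 j i)) = mi2 i j"
  by (auto simp: mi1_def mi2_def)

lemma mi_order_mi1: "mi_order (mi1 i) = 1"
  by (simp add: mi_order_def mi1_def)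

lemma mi_order_mi2: "mi_order (mi2 i j) = 2"
  by (simp add: mi_order_def mi2_def sum.distrib)

lemma cD_mi1: "cD (mi1 i) \<phi> = cpartial \<phi> i"
proof -
  have "(SOME k. 0 < mi1 i k) = i" by (rule some_equality) (auto simp: mi1_def split: if_splits)
  then show ?thesis by (simp add: cD_def mi_order_mi1 Let_def)
qed

lemma cD_mi2_same: "cD (mi2 i i) \<phi> = cpartial (cpartial \<phi> i) i"
proof -
  have 1: "(SOME k. 0 < mi2 i i k) = i" by (rule some_equality) (auto simp: mi2_def split: if_splits)
  have 2: "(mi2 i i)(i := mi2 i i i - Suc 0) = mi1 i" by (auto simp: mi2_def mi1_def)
  have 3: "(SOME k. 0 < mi1 i k) = i" by (rule some_equality) (auto simp: mi1_def split: if_splits)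
  show ?thesis by (simp add: cD_def mi_order_mi2 Let_def numeral_2_eq_2 1 2 3 del: fun_upd_apply)
qed

text \<open>One derivative at a time moves from the test function to the sine product, in the order
  in which \<open>cDk\<close> peels them off. The sine product collects them in its multi-index,
  which therefore varies in the induction.\<close>

lemma ip_sine_test:
  assumes "test_fun unit_cube \<phi>"
  shows "mi_order \<beta> = n \<Longrightarrow> cip (sine k \<alpha>) (cD \<beta> \<phi>)
    = (- 1) ^ n * cip (sine k (\<lambda>j. \<alpha> j + \<beta> j)) \<phi>"
proof (induction n arbitrary: \<alpha> \<beta>)
  case 0
  then have "\<beta> = (\<lambda>j. 0)" by (auto simp: mi_order_def)
  then show ?case by (simp add: cD_0)
next
  case (Suc n)
  \<comment> \<open>The same choice as in \<open>cDk\<close>, so that its unfolding exposes the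
    partial derivative in direction \<open>i\<close>.\<close>
  define i where "i = (SOME i. 0 < \<beta> i)"
  have "\<exists>i. 0 < \<beta> i" using Suc.prems by (metis mi_order_def gr0I sum.neutral nat.distinct(1))
  then have i: "0 < \<beta> i" unfolding i_def by (rule someI_ex)
  define \<beta>' where "\<beta>' = \<beta>(i := \<beta> i - 1)"
  have "mi_order \<beta> = Suc (mi_order \<beta>')"
    unfolding mi_order_def \<beta>'_def using i
    by (subst (1 2) sum.remove[of _ i]) (auto intro!: sum.cong)
  then have o: "mi_order \<beta>' = n" using Suc.prems by simp
  have cD: "cD \<beta> \<phi> = cpartial (cD \<beta>' \<phi>) i"
    using Suc.prems o by (simp add: cD_def Let_def i_def[symmetric] \<beta>'_def)
  have "cip (sine k \<alpha>) (cpartial (cD \<beta>' \<phi>) i) = - cip (cpartial (sine k \<alpha>) i) (cD \<beta>' \<phi>)"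
  proof (rule integration_by_parts_cube)
    show "continuous_on UNIV (cpartial (cD \<beta>' \<phi>) i)"
      using test_fun_cD(2)[OF assms, of _ \<beta>] by (simp add: cD)
  qed (use test_fun_cD[OF assms] smooth_sine smooth_differentiable smooth_continuous smooth_cpartial in blast)+
  also have "\<dots> = - ((- 1) ^ n * cip (sine k (\<lambda>j. (\<alpha>(i := Suc (\<alpha> i))) j + \<beta>' j)) \<phi>)"
    by (subst cpartial_sine, subst Suc.IH[OF o], rule refl)
  also have "(\<lambda>j. (\<alpha>(i := Suc (\<alpha> i))) j + \<beta>' j) = (\<lambda>j. \<alpha> j + \<beta> j)"
    using i by (auto simp: \<beta>'_def)
  finally show ?case by (simp add: cD)
qed

lemma weak_deriv_sine:
  assumes "test_fun unit_cube \<phi>"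
  shows "cip (sine k \<beta>) \<phi> = (- 1) ^ mi_order \<beta> * cip (sine k mi0) (cD \<beta> \<phi>)"
  using ip_sine_test[OF assms refl, of k "\<lambda>_. 0" \<beta>] by (simp flip: power_mult_distrib)

section \<open>Integration by parts for functions of zero trace\<close>

lemma C1c_weak_deriv:
  fixes \<psi> :: "real^'n::finite \<Rightarrow> real"
  assumes "C1c unit_cube \<psi>"
  shows "weak_deriv unit_cube (mi1 i) \<psi> (cpartial \<psi> i)"
    and "continuous_on A \<psi>" "continuous_on A (cpartial \<psi> i)"
proof -
  show c: "continuous_on A \<psi>" "continuous_on A (cpartial \<psi> i)" for A
    using assms by (auto simp: C1c_def intro: differentiable_imp_continuous_on_UNIV continuous_on_subset)
  have "cip \<psi> (cpartial \<phi> i) = - cip (cpartial \<psi> i) \<phi>" if t: "test_fun unit_cube \<phi>" for \<phi>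
    using assms test_fun_base[OF t] test_fun_cD(2)[OF t, of _ "mi1 i"]
    by (intro integration_by_parts_cube) (auto simp: C1c_def cD_mi1)
  then show "weak_deriv unit_cube (mi1 i) \<psi> (cpartial \<psi> i)"
    using c by (auto simp: weak_deriv_def cD_mi1 mi_order_mi1 intro!: L2_cube_loc_int continuous_cube_L2)
qed

lemma weak_deriv_0: "loc_int \<Omega> u \<Longrightarrow> weak_deriv \<Omega> (\<lambda>_. 0) u u"
  by (simp add: weak_deriv_def cD_0 mi_order_0)

lemma finite_mi_order_le: "finite {\<alpha> :: 'n::finite \<Rightarrow> nat. mi_order \<alpha> \<le> k}"
proof (rule finite_subset)
  show "{\<alpha> :: 'n \<Rightarrow> nat. mi_order \<alpha> \<le> k} \<subseteq> Pi UNIV (\<lambda>_. {..k})"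
  proof clarsimp
    fix \<alpha> :: "'n \<Rightarrow> nat" and i assume "mi_order \<alpha> \<le> k"
    moreover have "\<alpha> i \<le> mi_order \<alpha>" unfolding mi_order_def by (rule member_le_sum) auto
    ultimately show "\<alpha> i \<le> k" by simp
  qed
  show "finite (Pi UNIV (\<lambda>_::'n. {..k}))"
    using finite_PiE[of "UNIV :: 'n set" "\<lambda>_. {..k}"] by (simp add: PiE_UNIV_domain)
qed

text \<open>\<open>\<Phi>\<close> may be nonzero on the boundary. For an approximant from
  \<open>C1c\<close> there is no boundary term, and both sides depend continuously on
  \<open>u\<close> in the H1 norm.\<close>

lemma H10_by_parts:
  fixes u :: "real^'n::finite \<Rightarrow> real"
  assumes u: "H10 unit_cube u" and \<Phi>: "smooth \<Phi>"
  shows "cip (wD unit_cube (mi1 i) u) \<Phi> = - cip u (cpartial \<Phi> i)"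
proof -
  let ?D = "wD unit_cube (mi1 i) u"
  have H: "Hk 1 unit_cube u" using u by (simp add: H10_def)
  then have L: "L2 unit_cube u" by (simp add: Hk_def)
  have D: "weak_deriv unit_cube (mi1 i) u ?D" "L2 unit_cube ?D"
    using Hk_wD[OF H, of "mi1 i"] by (auto simp: mi_order_mi1)
  obtain \<psi> where \<psi>: "\<And>m. C1c unit_cube (\<psi> m)"
    and lim: "(\<lambda>m. Hk_norm_sq 1 unit_cube (\<lambda>x. \<psi> m x - u x)) \<longlonglongrightarrow> 0"
    using u by (auto simp: H10_def)
  \<comment> \<open>The squared distance between two weak derivatives of the same order is a summand
    of \<open>Hk_norm_sq\<close>, once the derivative chosen by \<open>wD\<close> is replaced by
    \<open>F m - f\<close> almost everywhere.\<close>
  have lt: "l2tendsto unit_cube F f"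
    if \<alpha>: "mi_order \<alpha> \<le> 1" and w: "\<And>m. weak_deriv unit_cube \<alpha> (\<psi> m) (F m)" "weak_deriv unit_cube \<alpha> u f"
      and LF: "\<And>m. L2 unit_cube (F m)" and Lf: "L2 unit_cube f" for \<alpha> F f
  proof -
    have "(\<integral>x. (F m x - f x)\<^sup>2 \<partial>cube_measure) \<le> Hk_norm_sq 1 unit_cube (\<lambda>x. \<psi> m x - u x)" for m
    proof -
      let ?W = "\<lambda>\<alpha>. wD unit_cube \<alpha> (\<lambda>x. \<psi> m x - u x)"
      have wd: "weak_deriv unit_cube \<alpha> (\<lambda>x. \<psi> m x - u x) (\<lambda>x. F m x - f x)"
        by (rule weak_deriv_diff[OF w])
      then have "?W \<alpha> \<in> borel_measurable cube_measure"
        using weak_deriv_wD[OF wd] by (simp add: weak_deriv_def loc_int_def)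
      moreover have "AE x in cube_measure. (F m x - f x)\<^sup>2 = (?W \<alpha> x)\<^sup>2"
        using wD_AE_eq[OF wd] by eventually_elim simp
      ultimately have "(\<integral>x. (F m x - f x)\<^sup>2 \<partial>cube_measure) = (\<integral>x. (?W \<alpha> x)\<^sup>2 \<partial>cube_measure)"
        using L2_measurable[OF LF] L2_measurable[OF Lf] by (intro integral_cong_AE) auto
      also have "\<dots> \<le> Hk_norm_sq 1 unit_cube (\<lambda>x. \<psi> m x - u x)"
        unfolding Hk_norm_sq_def
        by (rule member_le_sum[of \<alpha> _ "\<lambda>\<alpha>. \<integral>x. (?W \<alpha> x)\<^sup>2 \<partial>cube_measure"]) (use \<alpha> in \<open>auto simp: finite_mi_order_le\<close>)
      finally show ?thesis .
    qed
    from tendsto_0_sandwich(1)[OF this lim]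
    show ?thesis using LF Lf by (auto simp: l2tendsto_def)
  qed
  have lu: "l2tendsto unit_cube \<psi> u"
  proof (rule lt[of "\<lambda>_. 0"])
    show c: "L2 unit_cube (\<psi> m)" for m by (intro continuous_cube_L2 C1c_weak_deriv \<psi>)
    show "weak_deriv unit_cube (\<lambda>_. 0) (\<psi> m) (\<psi> m)" for m
      by (intro weak_deriv_0 L2_cube_loc_int c)
  qed (auto simp: mi_order_0 L intro!: weak_deriv_0 L2_cube_loc_int)
  have lD: "l2tendsto unit_cube (\<lambda>m. cpartial (\<psi> m) i) ?D"
    by (rule lt[of "mi1 i"]) (auto simp: mi_order_mi1 D intro!: C1c_weak_deriv \<psi> continuous_cube_L2)
  have sm: "L2 unit_cube \<Phi>" "L2 unit_cube (cpartial \<Phi> i)"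
    by (intro smooth_cube_L2 \<Phi> smooth_cpartial)+
  have "cip (cpartial (\<psi> m) i) \<Phi> = - cip (\<psi> m) (cpartial \<Phi> i)" for m
  proof -
    have "cip \<Phi> (cpartial (\<psi> m) i) = - cip (cpartial \<Phi> i) (\<psi> m)"
      using \<psi>[of m] by (intro integration_by_parts_cube)
        (auto simp: C1c_def intro!: smooth_differentiable smooth_continuous smooth_cpartial \<Phi>)
    then show ?thesis by (simp add: mult.commute)
  qed
  then have "(\<lambda>m. - cip (\<psi> m) (cpartial \<Phi> i)) \<longlonglongrightarrow> cip ?D \<Phi>"
    using l2tendsto_ip_const[OF lD sm(1)] by simp
  moreover have "(\<lambda>m. - cip (\<psi> m) (cpartial \<Phi> i)) \<longlonglongrightarrow> - cip u (cpartial \<Phi> i)"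
    by (intro tendsto_minus l2tendsto_ip_const[OF lu sm(2)])
  ultimately show ?thesis by (rule LIMSEQ_unique)
qed

lemma tensor_bound:
  assumes "\<And>i. \<bar>h i (x $ i)\<bar> \<le> C i"
  shows "\<bar>tensor h x\<bar> \<le> (\<Prod>i\<in>UNIV. C i)"
  unfolding tensor_def abs_prod using assms by (intro prod_mono) auto

lemma tensor_tendsto:
  assumes "\<And>i. (\<lambda>m. h m i (x $ i)) \<longlonglongrightarrow> g i (x $ i)"
  shows "(\<lambda>m. tensor (h m) x) \<longlonglongrightarrow> tensor g x"
  unfolding tensor_def by (intro tendsto_prod assms)

lemma csin_test_fun: "test_fun unit_cube (tensor (\<lambda>j. csin (k j) (Suc m)))"
  by (rule test_fun_tensor[of _ "real (Suc m)"]) (auto intro: smooth_csin csin_eq_0 simp del: of_nat_Suc)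

lemma smooth_tensor_measurable:
  "(\<And>i. smooth_real (h i)) \<Longrightarrow> tensor h \<in> borel_measurable cube_measure"
  by (intro continuous_cube_measurable smooth_continuous smooth_tensor)

lemma test_fun_cpartial:
  assumes "smooth \<phi>" "test_fun \<Omega> \<phi>" shows "test_fun \<Omega> (cpartial \<phi> i)"
proof (rule test_funI[OF smooth_cpartial[OF assms(1)]])
  show "tsupp (cpartial \<phi> i) \<subseteq> interior \<Omega>"
    using tsupp_cpartial[of \<phi> i] test_fun_base(4)[OF assms(2)] by blast
  show "compact (tsupp (cpartial \<phi> i))"
    using tsupp_cpartial[of \<phi> i] test_fun_base(3)[OF assms(2)]
    by (meson closed_tsupp compact_eq_bounded_closed bounded_subset)
qed

text \<open>Both \<open>csin\<close> and its derivative stay bounded, so the cutoffs may be removed in the weak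
  formulation; the boundary term for \<open>u\<close> vanishes because \<open>u\<close> is in \<open>H10\<close>.\<close>

lemma H10_H2_sine:
  fixes u :: "real^'n::finite \<Rightarrow> real"
  assumes u: "H10 unit_cube u" "Hk 2 unit_cube u"
  shows "cip (wD unit_cube (mi2 i i) u) (sine k mi0) = cip u (sine k (mi2 i i))"
proof -
  let ?D1 = "wD unit_cube (mi1 i) u" and ?D2 = "wD unit_cube (mi2 i i) u"
  have D1: "weak_deriv unit_cube (mi1 i) u ?D1" "L2 unit_cube ?D1"
    and D2: "weak_deriv unit_cube (mi2 i i) u ?D2" "L2 unit_cube ?D2"
    using Hk_wD[OF u(2)] by (auto simp: mi_order_mi1 mi_order_mi2)
  define h where "h m = (\<lambda>j. csin (k j) (Suc m))" for m
  define h1 where "h1 m = (h m)(i := csin' (k i) (Suc m))" for m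
  have smh: "smooth_real (h m j)" "smooth_real (h1 m j)" for m j
    by (auto simp: h_def h1_def smooth_csin)
  have c1: "cpartial (tensor (h m)) i = tensor (h1 m)" for m
    unfolding h1_def by (intro cpartial_tensor smh) (simp add: h_def csin_has_derivative)
  have t: "test_fun unit_cube (tensor (h m))" for m
    unfolding h_def by (rule csin_test_fun)
  \<comment> \<open>\<open>D_ii\<close> of \<open>tensor (h m)\<close> is \<open>D_i\<close> of the
    test function \<open>tensor (h1 m)\<close>; the second and the first weak derivative of
    \<open>u\<close> thus give two expressions for one integral.\<close>
  have eq: "cip ?D2 (tensor (h m)) = - cip ?D1 (tensor (h1 m))" for m
  proof -
    have "cip u (cpartial (tensor (h1 m)) i) = cip ?D2 (tensor (h m))"
      using D2(1) t[of m] by (auto simp: weak_deriv_def cD_mi2_same mi_order_mi2 c1[symmetric])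
    moreover have "test_fun unit_cube (tensor (h1 m))"
      using test_fun_cpartial[OF smooth_tensor t[of m], of i] smh by (simp add: c1)
    then have "cip u (cpartial (tensor (h1 m)) i) = - cip ?D1 (tensor (h1 m))"
      using D1(1) by (auto simp: weak_deriv_def cD_mi1 mi_order_mi1)
    ultimately show ?thesis by simp
  qed
  have "\<exists>C. 0 \<le> C \<and> (\<forall>m t. 0 \<le> t \<and> t \<le> 1 \<longrightarrow> \<bar>csin (k j) m t\<bar> \<le> C \<and> \<bar>csin' (k j) m t\<bar> \<le> C)" for j
  proof -
    obtain C where C: "0 \<le> C" "\<And>m t. 0 \<le> t \<Longrightarrow> t \<le> 1 \<Longrightarrow> \<bar>csin (k j) m t\<bar> \<le> C * (t * (1 - t))"
      "\<And>m t. 0 \<le> t \<Longrightarrow> t \<le> 1 \<Longrightarrow> \<bar>csin' (k j) m t\<bar> \<le> C"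
      using csin_bounds by metis
    have "\<bar>csin (k j) m t\<bar> \<le> C" if "0 \<le> t" "t \<le> 1" for m t
    proof -
      have "C * (t * (1 - t)) \<le> C * 1" using C(1) that by (intro mult_left_mono mult_le_one) auto
      then show ?thesis using C(2)[OF that, of m] by simp
    qed
    then show ?thesis using C by blast
  qed
  then obtain C where C: "\<And>j m t. 0 \<le> t \<Longrightarrow> t \<le> 1 \<Longrightarrow> \<bar>csin (k j) m t\<bar> \<le> C j \<and> \<bar>csin' (k j) m t\<bar> \<le> C j"
    by metis
  have lim0: "(\<lambda>m. cip ?D2 (tensor (h m))) \<longlonglongrightarrow> cip ?D2 (sine k mi0)"
  proof (rule bounded_convergence_cube)
    show "\<bar>tensor (h m) x\<bar> \<le> (\<Prod>j\<in>UNIV. C j)" if "x \<in> unit_cube" for m x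
      using that C by (intro tensor_bound) (auto simp: h_def mem_unit_cube)
    show "AE x in cube_measure. (\<lambda>m. tensor (h m) x) \<longlonglongrightarrow> sine k mi0 x"
      using AE_interior_unit_cube
    proof eventually_elim
      case (elim x)
      show ?case unfolding sine_def
        using elim by (intro tensor_tendsto) (auto simp: h_def interior_unit_cube intro!: LIMSEQ_Suc csin_tendsto)
    qed
    show "sine k mi0 \<in> borel_measurable cube_measure"
      by (intro continuous_cube_measurable smooth_continuous smooth_sine)
  qed (auto intro: L2_cube_integrable D2 smooth_tensor_measurable smh)
  have lim1: "(\<lambda>m. cip ?D1 (tensor (h1 m))) \<longlonglongrightarrow> cip ?D1 (sine k (mi1 i))"
  proof (rule bounded_convergence_cube)
    show "\<bar>tensor (h1 m) x\<bar> \<le> (\<Prod>j\<in>UNIV. C j)" if "x \<in> unit_cube" for m x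
      using that C by (intro tensor_bound) (auto simp: h_def h1_def mem_unit_cube)
    show "AE x in cube_measure. (\<lambda>m. tensor (h1 m) x) \<longlonglongrightarrow> sine k (mi1 i) x"
      using AE_interior_unit_cube
    proof eventually_elim
      case (elim x)
      have "(\<lambda>m. h1 m j (x $ j)) \<longlonglongrightarrow> trig (k j) (mi1 i j) (x $ j)" for j
        using elim by (cases "j = i")
          (auto simp: h1_def h_def mi1_def interior_unit_cube intro!: LIMSEQ_Suc csin_tendsto csin_tendsto[unfolded One_nat_def])
      then show ?case unfolding sine_def by (rule tensor_tendsto)
    qed
    show "sine k (mi1 i) \<in> borel_measurable cube_measure"
      by (intro continuous_cube_measurable smooth_continuous smooth_sine)
  qed (auto intro: L2_cube_integrable D1 smooth_tensor_measurable smh)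
  have "cip ?D2 (sine k mi0) = - cip ?D1 (sine k (mi1 i))"
    using lim0 tendsto_minus[OF lim1] unfolding eq by (rule LIMSEQ_unique)
  also have "\<dots> = cip u (cpartial (sine k (mi1 i)) i)"
    using H10_by_parts[OF u(1) smooth_sine] by simp
  also have "cpartial (sine k (mi1 i)) i = sine k (mi2 i i)"
    by (simp add: cpartial_sine mi2_upd del: fun_upd_apply)
  finally show ?thesis .
qed

section \<open>Integral identities for products of sines\<close>

lemma sine_mult: "sine k \<alpha> x * sine l \<beta> x = tensor (\<lambda>j t. trig (k j) (\<alpha> j) t * trig (l j) (\<beta> j) t) x"
  by (simp add: sine_def tensor_def prod.distrib)

text \<open>The boundary term in direction \<open>i\<close> contains a factor of even order in that
  direction, which is zero at both ends.\<close>

lemma sine_by_parts: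
  fixes k l \<alpha> \<beta> :: "'n::finite \<Rightarrow> nat"
  assumes ev: "even (\<alpha> i) \<or> even (\<beta> i)"
  shows "cip (sine k (\<alpha>(i := Suc (\<alpha> i)))) (sine l \<beta>) = - cip (sine k \<alpha>) (sine l (\<beta>(i := Suc (\<beta> i))))"
proof -
  define c where "c t = trig (k i) (\<alpha> i) t * trig (l i) (\<beta> i) t" for t
  define c' where "c' t = trig (k i) (Suc (\<alpha> i)) t * trig (l i) (\<beta> i) t + trig (k i) (\<alpha> i) t * trig (l i) (Suc (\<beta> i)) t" for t
  define h where "h = (\<lambda>j t. trig (k j) (\<alpha> j) t * trig (l j) (\<beta> j) t)(i := c')"
  have "smooth_real (h j)" for j
    by (auto simp: h_def c'_def[abs_def] intro!: smooth_real_intros(3,4) smooth_trig)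
  moreover have "(c has_real_derivative h i t) (at t)" for t
    unfolding c_def[abs_def] h_def c'_def[abs_def] fun_upd_same
    by (rule derivative_eq_intros trig_has_derivative refl)+ simp
  moreover have "c 0 = c 1"
    using ev trig_even_0_1 by (auto simp: c_def)
  ultimately have 0: "(\<integral>x. tensor h x \<partial>cube_measure) = 0"
    by (rule integral_tensor_deriv_eq_0)
  have "tensor h x = sine k (\<alpha>(i := Suc (\<alpha> i))) x * sine l \<beta> x + sine k \<alpha> x * sine l (\<beta>(i := Suc (\<beta> i))) x" for x
  proof -
    have "(\<Prod>j\<in>UNIV. f j) = f i * (\<Prod>j\<in>UNIV-{i}. f j)" for f :: "'n \<Rightarrow> real"
      by (rule prod.remove) auto
    note r = this
    have "tensor h x = c' (x $ i) * (\<Prod>j\<in>UNIV-{i}. trig (k j) (\<alpha> j) (x $ j) * trig (l j) (\<beta> j) (x $ j))"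
      unfolding tensor_def by (subst r) (auto simp: h_def intro!: prod.cong)
    moreover have "sine k (\<alpha>(i := Suc (\<alpha> i))) x * sine l \<beta> x =
      (trig (k i) (Suc (\<alpha> i)) (x $ i) * trig (l i) (\<beta> i) (x $ i)) * (\<Prod>j\<in>UNIV-{i}. trig (k j) (\<alpha> j) (x $ j) * trig (l j) (\<beta> j) (x $ j))"
      unfolding sine_mult tensor_def by (subst r) (auto intro!: prod.cong)
    moreover have "sine k \<alpha> x * sine l (\<beta>(i := Suc (\<beta> i))) x =
      (trig (k i) (\<alpha> i) (x $ i) * trig (l i) (Suc (\<beta> i)) (x $ i)) * (\<Prod>j\<in>UNIV-{i}. trig (k j) (\<alpha> j) (x $ j) * trig (l j) (\<beta> j) (x $ j))"
      unfolding sine_mult tensor_def by (subst r) (auto intro!: prod.cong)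
    ultimately show ?thesis by (simp add: c'_def distrib_right)
  qed
  moreover have "integrable cube_measure (\<lambda>x. sine k' \<alpha>' x * sine l' \<beta>' x)" for k' l' \<alpha>' \<beta>' :: "'n \<Rightarrow> nat"
    by (intro L2_integrable_mult smooth_cube_L2 smooth_sine)
  ultimately show ?thesis using 0 by simp
qed

lemma sine_mi2_same: "sine k (mi2 i i) x = - (real (k i) * pi)\<^sup>2 * sine k mi0 x"
proof -
  have "sine k (mi2 i i) x = trig (k i) 2 (x $ i) * (\<Prod>j\<in>UNIV-{i}. trig (k j) 0 (x $ j))"
    unfolding sine_def tensor_def by (subst prod.remove[of _ i]) (auto simp: mi2_def numeral_2_eq_2 intro!: prod.cong)
  moreover have "sine k mi0 x = trig (k i) 0 (x $ i) * (\<Prod>j\<in>UNIV-{i}. trig (k j) 0 (x $ j))"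
    unfolding sine_def tensor_def by (subst prod.remove[of _ i]) auto
  ultimately show ?thesis using trig_2[of "k i" 0 "x $ i"] by (simp add: numeral_2_eq_2)
qed

lemma ip_sine_grad:
  "cip (sine k (mi1 i)) (sine l (mi1 i)) = - cip (sine k mi0) (sine l (mi2 i i))"
  using sine_by_parts[of "\<lambda>_. 0" i "mi1 i" k l] by (simp add: mi2_upd mi1_upd del: fun_upd_apply)

text \<open>\<open>D_ii\<close> is symmetric on sine products by \<open>ip_sine_grad\<close>, and in
  a direction where the frequencies differ the two products are eigenfunctions for different
  eigenvalues.\<close>

lemma ip_sine_orthogonal:
  assumes "k \<noteq> l"
  shows "cip (sine k mi0) (sine l mi0) = 0"
proof -
  let ?I = "cip (sine k mi0) (sine l mi0)"
  obtain i where i: "k i \<noteq> l i" using assms by auto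
  have "cip (sine k mi0) (sine l (mi2 i i)) = cip (sine l mi0) (sine k (mi2 i i))"
    using ip_sine_grad[of k i l] ip_sine_grad[of l i k] by (simp add: mult.commute)
  moreover have "cip (sine k mi0) (sine l (mi2 i i)) = - (real (l i) * pi)\<^sup>2 * ?I"
    unfolding sine_mi2_same by (subst integral_mult_right_zero[symmetric]) (simp add: mult_ac)
  moreover have "cip (sine l mi0) (sine k (mi2 i i)) = - (real (k i) * pi)\<^sup>2 * ?I"
    unfolding sine_mi2_same by (subst integral_mult_right_zero[symmetric]) (simp add: mult_ac)
  ultimately have "(real (l i) * pi)\<^sup>2 * ?I = (real (k i) * pi)\<^sup>2 * ?I" by simp
  moreover have "(real (l i) * pi)\<^sup>2 \<noteq> (real (k i) * pi)\<^sup>2"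
    using i by (simp add: power_mult_distrib)
  ultimately show ?thesis by simp
qed

text \<open>For distinct \<open>i\<close> and \<open>j\<close>, \<open>D_i\<close> moves from the
  right factor to the left one, then \<open>D_j\<close> from the left to the right. The boundary
  terms vanish because in the first move the right factor has order 0 in direction \<open>i\<close>,
  and in the second the left factor has order 0 in direction \<open>j\<close>.\<close>

lemma ip_sine_hessian:
  "cip (sine k (mi2 i j)) (sine l (mi2 i j)) = cip (sine k (mi2 i i)) (sine l (mi2 j j))"
proof (cases "i = j")
  case False
  have 1: "mi2 i j = (mi1 j)(i := Suc (mi1 j i))" "mi2 i j = (mi1 i)(j := Suc (mi1 i j))"
    "mi2 i i = (mi1 i)(i := Suc (mi1 i i))" "mi2 j j = (mi1 j)(j := Suc (mi1 j j))"
    by (auto simp: mi2_def mi1_def)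
  have 2: "(mi2 i j)(i := Suc (mi2 i j i)) = (mi2 i i)(j := Suc (mi2 i i j))"
    using False by (auto simp: mi2_def)
  have "cip (sine k (mi2 i j)) (sine l (mi2 i j)) = - cip (sine k ((mi2 i j)(i := Suc (mi2 i j i)))) (sine l (mi1 j))"
  proof -
    have "even (mi1 j i)" using False by (simp add: mi1_def)
    from sine_by_parts[of "mi2 i j" i "mi1 j" k l, OF disjI2[OF this]] show ?thesis
      by (simp add: mi2_upd del: fun_upd_apply)
  qed
  also have "\<dots> = cip (sine k (mi2 i i)) (sine l (mi2 j j))"
    using sine_by_parts[of "mi2 i i" j "mi1 j" k l] False unfolding 2 by (simp add: mi2_upd del: fun_upd_apply) (simp add: mi2_def)
  finally show ?thesis .
qed simp

text \<open>One coefficient family with varying \<open>\<alpha>\<close> describes a sine polynomial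
  together with all its derivatives.\<close>

definition sine_poly :: "('n \<Rightarrow> nat) set \<Rightarrow> (('n \<Rightarrow> nat) \<Rightarrow> real) \<Rightarrow> ('n \<Rightarrow> nat) \<Rightarrow> real^'n::finite \<Rightarrow> real" where
  "sine_poly K c \<alpha> x = (\<Sum>k\<in>K. c k * sine k \<alpha> x)"

lemma L2_sine: "L2 unit_cube (sine k \<alpha>)"
  by (intro smooth_cube_L2 smooth_sine)

lemma L2_sine_poly: "L2 unit_cube (sine_poly K c \<alpha>)"
  unfolding sine_poly_def[abs_def] by (intro L2_sum L2_cmult L2_sine)

lemma ip_sine_poly_left:
  assumes "L2 unit_cube g"
  shows "cip g (sine_poly K c \<alpha>) = (\<Sum>k\<in>K. c k * cip g (sine k \<alpha>))"
proof -
  have "cip g (sine_poly K c \<alpha>) = (\<integral>x. (\<Sum>k\<in>K. c k * (g x * sine k \<alpha> x)) \<partial>cube_measure)"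
    by (simp add: sine_poly_def sum_distrib_left mult_ac)
  also have "\<dots> = (\<Sum>k\<in>K. c k * cip g (sine k \<alpha>))"
    by (subst Bochner_Integration.integral_sum) (auto intro!: L2_integrable_mult assms L2_sine)
  finally show ?thesis .
qed

lemma ip_sine_poly:
  "cip (sine_poly K c \<alpha>) (sine_poly K d \<beta>) =
    (\<Sum>l\<in>K. \<Sum>k\<in>K. d l * c k * cip (sine k \<alpha>) (sine l \<beta>))"
proof -
  have "cip (sine_poly K c \<alpha>) (sine l \<beta>) = (\<Sum>k\<in>K. c k * cip (sine k \<alpha>) (sine l \<beta>))" for l
    using ip_sine_poly_left[OF L2_sine, of l \<beta> K c \<alpha>] by (simp add: mult.commute)
  then show ?thesis
    by (simp add: ip_sine_poly_left[OF L2_sine_poly] sum_distrib_left mult.assoc)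
qed

lemma ip_sine_poly_hessian:
  "cip (sine_poly K c (mi2 i j)) (sine_poly K c (mi2 i j)) =
    cip (sine_poly K c (mi2 i i)) (sine_poly K c (mi2 j j))"
  by (simp add: ip_sine_poly ip_sine_hessian)

lemma ip_sine_poly_grad:
  "cip (sine_poly K c (mi1 i)) (sine_poly K c (mi1 i)) =
    - cip (sine_poly K c mi0) (sine_poly K c (mi2 i i))"
  by (simp add: ip_sine_poly ip_sine_grad sum_negf)

section \<open>Density of sine polynomials\<close>

definition l2closure :: "((real^'n::finite \<Rightarrow> real) \<Rightarrow> bool) \<Rightarrow> (real^'n \<Rightarrow> real) \<Rightarrow> bool" where
  "l2closure D f \<longleftrightarrow> (\<exists>F. (\<forall>n. D (F n)) \<and> l2tendsto unit_cube F f)"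

text \<open>A diagonal choice: \<open>h n\<close> is taken from \<open>D\<close> with squared
  distance to \<open>G n\<close> below \<open>1 / (n + 1)\<close>.\<close>

lemma l2closure_limit:
  fixes G :: "nat \<Rightarrow> real^'n::finite \<Rightarrow> real"
  assumes G: "l2tendsto unit_cube G f" and cl: "\<And>n. l2closure D (G n)"
  shows "l2closure D f"
proof -
  have "\<exists>h. D h \<and> L2 unit_cube h \<and> (\<integral>x. (h x - G n x)\<^sup>2 \<partial>cube_measure) < inverse (real (Suc n))" for n
  proof -
    obtain F where F: "\<And>m. D (F m)" "l2tendsto unit_cube F (G n)"
      using cl[of n] by (auto simp: l2closure_def)
    have "(\<lambda>m. \<integral>x. (F m x - G n x)\<^sup>2 \<partial>cube_measure) \<longlonglongrightarrow> 0" using F(2) by (simp add: l2tendsto_def)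
    then have "\<forall>\<^sub>F m in sequentially. (\<integral>x. (F m x - G n x)\<^sup>2 \<partial>cube_measure) < inverse (real (Suc n))"
      by (rule order_tendstoD) simp
    then obtain m where "(\<integral>x. (F m x - G n x)\<^sup>2 \<partial>cube_measure) < inverse (real (Suc n))"
      by (auto simp: eventually_sequentially)
    then show ?thesis using F by (auto simp: l2tendsto_def)
  qed
  then obtain h where h: "\<And>n. D (h n)" "\<And>n. L2 unit_cube (h n)"
    "\<And>n. (\<integral>x. (h n x - G n x)\<^sup>2 \<partial>cube_measure) < inverse (real (Suc n))"
    by metis
  have GL: "L2 unit_cube (G n)" "L2 unit_cube f" for n using G by (auto simp: l2tendsto_def)
  have "(\<integral>x. (h n x - f x)\<^sup>2 \<partial>cube_measure) \<le> 2 * inverse (real (Suc n)) + 2 * (\<integral>x. (G n x - f x)\<^sup>2 \<partial>cube_measure)" for n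
    using integral_sq_le[OF L2_diff[OF h(2) GL(1)] L2_diff[OF GL], of n n n] h(3)[of n] by simp
  moreover have "(\<lambda>n. 2 * inverse (real (Suc n)) + 2 * (\<integral>x. (G n x - f x)\<^sup>2 \<partial>cube_measure)) \<longlonglongrightarrow> 0"
    using G LIMSEQ_inverse_real_of_nat
    by (intro tendsto_add_zero tendsto_mult_right_zero) (auto simp: l2tendsto_def)
  ultimately have "(\<lambda>n. \<integral>x. (h n x - f x)\<^sup>2 \<partial>cube_measure) \<longlonglongrightarrow> 0"
    by (rule tendsto_0_sandwich) simp
  then show ?thesis using h GL by (auto simp: l2closure_def l2tendsto_def)
qed

lemma l2tendsto_truncate:
  fixes g :: "real^'n::finite \<Rightarrow> real"
  assumes g: "L2 unit_cube g"
  shows "l2tendsto unit_cube (\<lambda>n x. max (- real n) (min (real n) (g x))) g"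
proof -
  let ?T = "\<lambda>n x. max (- real n) (min (real n) (g x))"
  have m: "g \<in> borel_measurable cube_measure" using g by (rule L2_measurable)
  have L: "L2 unit_cube (?T n)" for n
    by (rule bounded_cube_L2[of _ "real n"]) (use m in auto)
  have "(\<lambda>n. \<integral>x. (?T n x - g x)\<^sup>2 \<partial>cube_measure) \<longlonglongrightarrow> (\<integral>x. 0 \<partial>(cube_measure :: (real^'n) measure))"
  proof (rule integral_dominated_convergence)
    show "integrable cube_measure (\<lambda>x. (g x)\<^sup>2)" using g by (rule L2_integrable_sq)
    show "AE x in cube_measure. (\<lambda>n. (?T n x - g x)\<^sup>2) \<longlonglongrightarrow> 0"
    proof (rule AE_I2)
      fix x
      have "\<forall>\<^sub>F n in sequentially. \<bar>g x\<bar> \<le> real n"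
        by (rule eventually_sequentiallyI[of "nat \<lceil>\<bar>g x\<bar>\<rceil>"]) linarith
      then have "\<forall>\<^sub>F n in sequentially. (?T n x - g x)\<^sup>2 = 0"
      proof eventually_elim
        case (elim n)
        then have "?T n x = g x" by linarith
        then show ?case by simp
      qed
      then show "(\<lambda>n. (?T n x - g x)\<^sup>2) \<longlonglongrightarrow> 0" by (rule tendsto_eventually)
    qed
    show "AE x in cube_measure. norm ((?T n x - g x)\<^sup>2) \<le> (g x)\<^sup>2" for n
    proof (rule AE_I2)
      fix x
      have "\<bar>?T n x - g x\<bar> \<le> \<bar>g x\<bar>" by linarith
      then show "norm ((?T n x - g x)\<^sup>2) \<le> (g x)\<^sup>2" by (simp add: abs_le_square_iff)
    qed
  qed (use m in auto)
  then show ?thesis using g L by (simp add: l2tendsto_def)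
qed

lemma l2tendsto_cutoff:
  fixes f :: "real^'n::finite \<Rightarrow> real"
  assumes f: "continuous_on unit_cube f"
  shows "l2tendsto unit_cube (\<lambda>m x. f x * tensor (\<lambda>i. cutoff (Suc m)) x) f"
proof -
  obtain C where C: "0 \<le> C" "\<And>x. x \<in> unit_cube \<Longrightarrow> \<bar>f x\<bar> \<le> C"
    using continuous_cube_bounded[OF f] by blast
  have t: "\<bar>tensor (\<lambda>i::'n. cutoff m) x\<bar> \<le> 1" for m x
    using tensor_bound[of "\<lambda>i. cutoff m" x "\<lambda>_. 1"] cutoff_bounds[of m] by simp
  show ?thesis
  proof (rule l2tendsto_bounded[where C = C])
    show "\<bar>f x * tensor (\<lambda>i. cutoff (Suc m)) x\<bar> \<le> C" if "x \<in> unit_cube" for m x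
      using mult_mono[OF C(2)[OF that] t[of "Suc m" x]] C(1) by (simp add: abs_mult)
    show "AE x in cube_measure. (\<lambda>m. f x * tensor (\<lambda>i. cutoff (Suc m)) x) \<longlonglongrightarrow> f x"
      using AE_interior_unit_cube
    proof eventually_elim
      case (elim x)
      have "\<forall>\<^sub>F m in sequentially. tensor (\<lambda>i. cutoff (Suc m)) x = 1"
        using cube_cutoff_eventually_1[OF elim] by (subst eventually_sequentially_Suc)
      then have "\<forall>\<^sub>F m in sequentially. f x * tensor (\<lambda>i. cutoff (Suc m)) x = f x"
        by eventually_elim simp
      then show ?case by (rule tendsto_eventually)
    qed
    show "(\<lambda>x. f x * tensor (\<lambda>i. cutoff (Suc m)) x) \<in> borel_measurable cube_measure" for m
      using f by (intro borel_measurable_times continuous_cube_measurable smooth_tensor_measurable smooth_cutoff)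
  qed (use C f in \<open>auto intro: continuous_cube_measurable\<close>)
qed

text \<open>A function in L2 is the limit of its truncations, and a bounded measurable function is
  the L2 limit of uniformly bounded continuous ones.\<close>

lemma L2_in_closure:
  assumes D: "\<And>f. continuous_on UNIV f \<Longrightarrow> l2closure D f" and g: "L2 unit_cube g"
  shows "l2closure D g"
proof (rule l2closure_limit[OF l2tendsto_truncate[OF g]])
  fix n
  let ?T = "\<lambda>x. max (- real n) (min (real n) (g x))"
  have m: "?T \<in> borel_measurable cube_measure" using L2_measurable[OF g] by auto
  have b: "\<bar>?T x\<bar> \<le> real n" for x by auto
  obtain d where d: "\<And>j. continuous_on UNIV (d j)" "\<And>j x. \<bar>d j x\<bar> \<le> real n"
    "AE x in cube_measure. (\<lambda>j. d j x) \<longlonglongrightarrow> ?T x"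
    using bounded_measurable_continuous_approx[OF m b] by blast
  have "l2tendsto unit_cube d ?T"
    by (rule l2tendsto_bounded[OF _ m d(2) b d(3)])
      (auto intro!: continuous_cube_measurable continuous_on_subset[OF d(1)])
  then show "l2closure D ?T" by (rule l2closure_limit) (rule D[OF d(1)])
qed

section \<open>Density of the span of the sine products\<close>

inductive sine_span :: "(real^'n::finite \<Rightarrow> real) \<Rightarrow> bool" where
  zero: "sine_span (\<lambda>_. 0)"
| add_sine: "sine_span f \<Longrightarrow> sine_span (\<lambda>x. f x + c * sine k mi0 x)"

lemma sine_span_sine: "sine_span (\<lambda>x. c * sine k mi0 x)"
  using add_sine[OF zero, of c k] by simp

lemma sine_span_add: "sine_span g \<Longrightarrow> sine_span f \<Longrightarrow> sine_span (\<lambda>x. f x + g x)"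
proof (induction rule: sine_span.induct)
  case (add_sine g c k)
  have "sine_span (\<lambda>x. (f x + g x) + c * sine k mi0 x)"
    using add_sine by (intro sine_span.add_sine) auto
  then show ?case by (simp add: add.assoc)
qed simp

lemma sine_span_cmult: "sine_span f \<Longrightarrow> sine_span (\<lambda>x. f x * d)"
proof (induction rule: sine_span.induct)
  case (add_sine f c k)
  have "sine_span (\<lambda>x. f x * d + (c * d) * sine k mi0 x)"
    using add_sine by (intro sine_span.add_sine) auto
  then show ?case by (simp add: distrib_left distrib_right mult_ac)
qed (simp add: zero)

text \<open>The product-to-sum formula turns sine times cosine into sines of the neighbouring
  frequencies \<open>k i + 1\<close> and \<open>k i - 1\<close>.\<close>

lemma sine_span_mult_cos:
  fixes f :: "real^'n::finite \<Rightarrow> real"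
  shows "sine_span f \<Longrightarrow> sine_span (\<lambda>x. f x * cos (pi * x $ i))"
proof (induction rule: sine_span.induct)
  case (add_sine f c k)
  have s: "sine_span (\<lambda>x. c * sine k mi0 x * cos (pi * x $ i))"
  \<comment> \<open>Separate because subtraction on the naturals truncates \<open>k i - 1\<close>;
    for frequency 0 the sine product itself is zero.\<close>
  proof (cases "k i = 0")
    case True
    have "sine k mi0 x = 0" for x :: "real^'n"
      unfolding sine_def tensor_def by (intro prod_zero bexI[of _ i]) (auto simp: trig_def True)
    then show ?thesis by (simp add: zero)
  next
    case False
    have "c * sine k mi0 x * cos (pi * x $ i) =
      c / 2 * sine (k(i := k i + 1)) mi0 x + c / 2 * sine (k(i := k i - 1)) mi0 x" for x :: "real^'n"
    proof -
      have r: "(\<Prod>j\<in>UNIV. f j) = f i * (\<Prod>j\<in>UNIV-{i}. f j)" for f :: "'n \<Rightarrow> real"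
        by (rule prod.remove) auto
      define P where "P = (\<Prod>j\<in>UNIV-{i}. trig (k j) 0 (x $ j))"
      have "sine (k(i := a)) mi0 x = sin (real a * pi * x $ i) * P" for a
        unfolding sine_def tensor_def P_def by (subst r) (auto simp: trig_def intro!: prod.cong)
      from this[of "k i"] this[of "k i + 1"] this[of "k i - 1"]
      have e: "sine k mi0 x = sin (real (k i) * pi * x $ i) * P"
        "sine (k(i := k i + 1)) mi0 x = sin (real (k i) * pi * x $ i + pi * x $ i) * P"
        "sine (k(i := k i - 1)) mi0 x = sin (real (k i) * pi * x $ i - pi * x $ i) * P"
        using False by (simp_all add: algebra_simps of_nat_diff)
      show ?thesis unfolding e by (simp add: sin_add sin_diff field_simps)
    qed
    then show ?thesis
      by (simp only:) (intro sine_span_add sine_span_sine)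
  qed
  show ?case
    using sine_span_add[OF s add_sine.IH] by (simp add: distrib_right)
qed (simp add: zero)

lemma sine_span_smooth: "sine_span f \<Longrightarrow> smooth f"
  by (induction rule: sine_span.induct) (auto intro: smooth_const smooth_add[OF _ smooth_mult[OF smooth_const smooth_sine]])

text \<open>Stone-Weierstrass is applied to the ring of multipliers of the sine span: after a cutoff, \<open>f\<close> is a
  continuous multiple of the product of the sines of lowest frequency.\<close>

lemma sine_span_dense_continuous:
  fixes f :: "real^'n::finite \<Rightarrow> real"
  assumes f: "continuous_on UNIV f"
  shows "l2closure sine_span f"
proof (rule l2closure_limit[OF l2tendsto_cutoff[OF continuous_on_subset[OF f]]])
  fix m
  let ?\<eta> = "tensor (\<lambda>i::'n. cutoff (Suc m))"
  let ?b = "sine (\<lambda>_::'n. 1) mi0"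
  let ?h = "\<lambda>x. f x * ?\<eta> x"
  define q where "q x = ?h x / ?b x" for x
  define R :: "(real^'n \<Rightarrow> real) set" where
    "R = {r. continuous_on unit_cube r \<and> (\<forall>s. sine_span s \<longrightarrow> sine_span (\<lambda>x. s x * r x))}"
  have bpos: "0 < ?b x" if "x \<in> interior unit_cube" for x
    unfolding sine_def tensor_def trig_def using that
    by (intro prod_pos) (auto simp: interior_unit_cube intro!: sin_gt_zero)
  have bbound: "\<bar>?b x\<bar> \<le> 1" for x
    using tensor_bound[of "\<lambda>_. trig 1 0" x "\<lambda>_. 1"] trig_bound[of 1 0] unfolding sine_def by simp
  note t = test_fun_base[OF test_fun_cube_cutoff[where 'a='n, of m]]
  have hq: "?h x = ?b x * q x" if "x \<in> unit_cube" for x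
  proof (cases "x \<in> interior unit_cube")
    case True
    then show ?thesis using bpos[OF True] by (simp add: q_def)
  next
    case False
    then have "?\<eta> x = 0" using t(4) not_in_tsupp by blast
    then show ?thesis by (simp add: q_def)
  qed
  \<comment> \<open>Two open sets cover the cube: the interior, where the denominator is positive,
    and the complement of the support of the cutoff, where \<open>q\<close> is 0 whatever the
    denominator is.\<close>
  have "continuous_on (interior unit_cube \<union> - tsupp ?\<eta>) q"
  proof (rule continuous_on_open_Un)
    show "continuous_on (interior unit_cube) q"
      unfolding q_def using bpos
      by (intro continuous_intros continuous_on_subset[OF f] t(2) smooth_continuous smooth_sine) (auto simp: less_le)
    have "continuous_on (- tsupp ?\<eta>) (\<lambda>x. 0::real)" by simp
    then show "continuous_on (- tsupp ?\<eta>) q"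
      by (rule continuous_on_eq) (auto simp: q_def not_in_tsupp)
  qed (auto simp: closed_tsupp open_closed)
  then have contq: "continuous_on unit_cube q"
    by (rule continuous_on_subset) (use t(4) in auto)
  interpret R: function_ring_on R unit_cube
  proof
    show "\<exists>f\<in>R. f x \<noteq> f y" if xy: "x \<in> unit_cube" "y \<in> unit_cube" "x \<noteq> y" for x y :: "real^'n"
    proof -
      obtain i where i: "x $ i \<noteq> y $ i" using xy(3) by (auto simp: vec_eq_iff)
      \<comment> \<open>\<open>cos (pi * t)\<close> is injective on [0, 1], so the cosines of the
        coordinates separate points, and they are multipliers by
        \<open>sine_span_mult_cos\<close>.\<close>
      have "cos (pi * x $ i) \<noteq> cos (pi * y $ i)"
        using cos_inj_pi[of "pi * x $ i" "pi * y $ i"] i xy by (auto simp: mem_unit_cube)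
      moreover have "(\<lambda>x. cos (pi * x $ i)) \<in> R"
        unfolding R_def
      proof (intro CollectI conjI allI impI)
        show "continuous_on unit_cube (\<lambda>x::real^'n. cos (pi * x $ i))" by (intro continuous_intros)
      qed (rule sine_span_mult_cos)
      ultimately show ?thesis by (intro bexI[of _ "\<lambda>x. cos (pi * x $ i)"])
    qed
    show "(\<lambda>x. r x * r' x) \<in> R" if "r \<in> R" "r' \<in> R" for r r'
    proof -
      have "sine_span (\<lambda>x. (s x * r x) * r' x)" if "sine_span s" for s
        using \<open>r \<in> R\<close> \<open>r' \<in> R\<close> that unfolding R_def by blast
      then show ?thesis using that by (simp add: R_def mult.assoc continuous_on_mult)
    qed
    show "(\<lambda>x. r x + r' x) \<in> R" if "r \<in> R" "r' \<in> R" for r r'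
    proof -
      have "sine_span (\<lambda>x. s x * r x + s x * r' x)" if "sine_span s" for s
        using \<open>r \<in> R\<close> \<open>r' \<in> R\<close> that unfolding R_def by (intro sine_span_add) blast+
      then show ?thesis using that by (simp add: R_def distrib_left continuous_on_add)
    qed
    show "(\<lambda>_. c) \<in> R" for c by (simp add: R_def sine_span_cmult)
  qed (simp_all add: R_def compact_unit_cube)
  have "\<exists>r\<in>R. \<forall>x\<in>unit_cube. \<bar>q x - r x\<bar> < inverse (real (Suc n))" for n
    by (intro R.Stone_Weierstrass_basic contq) simp
  then obtain r where r: "\<And>n. r n \<in> R" "\<And>n x. x \<in> unit_cube \<Longrightarrow> \<bar>q x - r n x\<bar> < inverse (real (Suc n))"
    by metis
  have bspan: "sine_span ?b" using sine_span_sine[of 1 "\<lambda>_. 1"] by simp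
  have span: "sine_span (\<lambda>x. ?b x * r n x)" for n
    using r(1)[of n] bspan by (auto simp: R_def)
  have diff: "\<bar>?h x - ?b x * r n x\<bar> \<le> inverse (real (Suc n))" if "x \<in> unit_cube" for n x
  proof -
    have "\<bar>?h x - ?b x * r n x\<bar> = \<bar>?b x\<bar> * \<bar>q x - r n x\<bar>"
      using hq[OF that] by (simp add: abs_mult[symmetric] right_diff_distrib)
    also have "\<dots> \<le> 1 * inverse (real (Suc n))"
      using bbound r(2)[OF that, of n] by (intro mult_mono) auto
    finally show ?thesis by simp
  qed
  have conth: "continuous_on unit_cube ?h"
    by (intro continuous_intros continuous_on_subset[OF f] t(2)) auto
  obtain C where C: "\<And>x. x \<in> unit_cube \<Longrightarrow> \<bar>?h x\<bar> \<le> C"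
    using continuous_cube_bounded[OF conth] by blast
  have inv1: "inverse (real (Suc n)) \<le> 1" for n by (simp add: field_simps)
  have "l2tendsto unit_cube (\<lambda>n x. ?b x * r n x) ?h"
  proof (rule l2tendsto_bounded[where C = "C + 1"])
    show "\<bar>?b x * r n x\<bar> \<le> C + 1" if "x \<in> unit_cube" for n x
      using diff[OF that, of n] C[OF that] inv1[of n] by linarith
    show "\<bar>?h x\<bar> \<le> C + 1" if "x \<in> unit_cube" for x using C[OF that] by linarith
    show "AE x in cube_measure. (\<lambda>n. ?b x * r n x) \<longlonglongrightarrow> ?h x"
    proof (rule AE_I2)
      fix x :: "real^'n" assume "x \<in> space cube_measure"
      then have x: "x \<in> unit_cube" by simp
      have "(\<lambda>n. \<bar>?b x * r n x - ?h x\<bar>) \<longlonglongrightarrow> 0"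
        by (rule tendsto_0_sandwich(2)[OF LIMSEQ_inverse_real_of_nat])
          (use diff[OF x] in \<open>auto simp: abs_minus_commute\<close>)
      then show "(\<lambda>n. ?b x * r n x) \<longlonglongrightarrow> ?h x"
        by (simp add: tendsto_rabs_zero_iff LIM_zero_iff)
    qed
  qed (intro continuous_cube_measurable conth smooth_continuous sine_span_smooth span)+
  then show "l2closure sine_span ?h"
    unfolding l2closure_def using span by (intro exI[of _ "\<lambda>n x. ?b x * r n x"] conjI allI)
qed simp

lemma L2_closure_sine_span: "L2 unit_cube g \<Longrightarrow> l2closure sine_span g"
  using L2_in_closure sine_span_dense_continuous by blast

text \<open>Elements of the sine span become test functions after a cutoff. This density is what
  lets \<open>l2tendsto_if_cauchy_weak\<close> recover a norm from test functions alone.\<close>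

lemma L2_closure_test_fun:
  fixes g :: "real^'n::finite \<Rightarrow> real"
  assumes g: "L2 unit_cube g"
  shows "l2closure (test_fun unit_cube) g"
proof -
  obtain S where S: "\<And>n. sine_span (S n)" "l2tendsto unit_cube S g"
    using L2_closure_sine_span[OF g] by (auto simp: l2closure_def)
  show ?thesis
  proof (rule l2closure_limit[OF S(2)])
    fix n
    have s: "smooth (S n)" by (rule sine_span_smooth[OF S(1)])
    have "test_fun unit_cube (\<lambda>x. S n x * tensor (\<lambda>i. cutoff (Suc m)) x)" for m
    proof -
      note t = test_fun_base[OF test_fun_cube_cutoff[where 'a='n, of m]]
      have "test_fun unit_cube (\<lambda>x. tensor (\<lambda>i. cutoff (Suc m)) x * S n x)"
        by (intro test_fun_mult_smooth s smooth_tensor smooth_cutoff t)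
      then show ?thesis by (simp add: mult.commute)
    qed
    then show "l2closure (test_fun unit_cube) (S n)"
      unfolding l2closure_def using l2tendsto_cutoff[OF smooth_continuous[OF s]]
      by (intro exI[of _ "\<lambda>m x. S n x * tensor (\<lambda>i. cutoff (Suc m)) x"]) blast
  qed
qed

section \<open>Fourier partial sums\<close>

definition box_index :: "nat \<Rightarrow> ('n::finite \<Rightarrow> nat) set" where
  "box_index N = {k. \<forall>i. k i \<le> N}"

lemma finite_box_index: "finite (box_index N :: ('n::finite \<Rightarrow> nat) set)"
proof -
  have "box_index N = Pi UNIV (\<lambda>_::'n. {..N})" by (auto simp: box_index_def)
  then show ?thesis
    using finite_PiE[of "UNIV :: 'n set" "\<lambda>_. {..N}"] by (simp add: PiE_UNIV_domain)
qed

lemma box_index_mono: "M \<le> N \<Longrightarrow> box_index M \<subseteq> box_index N"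
  by (auto simp: box_index_def intro: order_trans)

lemma sine_poly_extend:
  assumes "K \<subseteq> K'" "finite K'"
  shows "sine_poly K c \<alpha> = sine_poly K' (\<lambda>k. if k \<in> K then c k else 0) \<alpha>"
proof
  fix x
  have "(\<Sum>k\<in>K'. (if k \<in> K then c k else 0) * sine k \<alpha> x) = (\<Sum>k\<in>K. (if k \<in> K then c k else 0) * sine k \<alpha> x)"
    using assms by (intro sum.mono_neutral_right) auto
  then show "sine_poly K c \<alpha> x = sine_poly K' (\<lambda>k. if k \<in> K then c k else 0) \<alpha> x"
    by (simp add: sine_poly_def)
qed

lemma sine_poly_diff:
  assumes "K \<subseteq> K'" "finite K'"
  shows "sine_poly K' c \<alpha> x - sine_poly K c \<alpha> x = sine_poly (K' - K) c \<alpha> x"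
  using sum.subset_diff[OF assms, of "\<lambda>k. c k * sine k \<alpha> x"] by (simp add: sine_poly_def)

lemma sine_span_imp_sine_poly:
  fixes f :: "real^'n::finite \<Rightarrow> real"
  assumes "sine_span f" shows "\<exists>N c. f = sine_poly (box_index N) c mi0"
  using assms
proof (induction rule: sine_span.induct)
  case zero
  have "(\<lambda>_. 0) = sine_poly (box_index 0) (\<lambda>_. 0) (\<lambda>_::'n. 0)" by (auto simp: sine_poly_def)
  then show ?case by blast
next
  case (add_sine f d k)
  then obtain N c where f: "f = sine_poly (box_index N) c mi0" by blast
  \<comment> \<open>Large enough for the old box and for the new frequency vector
    \<open>k\<close>.\<close>
  define N' where "N' = max N (Max (range k))"
  define c' where "c' l = (if l \<in> box_index N then c l else 0)" for l
  have "k \<in> box_index N'" by (auto simp: box_index_def N'_def max.coboundedI2)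
  then have "(\<Sum>l\<in>box_index N'. (if l = k then d else 0) * sine l mi0 x) = d * sine k mi0 x" for x
    using finite_box_index[of N'] by (subst sum.remove[of _ k]) auto
  moreover have "f = sine_poly (box_index N') c' mi0"
    unfolding f c'_def by (intro sine_poly_extend box_index_mono finite_box_index) (simp add: N'_def)
  ultimately have "(\<lambda>x. f x + d * sine k mi0 x) = sine_poly (box_index N') (\<lambda>l. c' l + (if l = k then d else 0)) mi0"
    by (simp add: sine_poly_def fun_eq_iff distrib_right sum.distrib)
  then show ?case by blast
qed

text \<open>If some \<open>k i = 0\<close> then \<open>sine k mi0\<close> vanishes and the quotient is \<open>0 / 0 = 0\<close>.\<close>

definition fourier :: "(real^'n::finite \<Rightarrow> real) \<Rightarrow> ('n \<Rightarrow> nat) \<Rightarrow> real" where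
  "fourier g k = cip g (sine k mi0) / cip (sine k mi0) (sine k mi0)"

lemma fourier_residual_orthogonal:
  assumes g: "L2 unit_cube g" and K: "finite K" "l \<in> K"
  shows "cip (\<lambda>x. g x - sine_poly K (fourier g) mi0 x) (sine l mi0) = 0"
proof -
  let ?s = "\<lambda>k. sine k mi0"
  let ?\<gamma> = "cip (?s l) (?s l)"
  have "cip (?s l) (sine_poly K (fourier g) mi0) = (\<Sum>k\<in>K. fourier g k * cip (?s l) (?s k))"
    by (rule ip_sine_poly_left[OF L2_sine])
  also have "\<dots> = fourier g l * ?\<gamma>"
    using ip_sine_orthogonal[of l] by (subst sum.remove[OF K]) (simp, intro sum.neutral, force)
  also have "\<dots> = cip g (?s l)"
  proof (cases "?\<gamma> = 0")
    case True
    \<comment> \<open>A sine product of norm 0 has inner product 0 with \<open>g\<close>, so the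
      coefficient 0 produced by division by zero is the right one.\<close>
    then have "(cip g (?s l))\<^sup>2 \<le> 0"
      using L2_cauchy_schwarz[OF g L2_sine, of l "\<lambda>_. 0"] by simp
    then show ?thesis using True by simp
  qed (simp add: fourier_def)
  finally have "cip (sine_poly K (fourier g) mi0) (?s l) = cip g (?s l)"
    by (simp add: mult.commute)
  then show ?thesis
    using g by (simp add: left_diff_distrib L2_integrable_mult L2_sine L2_sine_poly)
qed

text \<open>Pythagoras: the residual is orthogonal to every sine product in \<open>K\<close>, hence
  to the difference of the two sine polynomials.\<close>

lemma fourier_best_approximation:
  assumes g: "L2 unit_cube g" and K: "finite K"
  shows "(\<integral>x. (sine_poly K (fourier g) mi0 x - g x)\<^sup>2 \<partial>cube_measure) \<le>
    (\<integral>x. (sine_poly K c mi0 x - g x)\<^sup>2 \<partial>cube_measure)"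
proof -
  define r where "r x = g x - sine_poly K (fourier g) mi0 x" for x
  define p where "p x = sine_poly K (\<lambda>k. fourier g k - c k) mi0 x" for x
  have L: "L2 unit_cube r" "L2 unit_cube p"
    unfolding r_def[abs_def] p_def[abs_def] using g by (intro L2_diff L2_sine_poly; simp)+
  have "cip r p = (\<Sum>k\<in>K. (fourier g k - c k) * cip r (sine k mi0))"
    unfolding p_def[abs_def] by (rule ip_sine_poly_left[OF L(1)])
  also have "\<dots> = 0"
    using fourier_residual_orthogonal[OF g K] by (intro sum.neutral) (simp add: r_def)
  finally have rp: "cip r p = 0" .
  have "(sine_poly K c mi0 x - g x)\<^sup>2 = r x * r x + 2 * (r x * p x) + p x * p x" for x
  proof -
    have eq: "sine_poly K c mi0 x - g x = - (r x + p x)"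
      by (simp add: r_def p_def sine_poly_def sum_subtractf left_diff_distrib)
    show ?thesis unfolding eq by (simp add: power2_eq_square algebra_simps)
  qed
  then have "(\<integral>x. (sine_poly K c mi0 x - g x)\<^sup>2 \<partial>cube_measure) = cip r r + 2 * cip r p + cip p p"
    using L by (simp add: L2_integrable_mult)
  moreover have "0 \<le> cip p p" by (intro integral_nonneg_AE) auto
  moreover have "(\<integral>x. (sine_poly K (fourier g) mi0 x - g x)\<^sup>2 \<partial>cube_measure) = cip r r"
    by (simp add: r_def power2_eq_square algebra_simps)
  ultimately show ?thesis using rp by simp
qed

text \<open>Density provides one sine polynomial close to \<open>g\<close>. All larger boxes contain
  its frequencies, and there the Fourier sum is at least as close.\<close>

lemma fourier_l2tendsto:
  fixes g :: "real^'n::finite \<Rightarrow> real"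
  assumes g: "L2 unit_cube g"
  shows "l2tendsto unit_cube (\<lambda>N. sine_poly (box_index N) (fourier g) mi0) g"
proof -
  let ?e = "\<lambda>N. \<integral>x. (sine_poly (box_index N) (fourier g) mi0 x - g x)\<^sup>2 \<partial>cube_measure"
  have "?e \<longlonglongrightarrow> 0"
  proof (rule LIMSEQ_I)
    fix e :: real assume e: "0 < e"
    obtain S where S: "\<And>n. sine_span (S n)" "l2tendsto unit_cube S g"
      using L2_closure_sine_span[OF g] by (auto simp: l2closure_def)
    have "(\<lambda>n. \<integral>x. (S n x - g x)\<^sup>2 \<partial>cube_measure) \<longlonglongrightarrow> 0" using S(2) by (simp add: l2tendsto_def)
    then have "\<forall>\<^sub>F n in sequentially. (\<integral>x. (S n x - g x)\<^sup>2 \<partial>cube_measure) < e"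
      using e by (rule order_tendstoD)
    then obtain n where n: "(\<integral>x. (S n x - g x)\<^sup>2 \<partial>cube_measure) < e"
      by (auto simp: eventually_sequentially)
    obtain N0 c where N0: "S n = sine_poly (box_index N0) c mi0"
      using sine_span_imp_sine_poly[OF S(1)] by blast
    have "?e N < e" if "N0 \<le> N" for N
    proof -
      have "S n = sine_poly (box_index N) (\<lambda>k. if k \<in> box_index N0 then c k else 0) mi0"
        unfolding N0 by (intro sine_poly_extend box_index_mono finite_box_index that)
      then show ?thesis
        using fourier_best_approximation[OF g finite_box_index[of N], of "\<lambda>k. if k \<in> box_index N0 then c k else 0"] n
        by simp
    qed
    then show "\<exists>N0. \<forall>N\<ge>N0. norm (?e N - 0) < e" by auto
  qed
  then show ?thesis using g by (simp add: l2tendsto_def L2_sine_poly)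
qed

text \<open>Takes the place of completeness of L2, since the limit is already known weakly. Against
  a test function the residual \<open>r = g - F n\<close> acts with norm at most the square root of
  \<open>e\<close>; by density of test functions this holds against \<open>r\<close> itself, so the
  squared norm of \<open>r\<close> is at most \<open>e\<close>.\<close>

lemma l2tendsto_if_cauchy_weak:
  fixes F :: "nat \<Rightarrow> real^'n::finite \<Rightarrow> real"
  assumes F: "\<And>n. L2 unit_cube (F n)" and g: "L2 unit_cube g"
    and cauchy: "\<And>e. 0 < e \<Longrightarrow> \<exists>N. \<forall>n\<ge>N. \<forall>m\<ge>n. (\<integral>x. (F m x - F n x)\<^sup>2 \<partial>cube_measure) \<le> e"
    and weak: "\<And>\<phi>. test_fun unit_cube \<phi> \<Longrightarrow> (\<lambda>n. cip (F n) \<phi>) \<longlonglongrightarrow> cip g \<phi>"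
  shows "l2tendsto unit_cube F g"
proof -
  have bound: "(\<integral>x. (F n x - g x)\<^sup>2 \<partial>cube_measure) \<le> e"
    if e: "0 < e" and c: "\<And>m. m \<ge> n \<Longrightarrow> (\<integral>x. (F m x - F n x)\<^sup>2 \<partial>cube_measure) \<le> e" for e n
  proof -
    define r where "r x = g x - F n x" for x
    have r: "L2 unit_cube r" unfolding r_def[abs_def] by (intro L2_diff g F)
    have test: "(cip r \<phi>)\<^sup>2 \<le> e * cip \<phi> \<phi>" if t: "test_fun unit_cube \<phi>" for \<phi>
    proof -
      have \<phi>: "L2 unit_cube \<phi>" by (intro continuous_cube_L2 test_fun_base[OF t])
      have "(\<lambda>m. (cip (F m) \<phi> - cip (F n) \<phi>)\<^sup>2) \<longlonglongrightarrow> (cip g \<phi> - cip (F n) \<phi>)\<^sup>2"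
        by (intro tendsto_intros weak t)
      moreover have "cip g \<phi> - cip (F n) \<phi> = cip r \<phi>"
        using g F \<phi> by (simp add: r_def left_diff_distrib L2_integrable_mult)
      moreover have "(cip (F m) \<phi> - cip (F n) \<phi>)\<^sup>2 \<le> e * cip \<phi> \<phi>" if "m \<ge> n" for m
      proof -
        have "cip (F m) \<phi> - cip (F n) \<phi> = cip (\<lambda>x. F m x - F n x) \<phi>"
          using F \<phi> by (simp add: left_diff_distrib L2_integrable_mult)
        moreover have "(cip (\<lambda>x. F m x - F n x) \<phi>)\<^sup>2 \<le> (\<integral>x. (F m x - F n x)\<^sup>2 \<partial>cube_measure) * cip \<phi> \<phi>"
          using L2_cauchy_schwarz[OF L2_diff[OF F F] \<phi>, of m n] by (simp add: power2_eq_square)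
        moreover have "\<dots> \<le> e * cip \<phi> \<phi>"
          by (intro mult_right_mono c that integral_nonneg_AE) auto
        ultimately show ?thesis by simp
      qed
      ultimately show ?thesis
        by (intro tendsto_upperbound[of _ "(cip r \<phi>)\<^sup>2" sequentially])
          (auto simp: eventually_sequentially)
    qed
    obtain \<Phi> where \<Phi>: "\<And>j. test_fun unit_cube (\<Phi> j)" "l2tendsto unit_cube \<Phi> r"
      using L2_closure_test_fun[OF r] by (auto simp: l2closure_def)
    have "(\<lambda>j. (cip (\<Phi> j) r)\<^sup>2) \<longlonglongrightarrow> (cip r r)\<^sup>2"
      by (intro tendsto_power l2tendsto_ip_const \<Phi> r)
    moreover have "(\<lambda>j. e * cip (\<Phi> j) (\<Phi> j)) \<longlonglongrightarrow> e * cip r r"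
      by (intro tendsto_mult_left l2tendsto_ip \<Phi>)
    moreover have "(cip (\<Phi> j) r)\<^sup>2 \<le> e * cip (\<Phi> j) (\<Phi> j)" for j
      using test[OF \<Phi>(1)] by (simp add: mult.commute)
    ultimately have "(cip r r)\<^sup>2 \<le> e * cip r r"
      by (intro LIMSEQ_le) auto
    moreover have "0 \<le> cip r r" by (intro integral_nonneg_AE) auto
    ultimately have "cip r r \<le> e"
      using e by (cases "cip r r = 0") (auto simp: power2_eq_square)
    moreover have "(\<integral>x. (F n x - g x)\<^sup>2 \<partial>cube_measure) = cip r r"
      by (simp add: r_def power2_eq_square algebra_simps)
    ultimately show ?thesis by simp
  qed
  have "(\<lambda>n. \<integral>x. (F n x - g x)\<^sup>2 \<partial>cube_measure) \<longlonglongrightarrow> 0"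
  proof (rule LIMSEQ_I)
    fix e :: real assume e: "0 < e"
    obtain N where N: "\<forall>n\<ge>N. \<forall>m\<ge>n. (\<integral>x. (F m x - F n x)\<^sup>2 \<partial>cube_measure) \<le> e / 2"
      using cauchy[of "e / 2"] e by auto
    have "(\<integral>x. (F n x - g x)\<^sup>2 \<partial>cube_measure) < e" if "n \<ge> N" for n
      using bound[of "e / 2" n] N that e by auto
    then show "\<exists>N. \<forall>n\<ge>N. norm ((\<integral>x. (F n x - g x)\<^sup>2 \<partial>cube_measure) - 0) < e" by auto
  qed
  then show ?thesis using F g by (simp add: l2tendsto_def)
qed

section \<open>Approximation of Sobolev functions\<close>

lemma l2tendsto_cauchy:
  assumes F: "l2tendsto unit_cube F f" and e: "0 < e"
  shows "\<exists>N. \<forall>n\<ge>N. \<forall>m\<ge>N. (\<integral>x. (F m x - F n x)\<^sup>2 \<partial>cube_measure) \<le> e"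
proof -
  have L: "L2 unit_cube (F n)" "L2 unit_cube f" for n using F by (auto simp: l2tendsto_def)
  have "(\<lambda>n. \<integral>x. (F n x - f x)\<^sup>2 \<partial>cube_measure) \<longlonglongrightarrow> 0" using F by (simp add: l2tendsto_def)
  then have "\<forall>\<^sub>F n in sequentially. (\<integral>x. (F n x - f x)\<^sup>2 \<partial>cube_measure) < e / 4"
    using e by (intro order_tendstoD) auto
  then obtain N where N: "\<And>n. n \<ge> N \<Longrightarrow> (\<integral>x. (F n x - f x)\<^sup>2 \<partial>cube_measure) < e / 4"
    by (auto simp: eventually_sequentially)
  have "(\<integral>x. (F m x - F n x)\<^sup>2 \<partial>cube_measure) \<le> e" if "n \<ge> N" "m \<ge> N" for n m
  proof -
    have "(\<integral>x. ((F m x - f x) + (f x - F n x))\<^sup>2 \<partial>cube_measure) \<le>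
        2 * (\<integral>x. (F m x - f x)\<^sup>2 \<partial>cube_measure) + 2 * (\<integral>x. (f x - F n x)\<^sup>2 \<partial>cube_measure)"
      by (intro integral_sq_le L2_diff L)
    then show ?thesis using N[OF that(1)] N[OF that(2)] by (simp add: power2_commute)
  qed
  then show ?thesis by blast
qed

text \<open>The difference of two partial sums is a sine polynomial over the difference
  \<open>S\<close> of the boxes. The identity holds for every \<open>S\<close>, and Cauchy-Schwarz
  then bounds the \<open>\<gamma>\<close> difference by those for \<open>\<alpha>\<close> and
  \<open>\<beta>\<close>. The absolute values absorb the minus sign of
  \<open>ip_sine_poly_grad\<close>.\<close>

lemma sine_poly_cauchy:
  assumes A: "l2tendsto unit_cube (\<lambda>N. sine_poly (box_index N) c \<alpha>) a"
    and B: "l2tendsto unit_cube (\<lambda>N. sine_poly (box_index N) c \<beta>) b"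
    and id: "\<And>S. \<bar>cip (sine_poly S c \<gamma>) (sine_poly S c \<gamma>)\<bar> = \<bar>cip (sine_poly S c \<alpha>) (sine_poly S c \<beta>)\<bar>"
    and e: "0 < e"
  shows "\<exists>N. \<forall>n\<ge>N. \<forall>m\<ge>n. (\<integral>x. (sine_poly (box_index m) c \<gamma> x - sine_poly (box_index n) c \<gamma> x)\<^sup>2 \<partial>cube_measure) \<le> e"
proof -
  obtain N1 where N1: "\<And>n m. n \<ge> N1 \<Longrightarrow> m \<ge> N1 \<Longrightarrow>
      (\<integral>x. (sine_poly (box_index m) c \<alpha> x - sine_poly (box_index n) c \<alpha> x)\<^sup>2 \<partial>cube_measure) \<le> e"
    using l2tendsto_cauchy[OF A e] by blast
  obtain N2 where N2: "\<And>n m. n \<ge> N2 \<Longrightarrow> m \<ge> N2 \<Longrightarrow>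
      (\<integral>x. (sine_poly (box_index m) c \<beta> x - sine_poly (box_index n) c \<beta> x)\<^sup>2 \<partial>cube_measure) \<le> e"
    using l2tendsto_cauchy[OF B e] by blast
  have "(\<integral>x. (sine_poly (box_index m) c \<gamma> x - sine_poly (box_index n) c \<gamma> x)\<^sup>2 \<partial>cube_measure) \<le> e"
    if n: "n \<ge> max N1 N2" "m \<ge> n" for n m
  proof -
    define S :: "('a \<Rightarrow> nat) set" where "S = box_index m - box_index n"
    have d: "(\<integral>x. (sine_poly (box_index m) c \<delta> x - sine_poly (box_index n) c \<delta> x)\<^sup>2 \<partial>cube_measure) =
        cip (sine_poly S c \<delta>) (sine_poly S c \<delta>)" for \<delta>
      using sine_poly_diff[OF box_index_mono[OF n(2)] finite_box_index, of c \<delta>]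
      by (simp add: S_def power2_eq_square)
    have nn: "0 \<le> cip (sine_poly S c \<delta>) (sine_poly S c \<delta>)" for \<delta>
      by (intro integral_nonneg_AE) auto
    have "cip (sine_poly S c \<alpha>) (sine_poly S c \<alpha>) \<le> e" "cip (sine_poly S c \<beta>) (sine_poly S c \<beta>) \<le> e"
      using N1[of n m] N2[of n m] n by (auto simp: d)
    then have "cip (sine_poly S c \<alpha>) (sine_poly S c \<alpha>) * cip (sine_poly S c \<beta>) (sine_poly S c \<beta>) \<le> e * e"
      using nn e by (intro mult_mono) auto
    then have "(cip (sine_poly S c \<alpha>) (sine_poly S c \<beta>))\<^sup>2 \<le> e\<^sup>2"
      using L2_cauchy_schwarz[OF L2_sine_poly L2_sine_poly, of S c \<alpha> S c \<beta>] by (simp add: power2_eq_square)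
    then have "\<bar>cip (sine_poly S c \<alpha>) (sine_poly S c \<beta>)\<bar> \<le> e"
      using e by (metis abs_le_square_iff abs_of_pos)
    then show ?thesis unfolding d using id[of S] nn[of \<gamma>] by linarith
  qed
  then show ?thesis by blast
qed

text \<open>All derivatives are moved to the test function, where convergence of the
  undifferentiated sums suffices; the sign occurs twice and cancels.\<close>

lemma sine_poly_weak_limit:
  assumes w: "weak_deriv unit_cube \<gamma> w g"
    and lim: "l2tendsto unit_cube (\<lambda>N. sine_poly (K N) c mi0) w" and t: "test_fun unit_cube \<phi>"
  shows "(\<lambda>N. cip (sine_poly (K N) c \<gamma>) \<phi>) \<longlonglongrightarrow> cip g \<phi>"
proof -
  let ?s = "(- 1 :: real) ^ mi_order \<gamma>"
  have \<phi>: "L2 unit_cube \<phi>" "L2 unit_cube (cD \<gamma> \<phi>)"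
    by (intro continuous_cube_L2 test_fun_base[OF t] test_fun_cD[OF t])+
  have "(\<lambda>N. ?s * cip (sine_poly (K N) c mi0) (cD \<gamma> \<phi>)) \<longlonglongrightarrow> ?s * cip w (cD \<gamma> \<phi>)"
    by (intro tendsto_mult_left l2tendsto_ip_const[OF lim] \<phi>)
  moreover have "?s * cip w (cD \<gamma> \<phi>) = cip g \<phi>"
  proof -
    have "cip w (cD \<gamma> \<phi>) = ?s * cip g \<phi>" using w t by (simp add: weak_deriv_def)
    then show ?thesis by (simp flip: mult.assoc power_mult_distrib)
  qed
  moreover have "?s * cip (sine_poly (K N) c mi0) (cD \<gamma> \<phi>) = cip (sine_poly (K N) c \<gamma>) \<phi>" for N
  proof -
    have "cip (sine_poly (K N) c \<delta>) f = (\<Sum>k\<in>K N. c k * cip (sine k \<delta>) f)"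
      if "L2 unit_cube f" for f \<delta>
      using ip_sine_poly_left[OF that, of "K N" c \<delta>] by (simp add: mult.commute)
    then show ?thesis
      using \<phi> weak_deriv_sine[OF t, of _ \<gamma>] by (simp add: sum_distrib_left mult_ac)
  qed
  ultimately show ?thesis by simp
qed

text \<open>The Fourier projection commutes with the pure second derivatives, which gives their convergence;
  the other derivatives of the partial sums are then Cauchy by the sine identities.\<close>

lemma sine_approximation:
  fixes w :: "real^'n::finite \<Rightarrow> real"
  assumes w: "L2 unit_cube w"
    and D: "\<And>\<alpha>. mi_order \<alpha> \<le> 2 \<Longrightarrow> weak_deriv unit_cube \<alpha> w (D \<alpha>) \<and> L2 unit_cube (D \<alpha>)"
    and bd: "\<And>i k. cip (D (mi2 i i)) (sine k mi0) = cip w (sine k (mi2 i i))"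
  shows "l2tendsto unit_cube (\<lambda>N. sine_poly (box_index N) (fourier w) mi0) w"
    and "l2tendsto unit_cube (\<lambda>N. sine_poly (box_index N) (fourier w) (mi1 i)) (D (mi1 i))"
    and "l2tendsto unit_cube (\<lambda>N. sine_poly (box_index N) (fourier w) (mi2 i j)) (D (mi2 i j))"
proof -
  have D1: "weak_deriv unit_cube (mi1 i) w (D (mi1 i))" "L2 unit_cube (D (mi1 i))"
    and D2: "weak_deriv unit_cube (mi2 i j) w (D (mi2 i j))" "L2 unit_cube (D (mi2 i j))" for i j
    using D[of "mi1 i"] D[of "mi2 i j"] by (auto simp: mi_order_mi1 mi_order_mi2)
  show 0: "l2tendsto unit_cube (\<lambda>N. sine_poly (box_index N) (fourier w) mi0) w"
    by (rule fourier_l2tendsto[OF w])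
  have 2: "l2tendsto unit_cube (\<lambda>N. sine_poly (box_index N) (fourier w) (mi2 i i)) (D (mi2 i i))" for i
  proof -
    \<comment> \<open>Both coefficients have the same denominator, so \<open>bd\<close> and the
      eigenvalue relation for sines give the factor.\<close>
    have "fourier (D (mi2 i i)) k = - (real (k i) * pi)\<^sup>2 * fourier w k" for k
    proof -
      have "cip w (sine k (mi2 i i)) = - (real (k i) * pi)\<^sup>2 * cip w (sine k mi0)"
        unfolding sine_mi2_same by (subst integral_mult_right_zero[symmetric]) (simp add: mult_ac)
      then show ?thesis by (simp add: fourier_def bd)
    qed
    then have "sine_poly K (fourier w) (mi2 i i) = sine_poly K (fourier (D (mi2 i i))) mi0" for K
      by (auto simp: sine_poly_def sine_mi2_same intro!: ext sum.cong)
    then show ?thesis using fourier_l2tendsto[OF D2(2)] by simp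
  qed
  show "l2tendsto unit_cube (\<lambda>N. sine_poly (box_index N) (fourier w) (mi1 i)) (D (mi1 i))"
  proof (rule l2tendsto_if_cauchy_weak[OF L2_sine_poly D1(2)])
    \<comment> \<open>The gradient is controlled by the partial sums themselves together with their
      pure second derivatives.\<close>
    show "\<exists>N. \<forall>n\<ge>N. \<forall>m\<ge>n. (\<integral>x. (sine_poly (box_index m) (fourier w) (mi1 i) x
        - sine_poly (box_index n) (fourier w) (mi1 i) x)\<^sup>2 \<partial>cube_measure) \<le> e" if "0 < e" for e
      by (rule sine_poly_cauchy[OF 0 2[of i] _ that]) (simp add: ip_sine_poly_grad)
  qed (rule sine_poly_weak_limit[OF D1(1) 0])
  show "l2tendsto unit_cube (\<lambda>N. sine_poly (box_index N) (fourier w) (mi2 i j)) (D (mi2 i j))"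
  proof (rule l2tendsto_if_cauchy_weak[OF L2_sine_poly D2(2)])
    show "\<exists>N. \<forall>n\<ge>N. \<forall>m\<ge>n. (\<integral>x. (sine_poly (box_index m) (fourier w) (mi2 i j) x
        - sine_poly (box_index n) (fourier w) (mi2 i j) x)\<^sup>2 \<partial>cube_measure) \<le> e" if "0 < e" for e
      by (rule sine_poly_cauchy[OF 2[of i] 2[of j] _ that]) (simp add: ip_sine_poly_hessian)
  qed (rule sine_poly_weak_limit[OF D2(1) 0])
qed

section \<open>The weak Laplacian of the potential\<close>

lemma Linf_cube_integrable:
  fixes a :: "real^'n::finite \<Rightarrow> real"
  assumes "Linf unit_cube a" shows "integrable cube_measure a"
proof -
  obtain C where "AE x in cube_measure. \<bar>a x\<bar> \<le> C" using assms by (auto simp: Linf_def)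
  then show ?thesis
    using assms by (intro finite_measure.integrable_const_bound[OF finite_cube_measure, of _ C])
      (auto simp: Linf_def)
qed

text \<open>The product rule for \<open>D_ii\<close> of \<open>sine k mi0 * sine l mi0\<close>,
  written out.\<close>

definition lap_prod :: "'n \<Rightarrow> ('n \<Rightarrow> nat) \<Rightarrow> ('n \<Rightarrow> nat) \<Rightarrow> real^'n::finite \<Rightarrow> real" where
  "lap_prod i k l x = sine k (mi2 i i) x * sine l mi0 x + 2 * (sine k (mi1 i) x * sine l (mi1 i) x)
     + sine k mi0 x * sine l (mi2 i i) x"

text \<open>A product of two sines vanishes to second order on the boundary, so the second derivatives of
  its cutoffs remain bounded.\<close>

lemma weak_laplacian_sine_product:
  fixes V :: "real^'n::finite \<Rightarrow> real" and W :: "'n \<Rightarrow> real^'n \<Rightarrow> real"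
  assumes V: "Linf unit_cube V" and W: "\<And>i. weak_deriv unit_cube (mi2 i i) V (W i)"
    and L: "Linf unit_cube (\<lambda>x. \<Sum>i\<in>UNIV. W i x)"
  shows "(\<Sum>i\<in>UNIV. cip V (lap_prod i k l)) =
    cip (\<lambda>x. \<Sum>i\<in>UNIV. W i x) (\<lambda>x. sine k mi0 x * sine l mi0 x)"
proof -
  define g where "g m = (\<lambda>j t. csin (k j) (Suc m) t * csin (l j) (Suc m) t)" for m
  define g1 where "g1 m j t = csin' (k j) (Suc m) t * csin (l j) (Suc m) t
    + csin (k j) (Suc m) t * csin' (l j) (Suc m) t" for m j t
  define g2 where "g2 m j t = csin'' (k j) (Suc m) t * csin (l j) (Suc m) t
    + 2 * (csin' (k j) (Suc m) t * csin' (l j) (Suc m) t)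
    + csin (k j) (Suc m) t * csin'' (l j) (Suc m) t" for m j t
  have sm: "smooth_real (g m j)" for m j
    unfolding g_def by (intro smooth_real_intros(4) smooth_csin)
  have d1: "(g m j has_real_derivative g1 m j t) (at t)" for m j t
    unfolding g_def g1_def by (rule derivative_eq_intros csin_has_derivative refl)+ simp
  have sm1: "smooth_real (g1 m j)" for m j
    by (rule smooth_real_cong_deriv[OF sm d1])
  have d2: "(g1 m j has_real_derivative g2 m j t) (at t)" for m j t
    unfolding g1_def[abs_def] g2_def by (rule derivative_eq_intros csin_has_derivative refl)+ simp
  have sm2: "smooth_real (g2 m j)" for m j
    by (rule smooth_real_cong_deriv[OF sm1 d2])
  have smu: "smooth_real (((g m)(i := g2 m i)) j)" for m i j
    by (simp add: sm sm2)
  have t: "test_fun unit_cube (tensor (g m))" for m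
    by (rule test_fun_tensor[of "g m" "real (Suc m)", OF sm]) (simp_all add: g_def csin_eq_0 del: of_nat_Suc)
  have c: "cD (mi2 i i) (tensor (g m)) = tensor ((g m)(i := g2 m i))" for i m
  proof -
    have "cpartial (tensor (g m)) i = tensor ((g m)(i := g1 m i))"
      by (rule cpartial_tensor[OF sm d1])
    moreover have "cpartial (tensor ((g m)(i := g1 m i))) i = tensor (((g m)(i := g1 m i))(i := g2 m i))"
      by (rule cpartial_tensor) (auto simp: sm sm1 d2)
    ultimately show ?thesis by (simp add: cD_mi2_same)
  qed
  have eq: "(\<Sum>i\<in>UNIV. cip V (tensor ((g m)(i := g2 m i)))) = cip (\<lambda>x. \<Sum>i\<in>UNIV. W i x) (tensor (g m))" for m
  proof -
    have "cip V (tensor ((g m)(i := g2 m i))) = cip (W i) (tensor (g m))" for i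
      using W[of i] t[of m] by (auto simp: weak_deriv_def mi_order_mi2 c)
    moreover have "integrable cube_measure (\<lambda>x. W i x * tensor (g m) x)" for i
      using W[of i] test_fun_base[OF t[of m]]
      by (intro integrable_loc_int_compact_support) (auto simp: weak_deriv_def)
    ultimately show ?thesis by (simp add: sum_distrib_right)
  qed
  have "\<exists>C. \<forall>m t. 0 \<le> t \<and> t \<le> 1 \<longrightarrow> \<bar>g m j t\<bar> \<le> C \<and> \<bar>g2 m j t\<bar> \<le> C" for j
  proof -
    obtain A where A: "0 \<le> A" "\<And>m t. 0 \<le> t \<Longrightarrow> t \<le> 1 \<Longrightarrow> \<bar>csin (k j) m t\<bar> \<le> A * (t * (1 - t))"
      "\<And>m t. 0 \<le> t \<Longrightarrow> t \<le> 1 \<Longrightarrow> \<bar>csin' (k j) m t\<bar> \<le> A"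
      "\<And>m t. 0 \<le> t \<Longrightarrow> t \<le> 1 \<Longrightarrow> (t * (1 - t)) * \<bar>csin'' (k j) m t\<bar> \<le> A"
      using csin_bounds[of "k j"] by metis
    obtain B where B: "0 \<le> B" "\<And>m t. 0 \<le> t \<Longrightarrow> t \<le> 1 \<Longrightarrow> \<bar>csin (l j) m t\<bar> \<le> B * (t * (1 - t))"
      "\<And>m t. 0 \<le> t \<Longrightarrow> t \<le> 1 \<Longrightarrow> \<bar>csin' (l j) m t\<bar> \<le> B"
      "\<And>m t. 0 \<le> t \<Longrightarrow> t \<le> 1 \<Longrightarrow> (t * (1 - t)) * \<bar>csin'' (l j) m t\<bar> \<le> B"
      using csin_bounds[of "l j"] by metis
    have "\<bar>g m j t\<bar> \<le> 4 * (A * B) \<and> \<bar>g2 m j t\<bar> \<le> 4 * (A * B)" if t: "0 \<le> t" "t \<le> 1" for m t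
    proof -
      let ?q = "t * (1 - t)"
      let ?a = "csin (k j) (Suc m) t" and ?a' = "csin' (k j) (Suc m) t" and ?a'' = "csin'' (k j) (Suc m) t"
      let ?b = "csin (l j) (Suc m) t" and ?b' = "csin' (l j) (Suc m) t" and ?b'' = "csin'' (l j) (Suc m) t"
      have q: "0 \<le> ?q" "?q \<le> 1" using t by (auto intro: mult_le_one)
      note a = A(2,3,4)[OF t, of "Suc m"] and b = B(2,3,4)[OF t, of "Suc m"]
      have AB: "0 \<le> A * B" using A(1) B(1) by simp
      have qA: "A * ?q \<le> A" "B * ?q \<le> B" using A(1) B(1) q mult_left_mono[of ?q 1] by fastforce+
      have "\<bar>?a\<bar> * \<bar>?b\<bar> \<le> A * B"
        using a(1) b(1) qA A(1) by (intro mult_mono) auto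
      then have 1: "\<bar>g m j t\<bar> \<le> 4 * (A * B)" using AB by (simp add: g_def abs_mult)
      \<comment> \<open>The factor \<open>q\<close> by which one function vanishes pays for the
        \<open>1 / q\<close> growth of the second derivative of the other. The three terms of
        \<open>g2\<close> add up to 1 + 2 + 1 times \<open>A * B\<close>.\<close>
      have "\<bar>?a''\<bar> * \<bar>?b\<bar> \<le> \<bar>?a''\<bar> * (B * ?q)" using b(1) by (intro mult_left_mono) auto
      also have "\<dots> = (?q * \<bar>?a''\<bar>) * B" by simp
      also have "\<dots> \<le> A * B" using a(3) B(1) by (intro mult_right_mono)
      finally have 2: "\<bar>?a'' * ?b\<bar> \<le> A * B" by (simp only: abs_mult)
      have "\<bar>?a\<bar> * \<bar>?b''\<bar> \<le> (A * ?q) * \<bar>?b''\<bar>" using a(1) by (intro mult_right_mono) auto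
      also have "\<dots> = A * (?q * \<bar>?b''\<bar>)" by simp
      also have "\<dots> \<le> A * B" using b(3) A(1) by (intro mult_left_mono)
      finally have 3: "\<bar>?a * ?b''\<bar> \<le> A * B" by (simp only: abs_mult)
      have "\<bar>?a'\<bar> * \<bar>?b'\<bar> \<le> A * B" using a(2) b(2) A(1) by (intro mult_mono) auto
      then have 4: "\<bar>?a' * ?b'\<bar> \<le> A * B" by (simp only: abs_mult)
      have "\<bar>g2 m j t\<bar> \<le> 4 * (A * B)"
        unfolding g2_def using 2 3 4 by linarith
      with 1 show ?thesis by simp
    qed
    then show ?thesis by blast
  qed
  then obtain C where C: "\<And>j m t. 0 \<le> t \<Longrightarrow> t \<le> 1 \<Longrightarrow> \<bar>g m j t\<bar> \<le> C j \<and> \<bar>g2 m j t\<bar> \<le> C j"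
    by metis
  have limg: "(\<lambda>m. g m j t) \<longlonglongrightarrow> trig (k j) 0 t * trig (l j) 0 t"
    "(\<lambda>m. g2 m j t) \<longlonglongrightarrow> trig (k j) 2 t * trig (l j) 0 t + 2 * (trig (k j) 1 t * trig (l j) 1 t) + trig (k j) 0 t * trig (l j) 2 t"
    if "0 < t" "t < 1" for j t
    unfolding g_def g2_def
    by (intro tendsto_add tendsto_mult tendsto_const csin_tendsto[OF that, THEN LIMSEQ_Suc])+
  \<comment> \<open>The limit is taken for the sum over \<open>i\<close>, which is bounded; a single
    \<open>W i\<close> is only locally integrable and was split off only against test
    functions.\<close>
  have lim0: "(\<lambda>m. cip (\<lambda>x. \<Sum>i\<in>UNIV. W i x) (tensor (g m))) \<longlonglongrightarrow>
      cip (\<lambda>x. \<Sum>i\<in>UNIV. W i x) (\<lambda>x. sine k mi0 x * sine l mi0 x)"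
  proof (rule bounded_convergence_cube)
    show "\<bar>tensor (g m) x\<bar> \<le> (\<Prod>j\<in>UNIV. C j)" if "x \<in> unit_cube" for m x
      using that C by (intro tensor_bound) (auto simp: mem_unit_cube)
    show "AE x in cube_measure. (\<lambda>m. tensor (g m) x) \<longlonglongrightarrow> sine k mi0 x * sine l mi0 x"
      using AE_interior_unit_cube
    proof eventually_elim
      case (elim x)
      then show ?case unfolding sine_mult
        by (intro tensor_tendsto limg) (auto simp: interior_unit_cube)
    qed
    show "(\<lambda>x. sine k mi0 x * sine l mi0 x) \<in> borel_measurable cube_measure"
      by (intro continuous_cube_measurable continuous_intros smooth_continuous smooth_sine)
  qed (auto intro: Linf_cube_integrable L smooth_tensor_measurable sm)
  have "(\<lambda>m. cip V (tensor ((g m)(i := g2 m i)))) \<longlonglongrightarrow> cip V (lap_prod i k l)" for i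
  proof (rule bounded_convergence_cube)
    show "\<bar>tensor ((g m)(i := g2 m i)) x\<bar> \<le> (\<Prod>j\<in>UNIV. C j)" if "x \<in> unit_cube" for m x
      using that C by (intro tensor_bound) (auto simp: mem_unit_cube)
    show "AE x in cube_measure. (\<lambda>m. tensor ((g m)(i := g2 m i)) x) \<longlonglongrightarrow> lap_prod i k l x"
      using AE_interior_unit_cube
    proof eventually_elim
      case (elim x)
      have r: "(\<Prod>j\<in>UNIV. f j) = f i * (\<Prod>j\<in>UNIV-{i}. f j)" for f :: "'n \<Rightarrow> real"
        by (rule prod.remove) auto
      define h where "h = (\<lambda>j t. trig (k j) 0 t * trig (l j) 0 t)(i :=
        (\<lambda>t. trig (k i) 2 t * trig (l i) 0 t + 2 * (trig (k i) 1 t * trig (l i) 1 t) + trig (k i) 0 t * trig (l i) 2 t))"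
      define P where "P = (\<Prod>j\<in>UNIV-{i}. trig (k j) 0 (x $ j) * trig (l j) 0 (x $ j))"
      have "lap_prod i k l x = tensor h x"
      proof -
        have "sine k (mi2 i i) x * sine l mi0 x = trig (k i) 2 (x $ i) * trig (l i) 0 (x $ i) * P"
          "sine k mi0 x * sine l (mi2 i i) x = trig (k i) 0 (x $ i) * trig (l i) 2 (x $ i) * P"
          unfolding sine_mult tensor_def P_def by (subst r; auto simp: mi2_same intro!: prod.cong)+
        moreover have "sine k (mi1 i) x * sine l (mi1 i) x = trig (k i) 1 (x $ i) * trig (l i) 1 (x $ i) * P"
          unfolding sine_mult tensor_def P_def by (subst r; auto simp: mi1_def intro!: prod.cong)
        moreover have "tensor h x = (trig (k i) 2 (x $ i) * trig (l i) 0 (x $ i) + 2 * (trig (k i) 1 (x $ i) * trig (l i) 1 (x $ i))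
            + trig (k i) 0 (x $ i) * trig (l i) 2 (x $ i)) * P"
          unfolding tensor_def P_def by (subst r) (auto simp: h_def intro!: prod.cong)
        ultimately show ?thesis unfolding lap_prod_def by (simp add: algebra_simps)
      qed
      moreover have "(\<lambda>m. ((g m)(i := g2 m i)) j (x $ j)) \<longlonglongrightarrow> h j (x $ j)" for j
        using elim limg[of "x $ j" j] by (cases "j = i") (auto simp: h_def interior_unit_cube)
      ultimately show ?case using tensor_tendsto[of "\<lambda>m. (g m)(i := g2 m i)" x h] by simp
    qed
    show "lap_prod i k l \<in> borel_measurable cube_measure"
      unfolding lap_prod_def[abs_def] by (intro continuous_cube_measurable continuous_intros smooth_continuous smooth_sine)
    show "tensor ((g m)(i := g2 m i)) \<in> borel_measurable cube_measure" for m
      by (intro smooth_tensor_measurable smu)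
  qed (rule Linf_cube_integrable[OF V])
  then have "(\<lambda>m. \<Sum>i\<in>UNIV. cip V (tensor ((g m)(i := g2 m i)))) \<longlonglongrightarrow> (\<Sum>i\<in>UNIV. cip V (lap_prod i k l))"
    by (intro tendsto_sum)
  then show ?thesis using lim0 unfolding eq by (rule LIMSEQ_unique)
qed

text \<open>The Laplacian of \<open>T^2\<close>, that is \<open>2 * T * lap T\<close> plus twice the
  squared gradient, tested against \<open>V\<close>. \<open>T^2\<close> is expanded into products of
  two sines, and the two outer terms of \<open>lap_prod\<close> coincide after summation over all
  pairs.\<close>

lemma weak_laplacian_sine_poly:
  fixes V :: "real^'n::finite \<Rightarrow> real" and W :: "'n \<Rightarrow> real^'n \<Rightarrow> real"
    and K :: "('n \<Rightarrow> nat) set" and c :: "('n \<Rightarrow> nat) \<Rightarrow> real"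
  assumes V: "Linf unit_cube V" and W: "\<And>i. weak_deriv unit_cube (mi2 i i) V (W i)"
    and L: "Linf unit_cube (\<lambda>x. \<Sum>i\<in>UNIV. W i x)"
  defines "T \<equiv> sine_poly K c"
  shows "(\<Sum>i\<in>UNIV. 2 * cip (\<lambda>x. V x * T (mi2 i i) x) (T mi0) + 2 * cip (\<lambda>x. V x * T (mi1 i) x) (T (mi1 i)))
    = cip (\<lambda>x. (\<Sum>i\<in>UNIV. W i x) * T mi0 x) (T mi0)"
proof -
  have TT: "T \<alpha> x * T \<beta> x = (\<Sum>k\<in>K. \<Sum>l\<in>K. c k * c l * (sine k \<alpha> x * sine l \<beta> x))" for \<alpha> \<beta> x
    unfolding T_def sine_poly_def sum_product by (intro sum.cong refl) (simp add: mult_ac)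
  have c: "continuous_on unit_cube (\<lambda>x. sine k \<alpha> x * sine l \<beta> x)" for k l \<alpha> \<beta> :: "'n \<Rightarrow> nat"
    by (intro continuous_intros smooth_continuous smooth_sine)
  have intg: "integrable cube_measure (\<lambda>x. a x * f x)" if "Linf unit_cube a" "continuous_on unit_cube f" for a f
    by (rule continuous_cube_bounded[OF that(2)])
      (rule integrable_mult_bounded[OF Linf_cube_integrable[OF that(1)] continuous_cube_measurable[OF that(2)]])
  have aTT: "cip a (\<lambda>x. T \<alpha> x * T \<beta> x) = (\<Sum>k\<in>K. \<Sum>l\<in>K. c k * c l * cip a (\<lambda>x. sine k \<alpha> x * sine l \<beta> x))"
    if a: "Linf unit_cube a" for a \<alpha> \<beta>
  proof -
    have "cip a (\<lambda>x. T \<alpha> x * T \<beta> x) = (\<integral>x. (\<Sum>k\<in>K. \<Sum>l\<in>K. c k * c l * (a x * (sine k \<alpha> x * sine l \<beta> x))) \<partial>cube_measure)"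
      by (simp add: TT sum_distrib_left mult_ac)
    also have "\<dots> = (\<Sum>k\<in>K. \<integral>x. (\<Sum>l\<in>K. c k * c l * (a x * (sine k \<alpha> x * sine l \<beta> x))) \<partial>cube_measure)"
      by (rule Bochner_Integration.integral_sum)
        (intro Bochner_Integration.integrable_sum integrable_mult_right intg[OF a c])
    also have "\<dots> = (\<Sum>k\<in>K. \<Sum>l\<in>K. \<integral>x. c k * c l * (a x * (sine k \<alpha> x * sine l \<beta> x)) \<partial>cube_measure)"
      by (intro sum.cong refl Bochner_Integration.integral_sum integrable_mult_right intg[OF a c])
    finally show ?thesis by simp
  qed
  have lap: "cip V (lap_prod i k l) = cip V (\<lambda>x. sine k (mi2 i i) x * sine l mi0 x)
      + 2 * cip V (\<lambda>x. sine k (mi1 i) x * sine l (mi1 i) x)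
      + cip V (\<lambda>x. sine k mi0 x * sine l (mi2 i i) x)" for i k l
  proof -
    have "cip V (lap_prod i k l) = (\<integral>x. V x * (sine k (mi2 i i) x * sine l mi0 x)
      + 2 * (V x * (sine k (mi1 i) x * sine l (mi1 i) x)) + V x * (sine k mi0 x * sine l (mi2 i i) x) \<partial>cube_measure)"
      by (simp add: lap_prod_def distrib_left mult.left_commute[of _ 2])
    also have "\<dots> = cip V (\<lambda>x. sine k (mi2 i i) x * sine l mi0 x)
      + 2 * cip V (\<lambda>x. sine k (mi1 i) x * sine l (mi1 i) x)
      + cip V (\<lambda>x. sine k mi0 x * sine l (mi2 i i) x)"
      by (simp add: intg[OF V c])
    finally show ?thesis .
  qed
  have "cip (\<lambda>x. \<Sum>i\<in>UNIV. W i x) (\<lambda>x. T mi0 x * T mi0 x) =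
      (\<Sum>k\<in>K. \<Sum>l\<in>K. c k * c l * (\<Sum>i\<in>UNIV. cip V (lap_prod i k l)))"
    by (subst aTT[OF L]) (simp only: weak_laplacian_sine_product[OF V W L])
  also have "\<dots> = (\<Sum>i\<in>UNIV. \<Sum>k\<in>K. \<Sum>l\<in>K. c k * c l * cip V (lap_prod i k l))"
    by (simp only: sum_distrib_left sum.swap[of _ UNIV])
  also have "\<dots> = (\<Sum>i\<in>UNIV. cip V (\<lambda>x. T (mi2 i i) x * T mi0 x)
      + 2 * cip V (\<lambda>x. T (mi1 i) x * T (mi1 i) x) + cip V (\<lambda>x. T mi0 x * T (mi2 i i) x))"
    by (simp only: aTT[OF V] lap distrib_left sum.distrib sum_distrib_left mult.left_commute[of _ 2])
  also have "\<dots> = (\<Sum>i\<in>UNIV. 2 * cip (\<lambda>x. V x * T (mi2 i i) x) (T mi0) + 2 * cip (\<lambda>x. V x * T (mi1 i) x) (T (mi1 i)))"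
    by (intro sum.cong refl) (simp add: mult_ac)
  finally show ?thesis by (simp add: mult.assoc)
qed

section \<open>The energy identity and the error bounds\<close>

lemma mi_order_SucE:
  assumes "mi_order \<alpha> = Suc n"
  obtains i \<beta> where "mi_order \<beta> = n" "\<alpha> = \<beta>(i := Suc (\<beta> i))"
proof -
  have "\<exists>i. 0 < \<alpha> i" using assms by (metis mi_order_def gr0I sum.neutral nat.distinct(1))
  then obtain i where i: "0 < \<alpha> i" by blast
  define \<beta> where "\<beta> = \<alpha>(i := \<alpha> i - 1)"
  have "mi_order \<alpha> = Suc (mi_order \<beta>)"
    unfolding mi_order_def \<beta>_def using i
    by (subst (1 2) sum.remove[of _ i]) (auto intro!: sum.cong)
  then have "mi_order \<beta> = n" using assms by simp
  moreover have "\<alpha> = \<beta>(i := Suc (\<beta> i))" using i by (simp add: \<beta>_def)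
  ultimately show ?thesis by (rule that)
qed

lemma mi_order_eq_0: "mi_order \<alpha> = 0 \<longleftrightarrow> \<alpha> = (\<lambda>_. 0)"
  by (auto simp: mi_order_def)

lemma mi_order_eq_1: "mi_order \<alpha> = Suc 0 \<longleftrightarrow> \<alpha> \<in> range mi1"
proof
  assume "mi_order \<alpha> = Suc 0"
  then obtain i \<beta> where "mi_order \<beta> = 0" "\<alpha> = \<beta>(i := Suc (\<beta> i))" by (rule mi_order_SucE)
  then have "\<alpha> = mi1 i" by (auto simp: mi_order_eq_0 mi1_def)
  then show "\<alpha> \<in> range mi1" by blast
qed (auto simp: mi_order_mi1)

lemma mi_order_eq_2: "mi_order \<alpha> = 2 \<longleftrightarrow> \<alpha> \<in> range (\<lambda>(i, j). mi2 i j)"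
proof
  assume "mi_order \<alpha> = 2"
  then have "mi_order \<alpha> = Suc (Suc 0)" by simp
  then obtain i \<beta> where b: "mi_order \<beta> = Suc 0" "\<alpha> = \<beta>(i := Suc (\<beta> i))" by (rule mi_order_SucE)
  then obtain j where "\<beta> = mi1 j" by (auto simp: mi_order_eq_1)
  then have "\<alpha> = mi2 i j" using b by (metis mi2_upd)
  then show "\<alpha> \<in> range (\<lambda>(i, j). mi2 i j)" by auto
qed (auto simp: mi_order_mi2)

lemma mi2_eq_iff: "mi2 a b = mi2 i j \<longleftrightarrow> (a = i \<and> b = j) \<or> (a = j \<and> b = i)"
proof
  assume eq: "mi2 a b = mi2 i j"
  show "(a = i \<and> b = j) \<or> (a = j \<and> b = i)"
    using fun_cong[OF eq, of a] fun_cong[OF eq, of b] fun_cong[OF eq, of i] fun_cong[OF eq, of j]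
    by (cases "a = i"; cases "a = j"; cases "b = i"; cases "b = j"; cases "i = j"; cases "a = b")
      (simp_all add: mi2_def)
qed (auto simp: mi2_def)

lemma inj_mi1: "inj mi1"
proof (rule injI)
  fix i j :: 'a assume "mi1 i = mi1 j"
  from fun_cong[OF this, of i] show "i = j" by (simp add: mi1_def split: if_splits)
qed

lemma sum_mi_order_le_2:
  fixes h :: "('n::finite \<Rightarrow> nat) \<Rightarrow> real"
  shows "(\<Sum>\<alpha> | mi_order \<alpha> \<le> 2. h \<alpha>) = h mi0 + (\<Sum>i\<in>UNIV. h (mi1 i)) + (\<Sum>\<alpha>\<in>range (\<lambda>(i, j). mi2 i j). h \<alpha>)"
proof -
  have eq: "{\<alpha> :: 'n \<Rightarrow> nat. mi_order \<alpha> \<le> 2} = insert (\<lambda>_. 0) (range mi1 \<union> range (\<lambda>(i, j). mi2 i j))"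
  proof -
    have "mi_order \<alpha> \<le> 2 \<longleftrightarrow> mi_order \<alpha> = 0 \<or> mi_order \<alpha> = Suc 0 \<or> mi_order \<alpha> = 2" for \<alpha> :: "'n \<Rightarrow> nat"
      by auto
    then show ?thesis by (auto simp: mi_order_eq_0 mi_order_eq_1 mi_order_eq_2)
  qed
  have "(\<lambda>_. 0) \<notin> range mi1 \<union> range (\<lambda>(i, j). mi2 i j :: 'n \<Rightarrow> nat)"
  proof
    assume "(\<lambda>_. 0) \<in> range mi1 \<union> range (\<lambda>(i, j). mi2 i j :: 'n \<Rightarrow> nat)"
    then have "mi_order (\<lambda>_::'n. 0) = Suc 0 \<or> mi_order (\<lambda>_::'n. 0) = 2"
      by (simp only: mi_order_eq_1 mi_order_eq_2 Un_iff)
    then show False by (simp add: mi_order_0)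
  qed
  moreover have "range mi1 \<inter> range (\<lambda>(i, j). mi2 i j :: 'n \<Rightarrow> nat) = {}"
  proof -
    have "False" if "\<alpha> \<in> range mi1" "\<alpha> \<in> range (\<lambda>(i, j). mi2 i j)" for \<alpha> :: "'n \<Rightarrow> nat"
      using that unfolding mi_order_eq_1[symmetric] mi_order_eq_2[symmetric] by simp
    then show ?thesis by blast
  qed
  ultimately show ?thesis
    unfolding eq by (simp add: sum.union_disjoint sum.reindex[OF inj_mi1])
qed

text \<open>A multi-index \<open>mi2 i j\<close> comes from one ordered pair if \<open>i = j\<close>
  and from two otherwise, so the double sum counts each nonnegative term once or twice.\<close>

lemma sum_mi2_bounds:
  fixes h :: "('n::finite \<Rightarrow> nat) \<Rightarrow> real"
  assumes nn: "\<And>\<alpha>. 0 \<le> h \<alpha>"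
  shows "(\<Sum>\<alpha>\<in>range (\<lambda>(i, j). mi2 i j). h \<alpha>) \<le> (\<Sum>i\<in>UNIV. \<Sum>j\<in>UNIV. h (mi2 i j))"
    and "(\<Sum>i\<in>UNIV. \<Sum>j\<in>UNIV. h (mi2 i j)) \<le> 2 * (\<Sum>\<alpha>\<in>range (\<lambda>(i, j). mi2 i j). h \<alpha>)"
proof -
  let ?f = "\<lambda>(i, j). mi2 i j :: 'n \<Rightarrow> nat"
  have S: "(\<Sum>i\<in>UNIV. \<Sum>j\<in>UNIV. h (mi2 i j)) = (\<Sum>p\<in>UNIV. h (?f p))"
    by (simp add: sum.cartesian_product split_def)
  show "(\<Sum>\<alpha>\<in>range ?f. h \<alpha>) \<le> (\<Sum>i\<in>UNIV. \<Sum>j\<in>UNIV. h (mi2 i j))"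
    unfolding S using sum_image_le[of UNIV h ?f] nn by (simp add: o_def)
  have "(\<Sum>p\<in>UNIV. h (?f p)) = (\<Sum>\<alpha>\<in>range ?f. \<Sum>p\<in>{p\<in>UNIV. ?f p = \<alpha>}. h (?f p))"
    by (rule sum.image_gen) simp
  also have "\<dots> \<le> (\<Sum>\<alpha>\<in>range ?f. 2 * h \<alpha>)"
  proof (rule sum_mono)
    fix \<alpha> assume "\<alpha> \<in> range ?f"
    then obtain i j where \<alpha>: "\<alpha> = mi2 i j" by auto
    have "{p\<in>UNIV. ?f p = \<alpha>} \<subseteq> {(i, j), (j, i)}" by (clarsimp simp: \<alpha> mi2_eq_iff)
    then have "card {p\<in>UNIV. ?f p = \<alpha>} \<le> card {(i, j), (j, i)}" by (intro card_mono) auto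
    also have "\<dots> \<le> 2" by (cases "i = j") simp_all
    finally have "real (card {p\<in>UNIV. ?f p = \<alpha>}) \<le> 2" by simp
    then have "real (card {p\<in>UNIV. ?f p = \<alpha>}) * h \<alpha> \<le> 2 * h \<alpha>" by (intro mult_right_mono nn)
    moreover have "(\<Sum>p\<in>{p\<in>UNIV. ?f p = \<alpha>}. h (?f p)) = (\<Sum>p\<in>{p\<in>UNIV. ?f p = \<alpha>}. h \<alpha>)"
      by (rule sum.cong) auto
    ultimately show "(\<Sum>p\<in>{p\<in>UNIV. ?f p = \<alpha>}. h (?f p)) \<le> 2 * h \<alpha>" by simp
  qed
  finally show "(\<Sum>i\<in>UNIV. \<Sum>j\<in>UNIV. h (mi2 i j)) \<le> 2 * (\<Sum>\<alpha>\<in>range ?f. h \<alpha>)"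
    unfolding S by (simp add: sum_distrib_left)
qed

text \<open>Only two identities are passed to the limit along the partial sums: the exchange of
  Hessian indices and the Laplacian of the squared sum against \<open>V\<close>. Both are made of
  inner products of L2 convergent sequences with bounded weights. The square on the left is then
  expanded for \<open>w\<close> itself.\<close>

lemma energy_identity:
  fixes w V :: "real^'n::finite \<Rightarrow> real" and W :: "'n \<Rightarrow> real^'n \<Rightarrow> real"
  assumes w: "L2 unit_cube w"
    and D: "\<And>\<alpha>. mi_order \<alpha> \<le> 2 \<Longrightarrow> weak_deriv unit_cube \<alpha> w (D \<alpha>) \<and> L2 unit_cube (D \<alpha>)"
    and bd: "\<And>i k. cip (D (mi2 i i)) (sine k mi0) = cip w (sine k (mi2 i i))"
    and V: "Linf unit_cube V" and W: "\<And>i. weak_deriv unit_cube (mi2 i i) V (W i)"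
    and L: "Linf unit_cube (\<lambda>x. \<Sum>i\<in>UNIV. W i x)"
  shows "(\<integral>x. ((\<Sum>i\<in>UNIV. D (mi2 i i) x) - V x * w x)\<^sup>2 \<partial>cube_measure) =
    (\<Sum>i\<in>UNIV. \<Sum>j\<in>UNIV. \<integral>x. (D (mi2 i j) x)\<^sup>2 \<partial>cube_measure)
    + 2 * (\<Sum>i\<in>UNIV. \<integral>x. V x * (D (mi1 i) x)\<^sup>2 \<partial>cube_measure)
    + (\<integral>x. ((V x)\<^sup>2 - (\<Sum>i\<in>UNIV. W i x)) * (w x)\<^sup>2 \<partial>cube_measure)"
proof -
  let ?T = "\<lambda>N. sine_poly (box_index N) (fourier w)"
  let ?\<Delta> = "\<lambda>x. \<Sum>i\<in>UNIV. D (mi2 i i) x"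
  let ?L = "\<lambda>x. \<Sum>i\<in>UNIV. W i x"
  note T0 = sine_approximation(1)[OF w D bd] and T1 = sine_approximation(2)[OF w D bd]
    and T2 = sine_approximation(3)[OF w D bd]
  have D1: "L2 unit_cube (D (mi1 i))" and D2: "L2 unit_cube (D (mi2 i j))" for i j
    using D[of "mi1 i"] D[of "mi2 i j"] by (auto simp: mi_order_mi1 mi_order_mi2)
  have \<Delta>: "L2 unit_cube ?\<Delta>" by (intro L2_sum D2)
  have hess: "cip (D (mi2 i i)) (D (mi2 j j)) = cip (D (mi2 i j)) (D (mi2 i j))" for i j
    using l2tendsto_ip[OF T2[of i i] T2[of j j]] l2tendsto_ip[OF T2[of i j] T2[of i j]]
    unfolding ip_sine_poly_hessian by (rule LIMSEQ_unique)
  have "cip ?\<Delta> ?\<Delta> = (\<integral>x. (\<Sum>i\<in>UNIV. \<Sum>j\<in>UNIV. D (mi2 i i) x * D (mi2 j j) x) \<partial>cube_measure)"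
    by (simp add: sum_product)
  also have "\<dots> = (\<Sum>i\<in>UNIV. \<integral>x. (\<Sum>j\<in>UNIV. D (mi2 i i) x * D (mi2 j j) x) \<partial>cube_measure)"
    by (rule Bochner_Integration.integral_sum) (intro Bochner_Integration.integrable_sum L2_integrable_mult D2)
  also have "\<dots> = (\<Sum>i\<in>UNIV. \<Sum>j\<in>UNIV. cip (D (mi2 i i)) (D (mi2 j j)))"
    by (intro sum.cong refl Bochner_Integration.integral_sum L2_integrable_mult D2)
  also have "\<dots> = (\<Sum>i\<in>UNIV. \<Sum>j\<in>UNIV. cip (D (mi2 i j)) (D (mi2 i j)))"
    by (intro sum.cong refl hess)
  finally have DD: "cip ?\<Delta> ?\<Delta> = (\<Sum>i\<in>UNIV. \<Sum>j\<in>UNIV. cip (D (mi2 i j)) (D (mi2 i j)))" .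
  have "(\<lambda>N. \<Sum>i\<in>UNIV. 2 * cip (\<lambda>x. V x * ?T N (mi2 i i) x) (?T N mi0)
        + 2 * cip (\<lambda>x. V x * ?T N (mi1 i) x) (?T N (mi1 i))) \<longlonglongrightarrow>
      (\<Sum>i\<in>UNIV. 2 * cip (\<lambda>x. V x * D (mi2 i i) x) w
        + 2 * cip (\<lambda>x. V x * D (mi1 i) x) (D (mi1 i)))"
    by (intro tendsto_intros l2tendsto_ip l2tendsto_Linf_mult[OF V] T0 T1 T2)
  moreover have "(\<lambda>N. cip (\<lambda>x. ?L x * ?T N mi0 x) (?T N mi0)) \<longlonglongrightarrow> cip (\<lambda>x. ?L x * w x) w"
    by (intro l2tendsto_ip l2tendsto_Linf_mult[OF L] T0)
  ultimately have "(\<Sum>i\<in>UNIV. 2 * cip (\<lambda>x. V x * D (mi2 i i) x) w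
        + 2 * cip (\<lambda>x. V x * D (mi1 i) x) (D (mi1 i))) = cip (\<lambda>x. ?L x * w x) w"
    unfolding weak_laplacian_sine_poly[OF V W L] by (rule LIMSEQ_unique)
  moreover have "(\<Sum>i\<in>UNIV. cip (\<lambda>x. V x * D (mi2 i i) x) w) = cip (\<lambda>x. V x * ?\<Delta> x) w"
  proof -
    have "(\<Sum>i\<in>UNIV. cip (\<lambda>x. V x * D (mi2 i i) x) w) = (\<integral>x. (\<Sum>i\<in>UNIV. V x * D (mi2 i i) x * w x) \<partial>cube_measure)"
      by (rule Bochner_Integration.integral_sum[symmetric]) (intro L2_integrable_mult L2_Linf_mult V D2 w)
    then show ?thesis by (simp add: sum_distrib_left sum_distrib_right)
  qed
  \<comment> \<open>The limit form of moving the Laplacian from \<open>w^2\<close> to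
    \<open>V\<close>.\<close>
  ultimately have VI: "2 * cip (\<lambda>x. V x * ?\<Delta> x) w
      + 2 * (\<Sum>i\<in>UNIV. cip (\<lambda>x. V x * D (mi1 i) x) (D (mi1 i))) = cip (\<lambda>x. ?L x * w x) w"
    by (simp add: sum.distrib flip: sum_distrib_left)
  have Vw: "L2 unit_cube (\<lambda>x. V x * w x)" by (intro L2_Linf_mult V w)
  have i1: "integrable cube_measure (\<lambda>x. ?\<Delta> x * ?\<Delta> x)" by (intro L2_integrable_mult \<Delta>)
  have i2: "integrable cube_measure (\<lambda>x. V x * ?\<Delta> x * w x)" by (intro L2_integrable_mult L2_Linf_mult V \<Delta> w)
  have i3: "integrable cube_measure (\<lambda>x. (V x * w x) * (V x * w x))" by (intro L2_integrable_mult Vw)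
  have i4: "integrable cube_measure (\<lambda>x. ?L x * w x * w x)" by (intro L2_integrable_mult L2_Linf_mult L w)
  have "(\<integral>x. (?\<Delta> x - V x * w x)\<^sup>2 \<partial>cube_measure) =
      (\<integral>x. ?\<Delta> x * ?\<Delta> x - 2 * (V x * ?\<Delta> x * w x) + (V x * w x) * (V x * w x) \<partial>cube_measure)"
    by (intro Bochner_Integration.integral_cong) (auto simp: power2_eq_square algebra_simps)
  also have "\<dots> = cip ?\<Delta> ?\<Delta> - 2 * cip (\<lambda>x. V x * ?\<Delta> x) w + cip (\<lambda>x. V x * w x) (\<lambda>x. V x * w x)"
    using i1 i2 i3 by simp
  \<comment> \<open>By \<open>VI\<close>, the cross term of the square is exchanged for the gradient
    term minus the term with the Laplacian of \<open>V\<close>.\<close>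
  also have "\<dots> = cip ?\<Delta> ?\<Delta> + 2 * (\<Sum>i\<in>UNIV. cip (\<lambda>x. V x * D (mi1 i) x) (D (mi1 i)))
      + (cip (\<lambda>x. V x * w x) (\<lambda>x. V x * w x) - cip (\<lambda>x. ?L x * w x) w)"
    using VI by simp
  also have "cip (\<lambda>x. V x * w x) (\<lambda>x. V x * w x) - cip (\<lambda>x. ?L x * w x) w =
      (\<integral>x. (V x * w x) * (V x * w x) - ?L x * w x * w x \<partial>cube_measure)"
    using i3 i4 by simp
  also have "\<dots> = (\<integral>x. ((V x)\<^sup>2 - ?L x) * (w x)\<^sup>2 \<partial>cube_measure)"
    by (intro Bochner_Integration.integral_cong) (auto simp: power2_eq_square algebra_simps)
  finally show ?thesis
    unfolding DD by (simp add: power2_eq_square mult.assoc)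
qed

theorem mainTheorem2:
  fixes V f ustar :: "real^'n::finite \<Rightarrow> real"
    and Cmin Vmax :: real
  assumes f_L2: "L2 unit_cube f"
    and V_twice: "\<forall>\<alpha>. mi_order \<alpha> \<le> 2 \<longrightarrow> (\<exists>v. weak_deriv unit_cube \<alpha> V v)"
    and V_Linf: "Linf unit_cube V"
    and gradV_Linf: "\<forall>\<alpha>. mi_order \<alpha> = 1 \<longrightarrow> Linf unit_cube (wD unit_cube \<alpha> V)"
    and lapV_Linf: "Linf unit_cube (wlap unit_cube V)"
    and Cmin_pos: "0 < Cmin"
    and V_bounds: "AE x in lebesgue_on unit_cube.
        Cmin < V x \<and> V x \<le> Vmax \<and> Cmin < (V x)\<^sup>2 - wlap unit_cube V x
        \<and> - wlap unit_cube V x \<le> Vmax"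
    and ustar_H10: "H10 unit_cube ustar"
    and ustar_H2: "Hk 2 unit_cube ustar"
    and ustar_eq: "AE x in lebesgue_on unit_cube.
        - wlap unit_cube ustar x + V x * ustar x = f x"
  shows "\<forall>u. H10 unit_cube u \<and> Hk 2 unit_cube u \<longrightarrow>
     min 1 Cmin * Hk_norm_sq 2 unit_cube (\<lambda>x. u x - ustar x)
       \<le> E_PINN unit_cube V f u - E_PINN unit_cube V f ustar
     \<and> E_PINN unit_cube V f u - E_PINN unit_cube V f ustar
       \<le> 2 * (1 + Vmax + Vmax\<^sup>2) * Hk_norm_sq 2 unit_cube (\<lambda>x. u x - ustar x)"
proof (intro allI impI)
  fix u :: "real^'n \<Rightarrow> real"
  assume u: "H10 unit_cube u \<and> Hk 2 unit_cube u"
  define w where "w x = u x - ustar x" for x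
  define D where "D \<alpha> = wD unit_cube \<alpha> w" for \<alpha>
  define W where "W i = wD unit_cube (mi2 i i) V" for i
  have wlap_eq: "wlap unit_cube v x = (\<Sum>i\<in>UNIV. wD unit_cube (mi2 i i) v x)" for v :: "real^'n \<Rightarrow> real" and x
    by (simp add: wlap_def mi2_same)
  have Lu: "L2 unit_cube u" "L2 unit_cube ustar" using u ustar_H2 by (auto simp: Hk_def)
  then have Lw: "L2 unit_cube w" unfolding w_def[abs_def] by (intro L2_diff)
  have wd: "weak_deriv unit_cube \<alpha> w (\<lambda>x. wD unit_cube \<alpha> u x - wD unit_cube \<alpha> ustar x)"
    and Ld: "L2 unit_cube (wD unit_cube \<alpha> u)" "L2 unit_cube (wD unit_cube \<alpha> ustar)"
    if "mi_order \<alpha> \<le> 2" for \<alpha>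
    unfolding w_def[abs_def] using u ustar_H2 that by (auto intro!: weak_deriv_diff Hk_wD)
  \<comment> \<open>\<open>D \<alpha>\<close> is the derivative that \<open>wD\<close> chooses for
    \<open>w\<close>; its agreement with the difference of those chosen for \<open>u\<close> and
    \<open>ustar\<close> is only almost everywhere.\<close>
  have Dw: "weak_deriv unit_cube \<alpha> w (D \<alpha>) \<and> L2 unit_cube (D \<alpha>)"
    and Dae: "AE x in cube_measure. D \<alpha> x = wD unit_cube \<alpha> u x - wD unit_cube \<alpha> ustar x"
    if "mi_order \<alpha> \<le> 2" for \<alpha>
  proof -
    show w1: "AE x in cube_measure. D \<alpha> x = wD unit_cube \<alpha> u x - wD unit_cube \<alpha> ustar x"
      unfolding D_def by (rule wD_AE_eq[OF wd[OF that]])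
    have w2: "weak_deriv unit_cube \<alpha> w (D \<alpha>)"
      unfolding D_def by (rule weak_deriv_wD[OF wd[OF that]])
    then have "D \<alpha> \<in> borel_measurable cube_measure" by (simp add: weak_deriv_def loc_int_def)
    moreover have "AE x in cube_measure. wD unit_cube \<alpha> u x - wD unit_cube \<alpha> ustar x = D \<alpha> x"
      using w1 by eventually_elim simp
    ultimately have "L2 unit_cube (D \<alpha>)"
      using L2_cong_AE[OF L2_diff[OF Ld[OF that]]] by blast
    then show "weak_deriv unit_cube \<alpha> w (D \<alpha>) \<and> L2 unit_cube (D \<alpha>)" using w2 by simp
  qed
  have D0: "AE x in cube_measure. D mi0 x = w x"
    unfolding D_def by (intro wD_AE_eq weak_deriv_0 L2_cube_loc_int Lw)
  have D1: "L2 unit_cube (D (mi1 i))" and D2: "L2 unit_cube (D (mi2 i j))" for i j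
    using Dw[of "mi1 i"] Dw[of "mi2 i j"] by (auto simp: mi_order_mi1 mi_order_mi2)
  \<comment> \<open>The boundary condition enters through \<open>u\<close> and \<open>ustar\<close>
    separately; the resulting identity is linear and so passes to \<open>w\<close>.\<close>
  have bd: "cip (D (mi2 i i)) (sine k mi0) = cip w (sine k (mi2 i i))" for i k
  proof -
    note L = Ld[of "mi2 i i", unfolded mi_order_mi2, OF order_refl]
    have ae: "AE x in cube_measure. D (mi2 i i) x * sine k mi0 x =
        (wD unit_cube (mi2 i i) u x - wD unit_cube (mi2 i i) ustar x) * sine k mi0 x"
      using Dae[of "mi2 i i", unfolded mi_order_mi2, OF order_refl] by eventually_elim simp
    have "cip (D (mi2 i i)) (sine k mi0) =
        cip (\<lambda>x. wD unit_cube (mi2 i i) u x - wD unit_cube (mi2 i i) ustar x) (sine k mi0)"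
      by (rule integral_cong_AE[OF _ _ ae])
        (intro borel_measurable_integrable L2_integrable_mult D2 L2_diff L L2_sine)+
    also have "\<dots> = cip (wD unit_cube (mi2 i i) u) (sine k mi0) - cip (wD unit_cube (mi2 i i) ustar) (sine k mi0)"
      using L by (simp add: left_diff_distrib L2_integrable_mult L2_sine)
    also have "\<dots> = cip u (sine k (mi2 i i)) - cip ustar (sine k (mi2 i i))"
      using u ustar_H10 ustar_H2 by (simp add: H10_H2_sine)
    also have "\<dots> = cip w (sine k (mi2 i i))"
      using Lu by (simp add: w_def left_diff_distrib L2_integrable_mult L2_sine)
    finally show ?thesis .
  qed
  have W: "weak_deriv unit_cube (mi2 i i) V (W i)" for i
    unfolding W_def using V_twice weak_deriv_wD mi_order_mi2 by (metis order_refl)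
  have lapW: "wlap unit_cube V = (\<lambda>x. \<Sum>i\<in>UNIV. W i x)" by (auto simp: wlap_eq W_def)
  have L: "Linf unit_cube (\<lambda>x. \<Sum>i\<in>UNIV. W i x)" using lapV_Linf by (simp add: lapW)
  define H where "H = (\<Sum>i\<in>UNIV. \<Sum>j\<in>UNIV. \<integral>x. (D (mi2 i j) x)\<^sup>2 \<partial>cube_measure)"
  define A where "A = (\<Sum>i\<in>UNIV. \<integral>x. (D (mi1 i) x)\<^sup>2 \<partial>cube_measure)"
  define B where "B = (\<integral>x. (w x)\<^sup>2 \<partial>cube_measure)"
  define S where "S = (\<Sum>\<alpha>\<in>range (\<lambda>(i, j). mi2 i j). \<integral>x. (D \<alpha> x)\<^sup>2 \<partial>cube_measure)"
  define P where "P = (\<Sum>i\<in>UNIV. \<integral>x. V x * (D (mi1 i) x)\<^sup>2 \<partial>cube_measure)"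
  define R where "R = (\<integral>x. ((V x)\<^sup>2 - (\<Sum>i\<in>UNIV. W i x)) * (w x)\<^sup>2 \<partial>cube_measure)"
  have SH: "S \<le> H" "H \<le> 2 * S"
    unfolding S_def H_def by (rule sum_mi2_bounds; simp)+
  have norm: "Hk_norm_sq 2 unit_cube w = B + A + S"
  proof -
    have ae: "AE x in cube_measure. (D mi0 x)\<^sup>2 = (w x)\<^sup>2"
      using D0 by eventually_elim simp
    have "(\<integral>x. (D mi0 x)\<^sup>2 \<partial>cube_measure) = B"
      unfolding B_def using Dw[of "\<lambda>_. 0"] Lw
      by (intro integral_cong_AE[OF _ _ ae]) (auto simp: mi_order_0 L2_def)
    then show ?thesis
      unfolding Hk_norm_sq_def A_def S_def
      by (simp add: D_def[symmetric] sum_mi_order_le_2[of "\<lambda>\<alpha>. \<integral>x. (D \<alpha> x)\<^sup>2 \<partial>cube_measure"])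
  qed
  have nn: "0 \<le> A" "0 \<le> B" "0 \<le> S"
    unfolding A_def B_def S_def by (auto intro!: sum_nonneg)
  have E: "E_PINN unit_cube V f u - E_PINN unit_cube V f ustar = H + 2 * P + R"
  proof -
    have "E_PINN unit_cube V f ustar = 0"
      unfolding E_PINN_def
    proof (rule integral_eq_zero_AE)
      show "AE x in cube_measure. (wlap unit_cube ustar x - V x * ustar x + f x)\<^sup>2 = 0"
        using ustar_eq by eventually_elim simp
    qed
    moreover have "E_PINN unit_cube V f u = (\<integral>x. ((\<Sum>i\<in>UNIV. D (mi2 i i) x) - V x * w x)\<^sup>2 \<partial>cube_measure)"
      unfolding E_PINN_def
    proof (rule integral_cong_AE)
      have Vm: "V \<in> borel_measurable cube_measure" using V_Linf by (simp add: Linf_def)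
      have "wlap unit_cube u \<in> borel_measurable cube_measure"
        unfolding wlap_eq[abs_def] using Ld(1)[of "mi2 _ _"]
        by (intro borel_measurable_sum L2_measurable) (auto simp: mi_order_mi2)
      then show "(\<lambda>x. (wlap unit_cube u x - V x * u x + f x)\<^sup>2) \<in> borel_measurable cube_measure"
        using Vm L2_measurable[OF Lu(1)] L2_measurable[OF f_L2] by auto
      show "(\<lambda>x. ((\<Sum>i\<in>UNIV. D (mi2 i i) x) - V x * w x)\<^sup>2) \<in> borel_measurable cube_measure"
        using Vm L2_measurable[OF Lw] L2_measurable[OF D2] by auto
      have "AE x in cube_measure. \<forall>i. D (mi2 i i) x = wD unit_cube (mi2 i i) u x - wD unit_cube (mi2 i i) ustar x"
        by (rule eventually_all_finite) (rule Dae, simp add: mi_order_mi2)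
      with ustar_eq show "AE x in cube_measure. (wlap unit_cube u x - V x * u x + f x)\<^sup>2
          = ((\<Sum>i\<in>UNIV. D (mi2 i i) x) - V x * w x)\<^sup>2"
      proof eventually_elim
        case (elim x)
        then have "(\<Sum>i\<in>UNIV. D (mi2 i i) x) = wlap unit_cube u x - wlap unit_cube ustar x"
          by (simp add: wlap_eq sum_subtractf)
        moreover have "f x = - wlap unit_cube ustar x + V x * ustar x" using elim by simp
        ultimately have "wlap unit_cube u x - V x * u x + f x = (\<Sum>i\<in>UNIV. D (mi2 i i) x) - V x * w x"
          by (simp add: w_def algebra_simps)
        then show ?case by simp
      qed
    qed
    ultimately show ?thesis
      using energy_identity[OF Lw Dw bd V_Linf W L] by (simp add: H_def P_def R_def)
  qed
  have Vsq: "Linf unit_cube (\<lambda>x. (V x)\<^sup>2 - (\<Sum>i\<in>UNIV. W i x))"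
  proof -
    obtain C1 C2 where "AE x in cube_measure. \<bar>V x\<bar> \<le> C1" "AE x in cube_measure. \<bar>\<Sum>i\<in>UNIV. W i x\<bar> \<le> C2"
      using V_Linf L unfolding Linf_def by blast
    then have "AE x in cube_measure. \<bar>(V x)\<^sup>2 - (\<Sum>i\<in>UNIV. W i x)\<bar> \<le> C1\<^sup>2 + C2"
    proof eventually_elim
      case (elim x)
      have "(V x)\<^sup>2 \<le> C1\<^sup>2" using elim(1) by (metis abs_ge_zero power2_abs power_mono)
      then show ?case using elim(2) zero_le_power2[of "V x"] by linarith
    qed
    then show ?thesis using V_Linf L by (auto simp: Linf_def)
  qed
  have wt: "integrable cube_measure (\<lambda>x. a x * (g x)\<^sup>2)" if "Linf unit_cube a" "L2 unit_cube g" for a g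
    using L2_integrable_mult[OF L2_Linf_mult[OF that] that(2)] by (simp add: power2_eq_square mult.assoc)
  have lower: "c * (\<integral>x. (g x)\<^sup>2 \<partial>cube_measure) \<le> (\<integral>x. a x * (g x)\<^sup>2 \<partial>cube_measure)"
    if "Linf unit_cube a" "L2 unit_cube g" "AE x in cube_measure. c \<le> a x" for a g c
  proof -
    have "(\<integral>x. c * (g x)\<^sup>2 \<partial>cube_measure) \<le> (\<integral>x. a x * (g x)\<^sup>2 \<partial>cube_measure)"
    proof (rule integral_mono_AE)
      show "AE x in cube_measure. c * (g x)\<^sup>2 \<le> a x * (g x)\<^sup>2"
        using that(3) by eventually_elim (simp add: mult_right_mono)
    qed (use wt[OF that(1,2)] L2_integrable_sq[OF that(2)] in auto)
    then show ?thesis by simp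
  qed
  have upper: "(\<integral>x. a x * (g x)\<^sup>2 \<partial>cube_measure) \<le> c * (\<integral>x. (g x)\<^sup>2 \<partial>cube_measure)"
    if "Linf unit_cube a" "L2 unit_cube g" "AE x in cube_measure. a x \<le> c" for a g c
  proof -
    have "(\<integral>x. a x * (g x)\<^sup>2 \<partial>cube_measure) \<le> (\<integral>x. c * (g x)\<^sup>2 \<partial>cube_measure)"
    proof (rule integral_mono_AE)
      show "AE x in cube_measure. a x * (g x)\<^sup>2 \<le> c * (g x)\<^sup>2"
        using that(3) by eventually_elim (simp add: mult_right_mono)
    qed (use wt[OF that(1,2)] L2_integrable_sq[OF that(2)] in auto)
    then show ?thesis by simp
  qed
  have V1: "AE x in cube_measure. Cmin \<le> V x" "AE x in cube_measure. V x \<le> Vmax"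
    using V_bounds by (eventually_elim; simp)+
  have V2: "AE x in cube_measure. Cmin \<le> (V x)\<^sup>2 - (\<Sum>i\<in>UNIV. W i x)"
    using V_bounds unfolding lapW by eventually_elim simp
  have V3: "AE x in cube_measure. (V x)\<^sup>2 - (\<Sum>i\<in>UNIV. W i x) \<le> Vmax\<^sup>2 + Vmax"
    using V_bounds unfolding lapW
  proof eventually_elim
    case (elim x)
    then have "(V x)\<^sup>2 \<le> Vmax\<^sup>2" using Cmin_pos by (intro power_mono) auto
    then show ?case using elim by linarith
  qed
  have P1: "Cmin * A \<le> P" "P \<le> Vmax * A"
    unfolding P_def A_def sum_distrib_left
    by (intro sum_mono lower upper V_Linf D1 V1)+
  have R1: "Cmin * B \<le> R" "R \<le> (Vmax\<^sup>2 + Vmax) * B"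
    unfolding R_def B_def by (intro lower upper Vsq Lw V2 V3)+
  \<comment> \<open>The bounds on \<open>V\<close> hold almost everywhere, so a point satisfying
    them exists only because the cube is not a null set.\<close>
  have Vmax: "0 \<le> Vmax"
  proof (rule ccontr)
    assume "\<not> 0 \<le> Vmax"
    have "AE x in (cube_measure :: (real^'n) measure). False"
      by (rule eventually_mono[OF V_bounds]) (use \<open>\<not> 0 \<le> Vmax\<close> Cmin_pos in linarith)
    then have "AE x in lebesgue. x \<notin> (unit_cube :: (real^'n) set)"
      by (subst (asm) AE_restrict_space_iff) auto
    then have "negligible (unit_cube :: (real^'n) set)"
      by (simp add: negligible_iff_null_sets AE_iff_null_sets)
    then have "negligible (interior (unit_cube :: (real^'n) set))"
      by (rule negligible_subset) (rule interior_subset)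
    moreover have "(\<chi> i. 1/2) \<in> interior (unit_cube :: (real^'n) set)" by (simp add: interior_unit_cube)
    ultimately show False using open_not_negligible[OF open_interior] by blast
  qed
  let ?c = "min 1 Cmin" and ?C = "2 * (1 + Vmax + Vmax\<^sup>2)"
  \<comment> \<open>The gradient term contributes \<open>2 * Cmin * A\<close>, of which half is
    enough.\<close>
  have "?c * B + ?c * A + ?c * S \<le> H + 2 * P + R"
  proof -
    have "?c * B \<le> Cmin * B" "?c * A \<le> Cmin * A" "?c * S \<le> 1 * S"
      using nn by (intro mult_right_mono; simp)+
    moreover have "0 \<le> Cmin * A" using Cmin_pos nn by simp
    ultimately show ?thesis using P1(1) R1(1) SH(1) by linarith
  qed
  \<comment> \<open>Nonnegativity of \<open>Vmax\<close> makes
    \<open>2 * (1 + Vmax + Vmax^2)\<close> dominate all three coefficients; the 2 is attained by the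
    Hessian term already when \<open>Vmax\<close> is small.\<close>
  moreover have "H + 2 * P + R \<le> ?C * B + ?C * A + ?C * S"
  proof -
    have "(Vmax\<^sup>2 + Vmax) * B \<le> ?C * B" "(2 * Vmax) * A \<le> ?C * A" "2 * S \<le> ?C * S"
      using nn Vmax by (intro mult_right_mono; simp)+
    then show ?thesis using P1(2) R1(2) SH(2) by linarith
  qed
  ultimately show "min 1 Cmin * Hk_norm_sq 2 unit_cube (\<lambda>x. u x - ustar x)
       \<le> E_PINN unit_cube V f u - E_PINN unit_cube V f ustar
     \<and> E_PINN unit_cube V f u - E_PINN unit_cube V f ustar
       \<le> 2 * (1 + Vmax + Vmax\<^sup>2) * Hk_norm_sq 2 unit_cube (\<lambda>x. u x - ustar x)"
    using norm E unfolding w_def[abs_def] by (simp add: distrib_left)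
qed

end
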